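(* 1. All vertex-colored graphs of color multiplicity $4$ with at most $15$ vertices are amenable to the 2-dimensional Weisfeiler–Leman algorithm. 2. Up to isomorphism and renaming of colors, there are exactly $436$ vertex-colored graphs of color multiplicity $4$ with $16$ vertices that are not amenable to the 2-dimensional Weisfeiler–Leman algorithm. More precisely, among such graphs the number of 2-WL-equivalence classes containing more than one isomorphism type is $218$, and each of these classes consists of exactly two non-isomorphic graphs.
   Context: A vertex-colored graph is a finite undirected graph without loops or multiple edges together with a coloring of its vertices; isomorphisms must preserve adjacency and vertex colors. The color multiplicity is the maximum number of vertices sharing a color. Such a graph is viewed as a coloring $c_G$ of ordered pairs of vertices: $c_G(vv)$ is the color of $v$, and for $u\ne v$, $c_G(uv)$ records whether $u,v$ are adjacent. The 2-dimensional Weisfeiler–Leman algorithm (2-WL) computes $c^0_G=c_G$, $c^{i+1}_G(uv)=\big(c^i_G(uv),\{\!\{(c^i_G(uw),c^i_G(wv)):w\in V(G)\}\!\}\big)$ (canonically encoded) until the partition into color classes stabilizes at round $t$; graphs $G,H$ are 2-WL-equivalent if the multisets of final colors $\{\!\{c^t_G(uv)\}\!\}$ and $\{\!\{c^t_H(uv)\}\!\}$ over all ordered pairs coincide. $G$ is amenable to 2-WL if every graph $H$ that is 2-WL-equivalent to $G$ is isomorphic to $G$. *)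

theory Defs
  imports "Graph_Theory.Pair_Digraph" "HOL-Library.Multiset"
begin

section \<open>Vertex-colored graphs\<close>

record ('a, 'c) vc_graph =
  ugraph :: "'a pair_pre_digraph"
  vcol :: "'a \<Rightarrow> 'c"

abbreviation V :: "('a, 'c) vc_graph \<Rightarrow> 'a set" where
  "V G \<equiv> pverts (ugraph G)"

abbreviation adj :: "('a, 'c) vc_graph \<Rightarrow> 'a \<Rightarrow> 'a \<Rightarrow> bool" where
  "adj G u v \<equiv> (u, v) \<in> parcs (ugraph G)"

text \<open>
  The locale predicate \<open>pair_graph\<close> says: finitely many vertices, and the arc set is a symmetric,
  irreflexive relation on them. Values of \<open>vcol\<close> outside the vertex set are irrelevant; all
  notions below depend on the colors of vertices only.
\<close>

definition is_vc_graph :: "('a, 'c) vc_graph \<Rightarrow> bool" where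
  "is_vc_graph G \<longleftrightarrow> pair_graph (ugraph G)"

definition vc_iso :: "('a, 'c) vc_graph \<Rightarrow> ('b, 'c) vc_graph \<Rightarrow> bool" where
  "vc_iso G H \<longleftrightarrow> (\<exists>f. bij_betw f (V G) (V H) \<and>
     (\<forall>u \<in> V G. \<forall>v \<in> V G. adj G u v \<longleftrightarrow> adj H (f u) (f v)) \<and>
     (\<forall>v \<in> V G. vcol H (f v) = vcol G v))"

text \<open>The inserted \<open>0\<close> only serves to give the empty graph color multiplicity 0.\<close>

definition color_multiplicity :: "('a, 'c) vc_graph \<Rightarrow> nat" where
  "color_multiplicity G = Max (insert 0 ((\<lambda>c. card {v \<in> V G. vcol G v = c}) ` vcol G ` V G))"

definition recolor :: "('c \<Rightarrow> 'd) \<Rightarrow> ('a, 'c) vc_graph \<Rightarrow> ('a, 'd) vc_graph" where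
  "recolor p G = \<lparr>ugraph = ugraph G, vcol = p \<circ> vcol G\<rparr>"


section \<open>The 2-dimensional Weisfeiler--Leman algorithm\<close>

text \<open>
  Colors of ordered pairs are kept as hereditary terms, with no renaming between rounds. This is
  the canonical encoding: it is the same for all graphs, so colors of pairs taken from
  different graphs can be compared.
\<close>

datatype 'c pair_color =
    Vertex_Color 'c
  | Adjacent
  | Nonadjacent
  | Refined "'c pair_color" "('c pair_color \<times> 'c pair_color) multiset"

definition initial_color :: "('a, 'c) vc_graph \<Rightarrow> 'a \<Rightarrow> 'a \<Rightarrow> 'c pair_color" where
  "initial_color G u v =
     (if u = v then Vertex_Color (vcol G v) else if adj G u v then Adjacent else Nonadjacent)"

primrec wl2_color :: "('a, 'c) vc_graph \<Rightarrow> nat \<Rightarrow> 'a \<Rightarrow> 'a \<Rightarrow> 'c pair_color" where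
  "wl2_color G 0 u v = initial_color G u v"
| "wl2_color G (Suc i) u v =
     Refined (wl2_color G i u v)
       (image_mset (\<lambda>w. (wl2_color G i u w, wl2_color G i w v)) (mset_set (V G)))"

definition wl2_palette :: "('a, 'c) vc_graph \<Rightarrow> nat \<Rightarrow> 'c pair_color multiset" where
  "wl2_palette G i = image_mset (\<lambda>(u, v). wl2_color G i u v) (mset_set (V G \<times> V G))"

text \<open>
  To compare \<open>G\<close> and \<open>H\<close> the algorithm runs on both of them in parallel, and it stops in the first
  round \<open>t\<close> that is stable for the color partition of the pairs of \<open>G\<close> and \<open>H\<close> taken together.
  Stopping when the two partitions are stable separately would be too early: the colors of round
  \<open>t\<close> count over the classes of round \<open>t - 1\<close>, hence do not record the intersection numbers of the
  partition of round \<open>t\<close>. For example, any two strongly regular graphs with the same numbers of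
  vertices and edges and with one vertex color are both stable in round 0.
\<close>

definition joint_color ::
    "('a, 'c) vc_graph \<Rightarrow> ('b, 'c) vc_graph \<Rightarrow> nat \<Rightarrow> ('a \<times> 'a) + ('b \<times> 'b) \<Rightarrow> 'c pair_color" where
  "joint_color G H i = case_sum (\<lambda>(u, v). wl2_color G i u v) (\<lambda>(u, v). wl2_color H i u v)"

definition wl2_stable :: "('a, 'c) vc_graph \<Rightarrow> ('b, 'c) vc_graph \<Rightarrow> nat \<Rightarrow> bool" where
  "wl2_stable G H i \<longleftrightarrow>
     (\<forall>x \<in> (V G \<times> V G) <+> (V H \<times> V H). \<forall>y \<in> (V G \<times> V G) <+> (V H \<times> V H).
        joint_color G H i x = joint_color G H i y \<longrightarrow>
        joint_color G H (Suc i) x = joint_color G H (Suc i) y)"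

definition wl2_equivalent :: "('a, 'c) vc_graph \<Rightarrow> ('b, 'c) vc_graph \<Rightarrow> bool" where
  "wl2_equivalent G H \<longleftrightarrow>
     (let t = (LEAST t. wl2_stable G H t) in wl2_palette G t = wl2_palette H t)"

text \<open>
  Every finite graph has an isomorphic copy on natural numbers, so letting \<open>H\<close> range over the
  graphs with vertices in \<open>nat\<close> is no restriction. Nor is the common color type: a graph
  equivalent to \<open>G\<close> uses exactly the colors of \<open>G\<close>.
\<close>

definition wl2_amenable :: "('a, 'c) vc_graph \<Rightarrow> bool" where
  "wl2_amenable G \<longleftrightarrow>
     (\<forall>H :: (nat, 'c) vc_graph. is_vc_graph H \<longrightarrow> wl2_equivalent G H \<longrightarrow> vc_iso G H)"


section \<open>Counting up to isomorphism and renaming of colors\<close>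

definition iso_rel :: "('a, 'c) vc_graph rel" where
  "iso_rel = {(G, H). is_vc_graph G \<and> is_vc_graph H \<and> vc_iso G H}"

text \<open>
  Graphs use finitely many colors, so every renaming of the colors in use that is injective
  extends to a bijection of the color type.
\<close>

definition iso_renaming_rel :: "('a, 'c) vc_graph rel" where
  "iso_renaming_rel =
     {(G, H). is_vc_graph G \<and> is_vc_graph H \<and> (\<exists>p. bij p \<and> vc_iso (recolor p G) H)}"

definition wl2_rel :: "('a, 'c) vc_graph rel" where
  "wl2_rel = {(G, H). is_vc_graph G \<and> is_vc_graph H \<and> wl2_equivalent G H}"

text \<open>Renaming of colors, acting on whole equivalence classes of graphs.\<close>

definition class_renaming_rel :: "('a, 'c) vc_graph set rel" where
  "class_renaming_rel = {(K, L). \<exists>p. bij p \<and> L = recolor p ` K}"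

text \<open>
  \<open>vc_graphs n m\<close>: the graphs with \<open>n\<close> vertices and color multiplicity \<open>m\<close>, with vertices and
  colors in \<open>nat\<close>.
\<close>

definition vc_graphs :: "nat \<Rightarrow> nat \<Rightarrow> (nat, nat) vc_graph set" where
  "vc_graphs n m = {G. is_vc_graph G \<and> card (V G) = n \<and> color_multiplicity G = m}"

definition ambiguous_wl2_classes :: "nat \<Rightarrow> nat \<Rightarrow> (nat, nat) vc_graph set set" where
  "ambiguous_wl2_classes n m =
     {K \<in> vc_graphs n m // wl2_rel. \<exists>G \<in> K. \<exists>H \<in> K. \<not> vc_iso G H}"

end

theory Submission
  imports Defs "HOL-Combinatorics.Multiset_Permutations"
begin

text \<open>
  Let \<open>G\<close> and \<open>H\<close> be equivalent, and call the classes of the stable vertex coloring fibers; they have at most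
  four elements. A fiber onto which a pair color induces a function from another fiber can be removed:
  an isomorphism of the remaining parts extends to it. In what is left, two fibers are joined either
  uniformly or, both having size 4, by \<open>2K\<^sub>2\<^sub>,\<^sub>2\<close> or by an 8-cycle. If base points, one in each fiber, can be chosen
  in \<open>G\<close> and \<open>H\<close> such that corresponding pairs have equal colors, then they extend to an isomorphism.
  Such base points exist for three fibers because colors of pairs determine the colors of triangles. With four fibers
  of size 4 (and then \<open>G\<close> has 16 vertices) they exist too, unless all six pairs are joined by edges forming
  \<open>2K\<^sub>2\<^sub>,\<^sub>2\<close> that induce three different matchings in every fiber. Then \<open>G\<close> is a Cai-Fuerer-Immerman
  graph over \<open>K\<^sub>4\<close>, determined up to isomorphism and color names by one bit, the twist, and by telling
  for each fiber which of its matchings, named by the three other fibers, consist of edges. The latter is a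
  loopless digraph on four points; up to isomorphism there are 218 of them.
\<close>

section \<open>Refinement of colors\<close>

text \<open>A color of a pair is taken to be the whole sequence of its colors over all rounds, and
  \<open>G\<close> and \<open>H\<close> are treated as one configuration on a disjoint union; so the
  stopping round disappears and the structure theory speaks of both graphs at once. The argument
  rests on one extension property: a triangle over a pair of vertices can be copied onto every pair
  of the same color, in either graph. Triangles are all that it controls, hence base points can be
  matched in three fibers, while with four fibers one of the six pairs stays free; this is where the
  twist comes from. After the removal of determined fibers every color between linked fibers occurs
  at least twice in each row, and the bound four leaves two and two. The two twists are told apart
  by a clique with one vertex of each color: at every vertex three characters of the Klein group
  with trivial product occur, so an odd number of twisted pairs admits no such clique. Renamings of
  colors preserve this, so the twist doubles the count 218 of digraphs, which comes from Burnside's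
  lemma as 5232 / 24.\<close>

lemma image_mset_bijI:
  assumes "bij_betw f A B" "\<And>w. w \<in> A \<Longrightarrow> h (f w) = g w"
  shows "image_mset g (mset_set A) = image_mset h (mset_set B)"
proof -
  have "mset_set B = image_mset f (mset_set A)"
    using assms(1) by (metis bij_betw_def image_mset_mset_set)
  then have "image_mset h (mset_set B) = image_mset (h \<circ> f) (mset_set A)"
    by (simp add: multiset.map_comp)
  also have "\<dots> = image_mset g (mset_set A)"
    by (intro image_mset_cong) (metis assms(2) comp_apply elem_mset_set finite_set_mset_mset_set infinite_set_mset_mset_set empty_iff)
  finally show ?thesis ..
qed

text \<open>Turns equality of the multisets of a refinement step into a bijection of vertices; all
  later arguments use refinement in this form.\<close>

lemma image_mset_eq_bijE:
  assumes "finite A" "finite B" "image_mset g (mset_set A) = image_mset h (mset_set B)"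
  shows "\<exists>f. bij_betw f A B \<and> (\<forall>w\<in>A. h (f w) = g w)"
  using assms
proof (induction A arbitrary: B rule: finite_induct)
  case empty
  then have "B = {}" by (simp add: mset_set_empty_iff)
  then show ?case by (auto simp: bij_betw_def)
next
  case (insert a A)
  have "g a \<in># image_mset h (mset_set B)"
    using insert.hyps insert.prems(2) by (metis image_mset_add_mset mset_set.insert union_single_eq_member)
  then obtain b where b: "b \<in> B" "h b = g a" using insert.prems(1) by auto
  have B: "mset_set B = add_mset b (mset_set (B - {b}))"
    using b(1) insert.prems(1) by (metis mset_set.remove)
  have "image_mset g (mset_set A) = image_mset h (mset_set (B - {b}))"
    using insert.hyps insert.prems(2) b by (simp add: B)
  then obtain f where f: "bij_betw f A (B - {b})" "\<forall>w\<in>A. h (f w) = g w"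
    using insert.IH insert.prems(1) by (meson finite_Diff)
  have "bij_betw (f(a := b)) (insert a A) (insert b (B - {b}))"
    using f(1) insert.hyps(2) by (auto simp: bij_betw_def inj_on_def)
  moreover have "insert b (B - {b}) = B" using b by auto
  moreover have "h ((f(a := b)) w) = g w" if "w \<in> insert a A" for w
    using f(2) b(2) that by (cases "w = a") auto
  ultimately show ?case by metis
qed

section \<open>Color refinement on a finite family of vertex sets\<close>

text \<open>Several vertex sets share one coloring, so colors of pairs from different graphs are
  compared by one argument. The index type is finite so that there are finitely many pairs in total,
  which stabilization needs.\<close>

locale wl_family =
  fixes W :: "'g::finite \<Rightarrow> 's set" and e :: "nat \<Rightarrow> 's \<Rightarrow> 's \<Rightarrow> 'c pair_color"
  assumes fin: "finite (W g)"
    and rec: "x \<in> W g \<Longrightarrow> y \<in> W g \<Longrightarrow>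
      e (Suc i) x y = Refined (e i x y) (image_mset (\<lambda>w. (e i x w, e i w y)) (mset_set (W g)))"
begin

text \<open>A refined color contains its predecessor, so pairs once separated stay
  separated.\<close>

lemma color_downward:
  assumes "x \<in> W g" "y \<in> W g" "x' \<in> W h" "y' \<in> W h" "e i x y = e i x' y'" "j \<le> i"
  shows "e j x y = e j x' y'"
  using assms(6,5)
proof (induction i rule: dec_induct)
  case (step n)
  then show ?case using rec[OF assms(1,2), of n] rec[OF assms(3,4), of n] by simp
qed

lemma color_Suc_bij:
  assumes "x \<in> W g" "y \<in> W g" "x' \<in> W h" "y' \<in> W h" "e (Suc i) x y = e (Suc i) x' y'"
  shows "\<exists>f. bij_betw f (W g) (W h) \<and> (\<forall>w\<in>W g. e i x' (f w) = e i x w \<and> e i (f w) y' = e i w y)"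
proof -
  have "image_mset (\<lambda>w. (e i x w, e i w y)) (mset_set (W g)) = image_mset (\<lambda>w. (e i x' w, e i w y')) (mset_set (W h))"
    using assms(5) rec[OF assms(1,2), of i] rec[OF assms(3,4), of i] by simp
  from image_mset_eq_bijE[OF fin fin this] show ?thesis by auto
qed

lemma color_SucI:
  assumes "x \<in> W g" "y \<in> W g" "x' \<in> W h" "y' \<in> W h" "e i x y = e i x' y'"
    and "bij_betw f (W g) (W h)" "\<And>w. w \<in> W g \<Longrightarrow> e i x' (f w) = e i x w \<and> e i (f w) y' = e i w y"
  shows "e (Suc i) x y = e (Suc i) x' y'"
proof -
  have "image_mset (\<lambda>w. (e i x w, e i w y)) (mset_set (W g)) = image_mset (\<lambda>w. (e i x' w, e i w y')) (mset_set (W h))"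
    by (rule image_mset_bijI[OF assms(6)]) (use assms(7) in auto)
  then show ?thesis using assms(5) rec[OF assms(1,2), of i] rec[OF assms(3,4), of i] by simp
qed

definition stable_at :: "nat \<Rightarrow> bool" where
  "stable_at t \<longleftrightarrow> (\<forall>g h. \<forall>x\<in>W g. \<forall>y\<in>W g. \<forall>x'\<in>W h. \<forall>y'\<in>W h. e t x y = e t x' y' \<longrightarrow> e (Suc t) x y = e (Suc t) x' y')"

text \<open>The bijection that witnesses equality in round \<open>Suc t\<close> matches colors of
  round \<open>t\<close>; by induction it matches those of round \<open>s\<close> as well and so
  witnesses equality in round \<open>Suc s\<close>.\<close>

lemma stable_atD:
  assumes "stable_at t" "x \<in> W g" "y \<in> W g" "x' \<in> W h" "y' \<in> W h" "e t x y = e t x' y'"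
  shows "e s x y = e s x' y'"
proof (cases "s \<le> t")
  case True
  then show ?thesis using color_downward assms by blast
next
  case False
  then have "t \<le> s" by simp
  then show ?thesis using assms(2-)
  proof (induction arbitrary: g h x y x' y' rule: dec_induct)
    case base
    then show ?case by simp
  next
    case (step s)
    then have "e (Suc t) x y = e (Suc t) x' y'" using assms(1) unfolding stable_at_def by blast
    from color_Suc_bij[OF step.prems(1-4) this] obtain f where
      f: "bij_betw f (W g) (W h)" "\<And>w. w\<in>W g \<Longrightarrow> e t x' (f w) = e t x w \<and> e t (f w) y' = e t w y" by blast
    have fW: "f w \<in> W h" if "w \<in> W g" for w using f(1) that by (auto simp: bij_betw_def)
    show ?case
    proof (rule color_SucI[OF step.prems(1-4) _ f(1)])
      show "e s x y = e s x' y'" using step by blast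
      show "e s x' (f w) = e s x w \<and> e s (f w) y' = e s w y" if "w \<in> W g" for w
        using step.IH[of x' h "f w" x g w] step.IH[of "f w" h y' w g y] f(2)[OF that] fW[OF that] that step.prems
        by auto
    qed
  qed
qed

text \<open>Only finitely many quadruples of vertices are ever separated. For each of them a
  separating round is chosen; the maximum of these rounds is stable.\<close>

lemma stable_exists: "\<exists>t. stable_at t"
proof -
  define A where "A = (\<Union>g. W g)"
  have finA: "finite A" unfolding A_def using fin by auto
  define Q where "Q = {q \<in> A \<times> A \<times> A \<times> A. case q of (x, y, x', y') \<Rightarrow> \<exists>i. e i x y \<noteq> e i x' y'}"
  have finQ: "finite Q" unfolding Q_def using finA by auto
  have "\<forall>q\<in>Q. \<exists>i. case q of (x, y, x', y') \<Rightarrow> e i x y \<noteq> e i x' y'" unfolding Q_def by auto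
  then obtain n where n: "\<forall>q\<in>Q. case q of (x, y, x', y') \<Rightarrow> e (n q) x y \<noteq> e (n q) x' y'" by metis
  have "stable_at (Max (insert 0 (n ` Q)))" (is "stable_at ?N")
    unfolding stable_at_def
  proof (intro allI ballI impI, rule ccontr)
    fix g h x y x' y'
    assume W: "x \<in> W g" "y \<in> W g" "x' \<in> W h" "y' \<in> W h" and eq: "e ?N x y = e ?N x' y'"
      and "e (Suc ?N) x y \<noteq> e (Suc ?N) x' y'"
    then have q: "(x, y, x', y') \<in> Q" unfolding Q_def A_def by blast
    then have "n (x, y, x', y') \<le> ?N" using finQ by (intro Max_ge) auto
    with color_downward[OF W eq] n q show False by blast
  qed
  then show ?thesis ..
qed

text \<open>The bijection for the round after a stable one matches colors of the stable round, hence
  of all rounds at once.\<close>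

lemma limit_color_bij:
  assumes W: "x \<in> W g" "y \<in> W g" "x' \<in> W h" "y' \<in> W h" and eq: "\<And>i. e i x y = e i x' y'"
  shows "\<exists>f. bij_betw f (W g) (W h) \<and> (\<forall>w\<in>W g. \<forall>i. e i x' (f w) = e i x w \<and> e i (f w) y' = e i w y)"
proof -
  obtain t where t: "stable_at t" using stable_exists by blast
  from color_Suc_bij[OF W eq] obtain f where
      f: "bij_betw f (W g) (W h)" "\<And>w. w\<in>W g \<Longrightarrow> e t x' (f w) = e t x w \<and> e t (f w) y' = e t w y" by blast
  have fW: "f w \<in> W h" if "w \<in> W g" for w using f(1) that by (auto simp: bij_betw_def)
  have "e i x' (f w) = e i x w \<and> e i (f w) y' = e i w y" if w: "w \<in> W g" for w i
    using stable_atD[OF t W(3) fW[OF w] W(1) w, of i] stable_atD[OF t fW[OF w] W(4) w W(2), of i] f(2)[OF w] by simp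
  with f(1) show ?thesis by blast
qed

end

section \<open>Two graphs refined in parallel\<close>

definition joint_vertices :: "('a, 'c) vc_graph \<Rightarrow> ('b, 'c) vc_graph \<Rightarrow> bool \<Rightarrow> ('a + 'b) set" where
  "joint_vertices G H g = (if g then Inr ` V H else Inl ` V G)"

text \<open>Mixed pairs get \<open>undefined\<close>, since the recursion is required only of pairs
  inside one vertex set.\<close>

fun joint_pair_color :: "('a, 'c) vc_graph \<Rightarrow> ('b, 'c) vc_graph \<Rightarrow> nat \<Rightarrow> 'a + 'b \<Rightarrow> 'a + 'b \<Rightarrow> 'c pair_color" where
  "joint_pair_color G H i (Inl u) (Inl v) = wl2_color G i u v"
| "joint_pair_color G H i (Inr u) (Inr v) = wl2_color H i u v"
| "joint_pair_color G H i _ _ = undefined"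

lemma is_vc_graph_iff:
  "is_vc_graph G \<longleftrightarrow> finite (V G) \<and> (\<forall>u v. adj G u v \<longrightarrow> u \<in> V G \<and> v \<in> V G \<and> u \<noteq> v \<and> adj G v u)"
proof
  assume "is_vc_graph G"
  then interpret pair_graph "ugraph G" unfolding is_vc_graph_def .
  have "sym (parcs (ugraph G))" using sym_arcs unfolding symmetric_def arcs_ends_def by (simp add: arc_to_ends_def)
  then show "finite (V G) \<and> (\<forall>u v. adj G u v \<longrightarrow> u \<in> V G \<and> v \<in> V G \<and> u \<noteq> v \<and> adj G v u)"
    using pair_finite_verts arc_fst_in_verts arc_snd_in_verts pair_no_loops unfolding sym_def by fastforce
next
  assume *: "finite (V G) \<and> (\<forall>u v. adj G u v \<longrightarrow> u \<in> V G \<and> v \<in> V G \<and> u \<noteq> v \<and> adj G v u)"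
  then have "parcs (ugraph G) \<subseteq> V G \<times> V G" by auto
  then have "finite (parcs (ugraph G))" using * finite_subset by blast
  with * show "is_vc_graph G" unfolding is_vc_graph_def
    by unfold_locales (auto simp: symmetric_def arcs_ends_def sym_def arc_to_ends_def)
qed

lemma is_vc_graph_finite: "is_vc_graph G \<Longrightarrow> finite (V G)"
  unfolding is_vc_graph_iff by blast

lemma is_vc_graph_adj_sym: "is_vc_graph G \<Longrightarrow> adj G u v \<longleftrightarrow> adj G v u"
  unfolding is_vc_graph_iff by blast

lemma wl_family_joint:
  assumes "finite (V G)" "finite (V H)"
  shows "wl_family (joint_vertices G H) (joint_pair_color G H)"
proof
  show "finite (joint_vertices G H g)" for g using assms by (auto simp: joint_vertices_def)
  show "joint_pair_color G H (Suc i) x y = Refined (joint_pair_color G H i x y)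
     (image_mset (\<lambda>w. (joint_pair_color G H i x w, joint_pair_color G H i w y)) (mset_set (joint_vertices G H g)))"
    if "x \<in> joint_vertices G H g" "y \<in> joint_vertices G H g" for x y g i
  proof -
    have "mset_set (Inl ` V G) = image_mset Inl (mset_set (V G))" "mset_set (Inr ` V H) = image_mset Inr (mset_set (V H))"
      by (rule image_mset_mset_set[symmetric], simp)+
    note eqs = this
    show ?thesis
    proof (cases g)
      case True
      then obtain u v where uv: "x = Inr u" "y = Inr v" using \<open>x \<in> _\<close> \<open>y \<in> _\<close> by (auto simp: joint_vertices_def)
      have "joint_vertices G H g = Inr ` V H" using True by (simp add: joint_vertices_def)
      then show ?thesis unfolding uv by (simp add: eqs image_mset.compositionality comp_def)
    next
      case False
      then obtain u v where uv: "x = Inl u" "y = Inl v" using \<open>x \<in> _\<close> \<open>y \<in> _\<close> by (auto simp: joint_vertices_def)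
      have "joint_vertices G H g = Inl ` V G" using False by (simp add: joint_vertices_def)
      then show ?thesis unfolding uv by (simp add: eqs image_mset.compositionality comp_def)
    qed
  qed
qed

lemma wl2_stable_iff:
  assumes "finite (V G)" "finite (V H)"
  shows "wl2_stable G H t \<longleftrightarrow> wl_family.stable_at (joint_vertices G H) (joint_pair_color G H) t"
proof -
  interpret wl_family "joint_vertices G H" "joint_pair_color G H" by (rule wl_family_joint[OF assms])
  have *: "wl2_stable G H t \<longleftrightarrow> (\<forall>g h. \<forall>x\<in>joint_vertices G H g. \<forall>y\<in>joint_vertices G H g. \<forall>x'\<in>joint_vertices G H h. \<forall>y'\<in>joint_vertices G H h.
    joint_pair_color G H t x y = joint_pair_color G H t x' y' \<longrightarrow> joint_pair_color G H (Suc t) x y = joint_pair_color G H (Suc t) x' y')"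
    unfolding wl2_stable_def joint_color_def joint_vertices_def all_bool_eq
    by (simp add: Plus_def ball_Un) blast
  show ?thesis unfolding * stable_at_def ..
qed

text \<open>Agreement in a stable round gives agreement in all rounds, so the stopping round can be
  traded for a matching of pairs that preserves every round color.\<close>

lemma wl2_equivalent_iff:
  assumes "finite (V G)" "finite (V H)"
  shows "wl2_equivalent G H \<longleftrightarrow> (\<exists>F. bij_betw F (V G \<times> V G) (V H \<times> V H) \<and>
    (\<forall>u\<in>V G. \<forall>v\<in>V G. \<forall>i. wl2_color H i (fst (F (u, v))) (snd (F (u, v))) = wl2_color G i u v))"
proof -
  interpret wl_family "joint_vertices G H" "joint_pair_color G H" by (rule wl_family_joint[OF assms])
  define t where "t = (LEAST t. wl2_stable G H t)"
  have "stable_at t"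
    using stable_exists LeastI_ex[of "wl2_stable G H"] unfolding t_def wl2_stable_iff[OF assms] by blast
  have lim: "wl2_color G s u v = wl2_color H s u' v'" if "u \<in> V G" "v \<in> V G" "u' \<in> V H" "v' \<in> V H"
    "wl2_color G t u v = wl2_color H t u' v'" for s u v u' v'
    using stable_atD[OF \<open>stable_at t\<close>, of "Inl u" False "Inl v" "Inr u'" True "Inr v'" s] that
    by (simp add: joint_vertices_def)
  show ?thesis
  proof
    assume "wl2_equivalent G H"
    then have "wl2_palette G t = wl2_palette H t" unfolding wl2_equivalent_def t_def Let_def .
    from image_mset_eq_bijE[OF _ _ this[unfolded wl2_palette_def]] assms
    obtain F where F: "bij_betw F (V G \<times> V G) (V H \<times> V H)"
       "\<forall>w\<in>V G \<times> V G. (case F w of (u, v) \<Rightarrow> wl2_color H t u v) = (case w of (u, v) \<Rightarrow> wl2_color G t u v)"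
      by auto
    have "F (u, v) \<in> V H \<times> V H" if "u \<in> V G" "v \<in> V G" for u v
      using bij_betwE[OF F(1)] that by blast
    then have "wl2_color H i (fst (F (u, v))) (snd (F (u, v))) = wl2_color G i u v" if "u \<in> V G" "v \<in> V G" for u v i
      using lim[of u v "fst (F (u, v))" "snd (F (u, v))" i] F(2)[rule_format, of "(u, v)"] that
      by (auto simp: case_prod_beta mem_Times_iff)
    with F(1) show "\<exists>F. bij_betw F (V G \<times> V G) (V H \<times> V H) \<and>
    (\<forall>u\<in>V G. \<forall>v\<in>V G. \<forall>i. wl2_color H i (fst (F (u, v))) (snd (F (u, v))) = wl2_color G i u v)" by blast
  next
    assume "\<exists>F. bij_betw F (V G \<times> V G) (V H \<times> V H) \<and>
    (\<forall>u\<in>V G. \<forall>v\<in>V G. \<forall>i. wl2_color H i (fst (F (u, v))) (snd (F (u, v))) = wl2_color G i u v)"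
    then obtain F where F: "bij_betw F (V G \<times> V G) (V H \<times> V H)"
      "\<And>u v i. u\<in>V G \<Longrightarrow> v\<in>V G \<Longrightarrow> wl2_color H i (fst (F (u, v))) (snd (F (u, v))) = wl2_color G i u v" by blast
    have "wl2_palette G t = wl2_palette H t" unfolding wl2_palette_def
      by (rule image_mset_bijI[OF F(1)]) (use F(2) in \<open>auto simp: case_prod_beta\<close>)
    then show "wl2_equivalent G H" unfolding wl2_equivalent_def t_def Let_def .
  qed
qed

text \<open>The stopping round depends on both graphs; comparing palettes in all rounds does not
  refer to it, which makes symmetry and transitivity evident.\<close>

lemma wl2_equivalent_iff_palette:
  assumes "finite (V G)" "finite (V H)"
  shows "wl2_equivalent G H \<longleftrightarrow> (\<forall>i. wl2_palette G i = wl2_palette H i)"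
proof
  assume "wl2_equivalent G H"
  then obtain F where F: "bij_betw F (V G \<times> V G) (V H \<times> V H)"
    "\<forall>u\<in>V G. \<forall>v\<in>V G. \<forall>i. wl2_color H i (fst (F (u, v))) (snd (F (u, v))) = wl2_color G i u v"
    unfolding wl2_equivalent_iff[OF assms] by blast
  show "\<forall>i. wl2_palette G i = wl2_palette H i"
    unfolding wl2_palette_def
  proof (intro allI image_mset_bijI[OF F(1)])
    fix i w assume "w \<in> V G \<times> V G"
    then obtain u v where "w = (u, v)" "u \<in> V G" "v \<in> V G" by blast
    with F(2) show "(case F w of (u, v) \<Rightarrow> wl2_color H i u v) = (case w of (u, v) \<Rightarrow> wl2_color G i u v)"
      by (simp add: case_prod_beta)
  qed
qed (simp add: wl2_equivalent_def Let_def)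

lemma wl2_equivalent_sym:
  assumes "finite (V G)" "finite (V H)" "wl2_equivalent G H"
  shows "wl2_equivalent H G"
  using assms(3) unfolding wl2_equivalent_iff_palette[OF assms(1,2)] wl2_equivalent_iff_palette[OF assms(2,1)] by simp

lemma wl2_equivalent_trans:
  assumes "finite (V G)" "finite (V H)" "finite (V K)" "wl2_equivalent G H" "wl2_equivalent H K"
  shows "wl2_equivalent G K"
  using assms(4,5) unfolding wl2_equivalent_iff_palette[OF assms(1,2)] wl2_equivalent_iff_palette[OF assms(2,3)]
    wl2_equivalent_iff_palette[OF assms(1,3)] by simp

lemma wl2_color_bij:
  assumes "bij_betw f (V G) (V H)" "\<And>u v. u\<in>V G \<Longrightarrow> v\<in>V G \<Longrightarrow> initial_color H (f u) (f v) = initial_color G u v"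
    "u \<in> V G" "v \<in> V G"
  shows "wl2_color H i (f u) (f v) = wl2_color G i u v"
  using assms(3,4)
proof (induction i arbitrary: u v)
  case 0
  then show ?case using assms by simp
next
  case (Suc i)
  then show ?case using image_mset_bijI[OF assms(1), of "\<lambda>w. (wl2_color H i (f u) w, wl2_color H i w (f v))" "\<lambda>w. (wl2_color G i u w, wl2_color G i w v)"]
    by simp
qed

lemma vc_iso_wl2_equivalent:
  assumes "finite (V G)" "finite (V H)" "vc_iso G H"
  shows "wl2_equivalent G H"
proof -
  obtain f where f: "bij_betw f (V G) (V H)" "\<forall>u \<in> V G. \<forall>v \<in> V G. adj G u v \<longleftrightarrow> adj H (f u) (f v)"
     "\<forall>v \<in> V G. vcol H (f v) = vcol G v" using assms(3) unfolding vc_iso_def by blast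
  have "wl2_color H i (f u) (f v) = wl2_color G i u v" if "u \<in> V G" "v \<in> V G" for i u v
    by (rule wl2_color_bij[OF f(1) _ that])
      (use f in \<open>auto simp: initial_color_def bij_betw_def inj_on_eq_iff\<close>)
  then show ?thesis unfolding wl2_equivalent_iff[OF assms(1,2)]
    by (intro exI[of _ "map_prod f f"]) (use f(1) in \<open>auto intro!: bij_betw_map_prod\<close>)
qed

lemma vc_iso_refl: "vc_iso G G"
  unfolding vc_iso_def by (rule exI[of _ id]) auto

lemma vc_iso_sym:
  assumes "vc_iso G H"
  shows "vc_iso H G"
proof -
  obtain f where f: "bij_betw f (V G) (V H)" "\<forall>u \<in> V G. \<forall>v \<in> V G. adj G u v \<longleftrightarrow> adj H (f u) (f v)"
     "\<forall>v \<in> V G. vcol H (f v) = vcol G v" using assms unfolding vc_iso_def by blast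
  let ?h = "inv_into (V G) f"
  have h: "?h v \<in> V G" "f (?h v) = v" if "v \<in> V H" for v
    using f(1) that bij_betw_inv_into_right[of f "V G" "V H" v] bij_betwE[OF bij_betw_inv_into[OF f(1)]] by auto
  show ?thesis unfolding vc_iso_def
    by (rule exI[of _ ?h]) (use f h bij_betw_inv_into[OF f(1)] in \<open>simp, metis\<close>)
qed

lemma vc_iso_trans:
  assumes "vc_iso G H" "vc_iso H K"
  shows "vc_iso G K"
proof -
  obtain f where f: "bij_betw f (V G) (V H)" "\<forall>u \<in> V G. \<forall>v \<in> V G. adj G u v \<longleftrightarrow> adj H (f u) (f v)"
     "\<forall>v \<in> V G. vcol H (f v) = vcol G v" using assms(1) unfolding vc_iso_def by blast
  obtain h where h: "bij_betw h (V H) (V K)" "\<forall>u \<in> V H. \<forall>v \<in> V H. adj H u v \<longleftrightarrow> adj K (h u) (h v)"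
     "\<forall>v \<in> V H. vcol K (h v) = vcol H v" using assms(2) unfolding vc_iso_def by blast
  have fV: "f v \<in> V H" if "v \<in> V G" for v using f(1) that by (auto dest: bij_betwE)
  show ?thesis unfolding vc_iso_def
    by (rule exI[of _ "h \<circ> f"]) (use f h fV bij_betw_trans[OF f(1) h(1)] in simp)
qed

section \<open>Pairs of coherent configurations with small fibers\<close>

text \<open>The limit colors of two equivalent graphs, abstractly; \<open>False\<close> is the side
  of \<open>G\<close> and \<open>True\<close> that of \<open>H\<close>. The assumption
  \<open>ext\<close> is coherence: with \<open>g = h\<close> it says that intersection numbers are
  well defined, with \<open>g \<noteq> h\<close> that they are the same on both sides.\<close>

locale coherent_pair =
  fixes W :: "bool \<Rightarrow> 's set" and c :: "'s \<Rightarrow> 's \<Rightarrow> 'k"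
  assumes fin: "finite (W g)"
    and ext: "\<lbrakk>x \<in> W g; y \<in> W g; x' \<in> W h; y' \<in> W h; c x y = c x' y'\<rbrakk> \<Longrightarrow>
      \<exists>f. bij_betw f (W g) (W h) \<and> (\<forall>w\<in>W g. c x' (f w) = c x w \<and> c (f w) y' = c w y)"
    and diag: "\<lbrakk>x \<in> W g; y \<in> W g; z \<in> W h; c x y = c z z\<rbrakk> \<Longrightarrow> x = y"
    and transp: "\<lbrakk>x \<in> W g; y \<in> W g; x' \<in> W h; y' \<in> W h; c x y = c x' y'\<rbrakk> \<Longrightarrow> c y x = c y' x'"
    and card_fiber: "card {v \<in> W g. c v v = k} = card {v \<in> W h. c v v = k}"
    and card_fiber_le: "card {v \<in> W g. c v v = k} \<le> 4"
begin

definition F :: "bool \<Rightarrow> 'k \<Rightarrow> 's set" where "F g k = {v \<in> W g. c v v = k}"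

lemma F_W: "x \<in> F g k \<Longrightarrow> x \<in> W g" and F_c: "x \<in> F g k \<Longrightarrow> c x x = k"
  by (auto simp: F_def)

lemma FI: "x \<in> W g \<Longrightarrow> c x x = k \<Longrightarrow> x \<in> F g k" by (auto simp: F_def)

lemma finF [simp]: "finite (F g k)" using fin by (auto simp: F_def)

lemma card_F: "card (F g k) = card (F h k)" using card_fiber unfolding F_def .

lemma card_F_le: "card (F g k) \<le> 4" using card_fiber_le unfolding F_def .

text \<open>By \<open>diag\<close> only equal vertices carry a diagonal color, so the bijection of
  \<open>ext\<close> must send \<open>x\<close> to \<open>x'\<close> and \<open>y\<close> to
  \<open>y'\<close>.\<close>

lemma end_colors:
  assumes "x \<in> W g" "y \<in> W g" "x' \<in> W h" "y' \<in> W h" "c x y = c x' y'"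
  shows "c x x = c x' x'" "c y y = c y' y'"
proof -
  obtain f where f: "bij_betw f (W g) (W h)" "\<forall>w\<in>W g. c x' (f w) = c x w \<and> c (f w) y' = c w y"
    using ext[OF assms] by blast
  have W: "f x \<in> W h" "f y \<in> W h" using f(1) assms by (auto dest: bij_betwE)
  have "x' = f x" using diag[OF assms(3) W(1) assms(1)] f(2) assms(1) by blast
  then show "c x x = c x' x'" using f(2) assms(1) by metis
  have "f y = y'" using diag[OF W(2) assms(4) assms(2)] f(2) assms(2) by blast
  then show "c y y = c y' y'" using f(2) assms(2) by metis
qed

text \<open>Colors of pairs determine colors of triangles: the bijection of \<open>ext\<close> moves
  the apex \<open>w\<close>.\<close>

lemma ext_point:
  assumes "x \<in> W g" "y \<in> W g" "x' \<in> W h" "y' \<in> W h" "c x y = c x' y'" "w \<in> W g"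
  shows "\<exists>w'\<in>W h. c x' w' = c x w \<and> c w' y' = c w y \<and> c w' w' = c w w"
proof -
  obtain f where f: "bij_betw f (W g) (W h)" "\<forall>w\<in>W g. c x' (f w) = c x w \<and> c (f w) y' = c w y"
    using ext[OF assms(1-5)] by blast
  have "f w \<in> W h" using f(1) assms by (auto dest: bij_betwE)
  then show ?thesis using f(2) assms end_colors(2)[of x' h "f w" x g w] by auto
qed

lemma ext1:
  assumes "x \<in> F g k" "x' \<in> F h k"
  shows "\<exists>f. bij_betw f (W g) (W h) \<and> (\<forall>w\<in>W g. c x' (f w) = c x w \<and> c (f w) x' = c w x)"
  using ext[of x g x x' h x'] assms by (auto simp: F_def)

lemma ext_point1:
  assumes "x \<in> F g k" "x' \<in> F h k" "w \<in> W g"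
  shows "\<exists>w'\<in>W h. c x' w' = c x w \<and> c w' x' = c w x \<and> c w' w' = c w w"
  using ext_point[of x g x x' h x' w] assms by (auto simp: F_def)

text \<open>Respecting the colors from one vertex implies respecting diagonal colors, by
  \<open>end_colors\<close>; equal sizes of the fibers then give surjectivity.\<close>

lemma ext_fiber:
  assumes "bij_betw f (W g) (W h)" "x \<in> W g" "x' \<in> W h" "\<forall>w\<in>W g. c x' (f w) = c x w"
  shows "bij_betw f (F g k) (F h k)"
proof -
  have "c (f w) (f w) = c w w" "f w \<in> W h" if "w \<in> W g" for w
    using end_colors(2)[of x' h "f w" x g w] assms that by (auto dest: bij_betwE)
  then have "f ` F g k \<subseteq> F h k" by (auto simp: F_def)
  moreover have "inj_on f (F g k)" using assms(1) unfolding bij_betw_def F_def by (auto intro: inj_on_subset)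
  ultimately show ?thesis using card_F[of g k h] unfolding bij_betw_def by (simp add: card_image card_subset_eq)
qed

lemma row_card:
  assumes "x \<in> F g k" "x' \<in> F h k"
  shows "card {y \<in> F g l. c x y = r} = card {y \<in> F h l. c x' y = r}"
proof -
  obtain f where f: "bij_betw f (W g) (W h)" "\<forall>w\<in>W g. c x' (f w) = c x w \<and> c (f w) x' = c w x"
    using ext1[OF assms] by blast
  have "bij_betw f (F g l) (F h l)" using ext_fiber[OF f(1), of x x'] f(2) assms F_W by blast
  then have "bij_betw f {y \<in> F g l. c x y = r} {y \<in> F h l. c x' y = r}"
    using f(2) by (intro bij_betw_Collect) (auto dest: F_W)
  then show ?thesis by (rule bij_betw_same_card)
qed

lemma ne_F: "x \<in> F g k \<Longrightarrow> F h k \<noteq> {}"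
  using card_F[of g k h] by (metis card_eq_0_iff empty_iff finF)

section \<open>Color-preserving maps and the removal of determined fibers\<close>

definition U :: "'k set \<Rightarrow> 's set" where "U K = {v \<in> W False. c v v \<in> K}"

definition partial_iso :: "'k set \<Rightarrow> bool" where
  "partial_iso K \<longleftrightarrow> (\<exists>\<phi>. (\<forall>u\<in>U K. \<phi> u \<in> W True) \<and> (\<forall>u\<in>U K. \<forall>v\<in>U K. c (\<phi> u) (\<phi> v) = c u v))"

definition fibers :: "'k set" where "fibers = (\<lambda>v. c v v) ` W False"

text \<open>No color between two different fibers induces a function, in either direction; a color
  that does so would allow the removal of a fiber.\<close>

definition reduced :: "'k set \<Rightarrow> bool" where
  "reduced K \<longleftrightarrow> (\<forall>g. \<forall>k\<in>K. \<forall>l\<in>K. k \<noteq> l \<longrightarrow>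
     (\<forall>x\<in>F g k. \<forall>y\<in>F g l. \<exists>x2\<in>F g k. x2 \<noteq> x \<and> c x2 y = c x y))"

text \<open>If one color of pairs induces a map from fiber \<open>l\<close> to fiber \<open>k\<close>, then fiber \<open>k\<close> is determined by fiber \<open>l\<close>.\<close>

lemma partial_iso_insert:
  assumes "l \<in> K" "k \<notin> K" and x0: "x0 \<in> F g0 k" and y0: "y0 \<in> F g0 l"
    and uniq: "\<And>x2. x2 \<in> F g0 k \<Longrightarrow> c x2 y0 = c x0 y0 \<Longrightarrow> x2 = x0"
    and "partial_iso K"
  shows "partial_iso (insert k K)"
proof -
  obtain \<phi> where \<phi>W: "\<And>u. u\<in>U K \<Longrightarrow> \<phi> u \<in> W True" and \<phi>: "\<And>u v. u\<in>U K \<Longrightarrow> v\<in>U K \<Longrightarrow> c (\<phi> u) (\<phi> v) = c u v"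
    using \<open>partial_iso K\<close> unfolding partial_iso_def by blast
  define r where "r = c x0 y0"
  have ex: "\<exists>x\<in>W h. c x y = r" if "y \<in> F h l" for y h
    using ext_point1[OF y0 that, of x0] x0 by (auto simp: r_def F_def)
  \<comment> \<open>Uniqueness at \<open>y0\<close> spreads to all vertices of fiber
    \<open>l\<close> on both sides, since the bijection of \<open>ext1\<close> carries the column of
    \<open>y\<close> to that of \<open>y0\<close>.\<close>
  have un: "x1 = x2" if y: "y \<in> F h l" and x: "x1 \<in> W h" "x2 \<in> W h" "c x1 y = r" "c x2 y = r" for x1 x2 y h
  proof -
    obtain f where f: "bij_betw f (W h) (W g0)" "\<forall>w\<in>W h. c y0 (f w) = c y w \<and> c (f w) y0 = c w y"
      using ext1[OF y y0] by blast
    have "f z = x0" if "z \<in> W h" "c z y = r" for z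
    proof (rule uniq)
      have fz: "f z \<in> W g0" "c (f z) y0 = c x0 y0" using f that by (auto simp: r_def dest: bij_betwE)
      then have "c (f z) (f z) = c x0 x0" using end_colors(1)[of "f z" g0 y0 x0 g0 y0] x0 y0 F_W by blast
      then show "f z \<in> F g0 k" using fz x0 by (auto simp: F_def)
      show "c (f z) y0 = c x0 y0" using fz by blast
    qed
    then have "f x1 = f x2" using x by metis
    then show ?thesis using f(1) x by (auto simp: bij_betw_def inj_on_def)
  qed
  have pre: "\<exists>y\<in>F h l. c x y = r" if "x \<in> F h k" for x h
    using ext_point1[OF x0 that, of y0] y0 by (auto simp: r_def F_def)
  define s where "s x = (SOME y. y \<in> F False l \<and> c x y = r)" for x
  have s: "s x \<in> F False l" "c x (s x) = r" if "x \<in> F False k" for x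
    using someI_ex[of "\<lambda>y. y \<in> F False l \<and> c x y = r"] pre[OF that] unfolding s_def by blast+
  define m where "m y = (SOME x. x \<in> W True \<and> c x y = r)" for y
  have m: "m y \<in> W True" "c (m y) y = r" if "y \<in> F True l" for y
    using someI_ex[of "\<lambda>x. x \<in> W True \<and> c x y = r"] ex[OF that] unfolding m_def by blast+
  define \<psi> where "\<psi> u = (if u \<in> F False k then m (\<phi> (s u)) else \<phi> u)" for u
  have lU: "y \<in> U K" if "y \<in> F False l" for y using that \<open>l \<in> K\<close> by (auto simp: F_def U_def)
  have \<phi>l: "\<phi> y \<in> F True l" if "y \<in> F False l" for y
    using \<phi>[OF lU[OF that] lU[OF that]] \<phi>W[OF lU[OF that]] that by (auto simp: F_def)
  have \<psi>K: "\<psi> v = \<phi> v" if "v \<in> U K" for v using that \<open>k \<notin> K\<close> by (auto simp: \<psi>_def F_def U_def)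
  have \<psi>k: "\<psi> x \<in> W True" "c (\<psi> x) (\<phi> (s x)) = r" if "x \<in> F False k" for x
    using m[OF \<phi>l[OF s(1)[OF that]]] that by (auto simp: \<psi>_def)
  \<comment> \<open>The new vertex is recognized by its color to \<open>\<phi> (s x)\<close>:
    copying the triangle on \<open>s x\<close>, \<open>v\<close>, \<open>x\<close> produces a vertex
    that uniqueness forces to be \<open>\<psi> x\<close>.\<close>
  have mixed: "c (\<psi> x) (\<phi> v) = c x v" if x: "x \<in> F False k" and v: "v \<in> U K" for x v
  proof -
    have "c (s x) v = c (\<phi> (s x)) (\<phi> v)" using \<phi>[OF lU[OF s(1)[OF x]] v] by simp
    moreover have WW: "s x \<in> W False" "v \<in> W False" "\<phi> (s x) \<in> W True" "\<phi> v \<in> W True" "x \<in> W False"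
      using s(1)[OF x] v \<phi>W[OF v] \<phi>l[OF s(1)[OF x]] x by (auto simp: F_def U_def)
    ultimately obtain w' where w': "w' \<in> W True" "c (\<phi> (s x)) w' = c (s x) x" "c w' (\<phi> v) = c x v"
      using ext_point[of "s x" False v "\<phi> (s x)" True "\<phi> v" x] by blast
    have "c w' (\<phi> (s x)) = r" using transp[OF WW(3) w'(1) WW(1,5) w'(2)] s(2)[OF x] by simp
    then have "w' = \<psi> x" using un[OF \<phi>l[OF s(1)[OF x]] w'(1) \<psi>k(1)[OF x]] \<psi>k(2)[OF x] by blast
    then show ?thesis using w'(3) by simp
  qed
  have both: "c (\<psi> x1) (\<psi> x2) = c x1 x2" if x: "x1 \<in> F False k" "x2 \<in> F False k" for x1 x2
  proof -
    have "c x1 (s x2) = c (\<psi> x1) (\<phi> (s x2))" using mixed[OF x(1) lU[OF s(1)[OF x(2)]]] by simp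
    moreover have WW: "s x2 \<in> W False" "\<phi> (s x2) \<in> W True" "x1 \<in> W False" "x2 \<in> W False" "\<psi> x1 \<in> W True"
      using s(1)[OF x(2)] \<psi>k(1)[OF x(1)] \<phi>l[OF s(1)[OF x(2)]] x by (auto simp: F_def U_def)
    ultimately obtain w' where w': "w' \<in> W True" "c (\<psi> x1) w' = c x1 x2" "c w' (\<phi> (s x2)) = c x2 (s x2)"
      using ext_point[of x1 False "s x2" "\<psi> x1" True "\<phi> (s x2)" x2] by blast
    then have "w' = \<psi> x2" using un[OF \<phi>l[OF s(1)[OF x(2)]] w'(1) \<psi>k(1)[OF x(2)]] \<psi>k(2)[OF x(2)] s(2)[OF x(2)] by simp
    then show ?thesis using w'(2) by simp
  qed
  have mixed': "c (\<phi> v) (\<psi> x) = c v x" if x: "x \<in> F False k" and v: "v \<in> U K" for x v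
    using transp[of "\<psi> x" True "\<phi> v" x False v] mixed[OF that] \<psi>k(1)[OF x] \<phi>W[OF v] x v
    by (auto simp: F_def U_def)
  have Uins: "u \<in> F False k \<or> u \<in> U K" if "u \<in> U (insert k K)" for u using that by (auto simp: U_def F_def)
  show ?thesis unfolding partial_iso_def
    by (rule exI[of _ \<psi>]) (use Uins \<psi>K \<psi>k(1) \<phi>W mixed mixed' both \<phi> in metis)
qed

text \<open>Take a smallest set of fibers on which a partial isomorphism would yield one on all
  fibers; a color inducing a function would make it smaller.\<close>

lemma reduce: "\<exists>K\<subseteq>fibers. reduced K \<and> (partial_iso K \<longrightarrow> partial_iso fibers)"
proof -
  define P where "P K \<longleftrightarrow> K \<subseteq> fibers \<and> (partial_iso K \<longrightarrow> partial_iso fibers)" for K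
  have "P fibers" by (simp add: P_def)
  then obtain K where K: "P K" "\<And>L. P L \<Longrightarrow> card K \<le> card L"
    using ex_has_least_nat[of P fibers card] by blast
  have finfib: "finite fibers" using fin by (simp add: fibers_def)
  have "reduced K"
    unfolding reduced_def
  proof (intro allI ballI impI, rule ccontr)
    fix g k l x y
    assume kl: "k \<in> K" "l \<in> K" "k \<noteq> l" "x \<in> F g k" "y \<in> F g l"
      and "\<not> (\<exists>x2\<in>F g k. x2 \<noteq> x \<and> c x2 y = c x y)"
    then have "partial_iso (insert k (K - {k}))" if "partial_iso (K - {k})"
      by (intro partial_iso_insert[where l = l and ?g0.0 = g and ?x0.0 = x and ?y0.0 = y]) (use that in auto)
    then have "P (K - {k})" using K(1) kl(1) by (auto simp: P_def insert_absorb)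
    moreover have "card (K - {k}) < card K"
      using kl(1) K(1) finfib by (metis P_def card_Diff1_less finite_subset)
    ultimately show False using K(2)[of "K - {k}"] by simp
  qed
  then show ?thesis using K(1) unfolding P_def by blast
qed

end

locale reduced_pair = coherent_pair +
  fixes K
  assumes red: "reduced K" and Kfib: "K \<subseteq> fibers"
begin

lemma red_col:
  assumes "k \<in> K" "l \<in> K" "k \<noteq> l" "x \<in> F g k" "y \<in> F g l"
  shows "\<exists>x2\<in>F g k. x2 \<noteq> x \<and> c x2 y = c x y"
  using red assms unfolding reduced_def by blast

lemma red_row:
  assumes "k \<in> K" "l \<in> K" "k \<noteq> l" "x \<in> F g k" "y \<in> F g l"
  shows "\<exists>y2\<in>F g l. y2 \<noteq> y \<and> c x y2 = c x y"
proof -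
  obtain y2 where y2: "y2 \<in> F g l" "y2 \<noteq> y" "c y2 x = c y x"
    using red_col[of l k y g x] assms by blast
  then show ?thesis using transp[of y2 g x y g x] assms F_W by blast
qed

lemma FK_ne: "k \<in> K \<Longrightarrow> F g k \<noteq> {}"
proof -
  assume "k \<in> K"
  then obtain v where "v \<in> W False" "c v v = k" using Kfib unfolding fibers_def by auto
  then have "v \<in> F False k" by (rule FI)
  then show ?thesis by (rule ne_F)
qed

section \<open>Pairs of fibers that are not joined uniformly\<close>

definition uniform :: "'b \<Rightarrow> 'b \<Rightarrow> bool" where
  "uniform k l \<longleftrightarrow> (\<forall>g h. \<forall>x\<in>F g k. \<forall>y\<in>F g l. \<forall>x'\<in>F h k. \<forall>y'\<in>F h l. c x y = c x' y')"

definition linked :: "'b \<Rightarrow> 'b \<Rightarrow> bool" where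
  "linked k l \<longleftrightarrow> k \<in> K \<and> l \<in> K \<and> k \<noteq> l \<and> \<not> uniform k l"

lemma linked_sym: "linked k l \<Longrightarrow> linked l k"
proof -
  have "uniform k l" if "uniform l k" using that transp F_W unfolding uniform_def by meson
  then show "linked k l \<Longrightarrow> linked l k" unfolding linked_def by blast
qed

lemma linked_K: "linked k l \<Longrightarrow> k \<in> K \<and> l \<in> K \<and> k \<noteq> l" by (simp add: linked_def)

lemma four_elems: "finite A \<Longrightarrow> card A \<le> 4 \<Longrightarrow> {a, b, d, e} \<subseteq> A \<Longrightarrow> distinct [a, b, d, e] \<Longrightarrow> A = {a, b, d, e}"
  by (rule sym, rule card_seteq) auto

lemma ex_fourth: "card A = 4 \<Longrightarrow> \<exists>w\<in>A. w \<noteq> a \<and> w \<noteq> b \<and> w \<noteq> d"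
proof (rule ccontr)
  assume A: "card A = 4" and "\<not> (\<exists>w\<in>A. w \<noteq> a \<and> w \<noteq> b \<and> w \<noteq> d)"
  then have "A \<subseteq> {a, b, d}" by blast
  from card_mono[OF _ this] have "card A \<le> card {a, b, d}" by simp
  also have "\<dots> \<le> 3" by (simp add: card_insert_if)
  finally show False using A by simp
qed

text \<open>Some row contains two colors, each at least twice because the set of fibers is reduced;
  a fiber has at most four vertices, so both occur exactly twice and no third color occurs. Columns
  are counted in the same way.\<close>

lemma linked_colors:
  assumes "linked k l"
  shows "\<exists>r s. r \<noteq> s \<and> (\<forall>g. card (F g k) = 4 \<and> card (F g l) = 4 \<and>
    (\<forall>x\<in>F g k. \<forall>y\<in>F g l. c x y = r \<or> c x y = s) \<and>
    (\<forall>x\<in>F g k. card {y\<in>F g l. c x y = r} = 2 \<and> card {y\<in>F g l. c x y = s} = 2) \<and>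
    (\<forall>y\<in>F g l. card {x\<in>F g k. c x y = r} = 2 \<and> card {x\<in>F g k. c x y = s} = 2))"
proof -
  have kl: "k \<in> K" "l \<in> K" "k \<noteq> l" "\<not> uniform k l" using assms by (auto simp: linked_def)
  \<comment> \<open>If all rows were constant, extension from one vertex would give all of them the
    same color.\<close>
  have "\<exists>g. \<exists>x\<in>F g k. \<exists>y\<in>F g l. \<exists>y2\<in>F g l. c x y \<noteq> c x y2"
  proof (rule ccontr)
    assume const: "\<not> ?thesis"
    have "uniform k l" unfolding uniform_def
    proof (intro allI ballI)
      fix g h x y x' y' assume *: "x \<in> F g k" "y \<in> F g l" "x' \<in> F h k" "y' \<in> F h l"
      obtain w' where "w' \<in> F h l" "c x' w' = c x y"
        using ext_point1[OF *(1,3), of y] *(2) by (auto simp: F_def)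
      then show "c x y = c x' y'" using const * by metis
    qed
    with kl show False by blast
  qed
  then obtain g x y1 y2 where x: "x \<in> F g k" and y: "y1 \<in> F g l" "y2 \<in> F g l" "c x y1 \<noteq> c x y2" by blast
  obtain y1' where y1': "y1' \<in> F g l" "y1' \<noteq> y1" "c x y1' = c x y1" using red_row[OF kl(1-3) x y(1)] by blast
  obtain y2' where y2': "y2' \<in> F g l" "y2' \<noteq> y2" "c x y2' = c x y2" using red_row[OF kl(1-3) x y(2)] by blast
  have Fl: "F g l = {y1, y1', y2, y2'}"
    by (rule four_elems) (use y y1' y2' card_F_le in auto)
  define r s where "r = c x y1" and "s = c x y2"
  have rs: "r \<noteq> s" using y by (simp add: r_def s_def)
  have "{y\<in>F g l. c x y = r} = {y1, y1'}" "{y\<in>F g l. c x y = s} = {y2, y2'}"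
    unfolding Fl using y y1' y2' by (auto simp: r_def s_def)
  then have "card {y\<in>F g l. c x y = r} = 2" "card {y\<in>F g l. c x y = s} = 2" using y1' y2' by auto
  then have rows: "card {y\<in>F h l. c x' y = r} = 2" "card {y\<in>F h l. c x' y = s} = 2" if "x' \<in> F h k" for x' h
    using row_card[OF x that] by metis+
  have two: "c x' y' = r \<or> c x' y' = s" if x': "x' \<in> F h k" and y': "y' \<in> F h l" for x' y' h
  proof -
    obtain w' where "w' \<in> F g l" "c x w' = c x' y'" using ext_point1[OF x' x, of y'] y' by (auto simp: F_def)
    then show ?thesis using Fl y1' y2' by (auto simp: r_def s_def)
  qed
  have cards: "card (F h l) = 4" for h using card_F[of h l g] Fl y y1' y2' by (auto simp: card_insert_if)
  have cols: "card {x'\<in>F h k. c x' y' = r} = 2 \<and> card {x'\<in>F h k. c x' y' = s} = 2 \<and> card (F h k) = 4" if y': "y' \<in> F h l" for h y'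
  proof -
    obtain x1 where x1: "x1 \<in> F h k" "c x1 y' = r" using ext_point1[OF y(1) y', of x] x by (auto simp: F_def r_def)
    obtain x2 where x2: "x2 \<in> F h k" "c x2 y' = s" using ext_point1[OF y(2) y', of x] x by (auto simp: F_def s_def)
    obtain x1' where x1': "x1' \<in> F h k" "x1' \<noteq> x1" "c x1' y' = r" using red_col[OF kl(1-3) x1(1) y'] x1 by metis
    obtain x2' where x2': "x2' \<in> F h k" "x2' \<noteq> x2" "c x2' y' = s" using red_col[OF kl(1-3) x2(1) y'] x2 by metis
    have d: "distinct [x1, x1', x2, x2']" using x1 x2 x1' x2' rs by auto
    have Fk: "F h k = {x1, x1', x2, x2'}"
      by (rule four_elems[OF _ _ _ d]) (use x1 x2 x1' x2' card_F_le in auto)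
    have "{x'\<in>F h k. c x' y' = r} = {x1, x1'}" "{x'\<in>F h k. c x' y' = s} = {x2, x2'}"
      unfolding Fk using x1 x2 x1' x2' rs by auto
    then show ?thesis using d Fk by auto
  qed
  have "card (F h k) = 4" for h using cols FK_ne[OF kl(2), of h] by blast
  then have "r \<noteq> s \<and> (\<forall>g. card (F g k) = 4 \<and> card (F g l) = 4 \<and>
    (\<forall>x\<in>F g k. \<forall>y\<in>F g l. c x y = r \<or> c x y = s) \<and>
    (\<forall>x\<in>F g k. card {y\<in>F g l. c x y = r} = 2 \<and> card {y\<in>F g l. c x y = s} = 2) \<and>
    (\<forall>y\<in>F g l. card {x\<in>F g k. c x y = r} = 2 \<and> card {x\<in>F g k. c x y = s} = 2))"
    using rs rows two cards cols by blast
  then show ?thesis by blast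
qed

lemma linked_two:
  assumes "linked k l" "x1 \<in> F g k" "y1 \<in> F g l" "x2 \<in> F h k" "y2 \<in> F h l" "x3 \<in> F i k" "y3 \<in> F i l"
    "c x1 y1 \<noteq> c x2 y2" "c x3 y3 \<noteq> c x2 y2"
  shows "c x1 y1 = c x3 y3"
  using linked_colors[OF assms(1)] assms(2-) by metis

lemma linked_card: "linked k l \<Longrightarrow> card (F g k) = 4" using linked_colors by blast

lemma linked_row:
  assumes "linked k l" "x \<in> F g k" "y \<in> F g l"
  shows "card {y'\<in>F g l. c x y' = c x y} = 2"
  using linked_colors[OF assms(1)]
proof (elim exE conjE allE[where x = g])
  fix r s
  assume "\<forall>x\<in>F g k. \<forall>y\<in>F g l. c x y = r \<or> c x y = s"
    "\<forall>x\<in>F g k. card {y\<in>F g l. c x y = r} = 2 \<and> card {y\<in>F g l. c x y = s} = 2"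
    "\<forall>y\<in>F g l. card {x\<in>F g k. c x y = r} = 2 \<and> card {x\<in>F g k. c x y = s} = 2"
  then show ?thesis using assms(2,3) by (cases "c x y = r") auto
qed

lemma linked_col:
  assumes "linked k l" "x \<in> F g k" "y \<in> F g l"
  shows "card {x'\<in>F g k. c x' y = c x y} = 2"
  using linked_colors[OF assms(1)]
proof (elim exE conjE allE[where x = g])
  fix r s
  assume "\<forall>x\<in>F g k. \<forall>y\<in>F g l. c x y = r \<or> c x y = s"
    "\<forall>x\<in>F g k. card {y\<in>F g l. c x y = r} = 2 \<and> card {y\<in>F g l. c x y = s} = 2"
    "\<forall>y\<in>F g l. card {x\<in>F g k. c x y = r} = 2 \<and> card {x\<in>F g k. c x y = s} = 2"
  then show ?thesis using assms(2,3) by (cases "c x y = r") auto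
qed

lemma two_elems:
  assumes "card {y\<in>A. P y} = 2" "y1 \<in> A" "P y1" "y2 \<in> A" "P y2" "y1 \<noteq> y2" "y \<in> A"
  shows "P y \<longleftrightarrow> y = y1 \<or> y = y2"
proof -
  have "finite {y\<in>A. P y}" using assms(1) by (metis card.infinite zero_neq_numeral)
  then have "{y1, y2} = {y\<in>A. P y}" using assms by (intro card_seteq) auto
  then show ?thesis using assms by blast
qed

lemma linked_rowE:
  assumes "linked k l" "x \<in> F g k" "y \<in> F g l"
  obtains y2 where "y2 \<in> F g l" "y2 \<noteq> y" "c x y2 = c x y"
  using red_row[of k l x g y] assms linked_K by blast

lemma linked_colE:
  assumes "linked k l" "x \<in> F g k" "y \<in> F g l"
  obtains x2 where "x2 \<in> F g k" "x2 \<noteq> x" "c x2 y = c x y"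
  using red_col[of k l x g y] assms linked_K by blast

section \<open>Two squares and the 8-cycle\<close>

definition same_row :: "bool \<Rightarrow> 'b \<Rightarrow> 'a \<Rightarrow> 'a \<Rightarrow> bool" where
  "same_row g l u v \<longleftrightarrow> (\<forall>y\<in>F g l. c u y = c v y)"

definition opp_row :: "bool \<Rightarrow> 'b \<Rightarrow> 'a \<Rightarrow> 'a \<Rightarrow> bool" where
  "opp_row g l u v \<longleftrightarrow> (\<forall>y\<in>F g l. c u y \<noteq> c v y)"

text \<open>The joint behavior of \<open>u\<close> and \<open>v\<close> toward fiber
  \<open>l\<close> consists of triangles, hence depends only on the color of the pair; so do
  \<open>same_row\<close> and \<open>opp_row\<close>.\<close>

lemma agree_transfer:
  assumes "u \<in> W g" "v \<in> W g" "u' \<in> W h" "v' \<in> W h" "c u v = c u' v'" "y' \<in> F h l"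
  shows "\<exists>y\<in>F g l. c u y = c u' y' \<and> c v y = c v' y'"
proof -
  obtain y where y: "y \<in> W g" "c u y = c u' y'" "c y v = c y' v'" "c y y = c y' y'"
    using ext_point[of u' h v' u g v y'] assms F_W by metis
  then have "c v y = c v' y'" using transp[of y g v y' h v'] assms F_W by blast
  then show ?thesis using y assms by (auto simp: F_def)
qed

lemma same_row_transfer:
  assumes "u \<in> W g" "v \<in> W g" "u' \<in> W h" "v' \<in> W h" "c u v = c u' v'" "same_row g l u v"
  shows "same_row h l u' v'"
  using agree_transfer[OF assms(1-5)] assms(6) unfolding same_row_def by metis

lemma opp_row_transfer:
  assumes "u \<in> W g" "v \<in> W g" "u' \<in> W h" "v' \<in> W h" "c u v = c u' v'" "opp_row g l u v"
  shows "opp_row h l u' v'"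
  using agree_transfer[OF assms(1-5)] assms(6) unfolding opp_row_def by metis

text \<open>
  Linked fibers are joined by two squares \<open>2K\<^sub>2\<^sub>,\<^sub>2\<close>, where every vertex shares its neighbors with one
  other vertex of its fiber, or by an 8-cycle, where no two vertices of a fiber have the same neighbors.
\<close>

definition K22 :: "'b \<Rightarrow> 'b \<Rightarrow> bool" where
  "K22 k l \<longleftrightarrow> linked k l \<and> (\<forall>g. \<forall>u\<in>F g k. \<exists>v\<in>F g k. v \<noteq> u \<and> same_row g l u v)"

definition C8 :: "'b \<Rightarrow> 'b \<Rightarrow> bool" where
  "C8 k l \<longleftrightarrow> linked k l \<and> (\<forall>g. \<forall>u\<in>F g k. \<forall>v\<in>F g k. same_row g l u v \<longrightarrow> u = v)"

text \<open>If two distinct vertices of a fiber have equal rows, the color of this pair occurs at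
  every vertex of the fiber on both sides, so every vertex has such a partner.\<close>

lemma K22_or_C8: "linked k l \<Longrightarrow> K22 k l \<or> C8 k l"
proof -
  assume linked: "linked k l"
  have "\<exists>v'\<in>F h k. v' \<noteq> u' \<and> same_row h l u' v'" if "u \<in> F g k" "v \<in> F g k" "same_row g l u v" "u \<noteq> v" "u' \<in> F h k" for g u v h u'
  proof -
    have "v \<in> W g" using that(2) F_W by blast
    then obtain v' where v': "v' \<in> W h" "c u' v' = c u v" "c v' v' = c v v" using ext_point1[OF \<open>u \<in> F g k\<close> \<open>u' \<in> F h k\<close>] by blast
    have "same_row h l u' v'" by (rule same_row_transfer[of u g v]) (use that v' F_W in auto)
    moreover have "v' \<noteq> u'" using v' that diag[of u g v u' h] by (auto simp: F_def)
    ultimately show ?thesis using v' that by (auto simp: F_def)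
  qed
  then show ?thesis using linked unfolding K22_def C8_def by blast
qed

lemma K22_partner:
  assumes "K22 k l" "u \<in> F g k" "v \<in> F g k" "v \<noteq> u" "same_row g l u v" "w \<in> F g k" "y \<in> F g l"
  shows "c w y = c u y \<longleftrightarrow> w = u \<or> w = v"
  by (rule two_elems[OF linked_col[of k l u g y]]) (use assms in \<open>auto simp: K22_def same_row_def\<close>)

text \<open>Two columns that agree at \<open>u\<close> agree at its partner as well; each column has
  every color twice, so the other two vertices carry the other color in both.\<close>

lemma K22_sym: assumes "K22 k l" shows "K22 l k"
proof -
  have linked: "linked k l" using assms by (simp add: K22_def)
  have "\<exists>z\<in>F g l. z \<noteq> y \<and> same_row g k y z" if y: "y \<in> F g l" for g y
  proof -
    obtain u where u: "u \<in> F g k" using FK_ne linked_K[OF linked] by blast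
    obtain v where v: "v \<in> F g k" "v \<noteq> u" "same_row g l u v" using assms u unfolding K22_def by blast
    obtain z where z: "z \<in> F g l" "z \<noteq> y" "c u z = c u y" using linked_rowE[OF linked u y] .
    have "c w y = c w z" if w: "w \<in> F g k" for w
    proof (cases "w = u \<or> w = v")
      case True
      then show ?thesis using v z y unfolding same_row_def by metis
    next
      case False
      then have "c w y \<noteq> c u y" "c w z \<noteq> c u y" using K22_partner[OF assms u v w] y z by metis+
      then show ?thesis using linked_two[OF linked w y u y w z(1)] by blast
    qed
    then have "c y w = c z w" if "w \<in> F g k" for w
      using transp[of w g y w g z] that y z F_W by blast
    then show ?thesis using z unfolding same_row_def by blast
  qed
  then show ?thesis unfolding K22_def using linked_sym[OF linked] by blast
qed

text \<open>A row has each of two colors twice, so two places with the same color fix it.\<close>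

lemma row_determined:
  assumes "linked k l" "u \<in> F g k" "w \<in> F g k" "y \<in> F g l" "y' \<in> F g l" "y \<noteq> y'" "c u y = c u y'"
    "c w y = c u y" "c w y' = c u y'"
  shows "same_row g l u w"
  unfolding same_row_def
proof
  fix z assume z: "z \<in> F g l"
  have 1: "c u z = c u y \<longleftrightarrow> z = y \<or> z = y'"
    by (rule two_elems[OF linked_row[OF assms(1,2,4)]]) (use assms z in auto)
  have 2: "c w z = c w y \<longleftrightarrow> z = y \<or> z = y'"
    by (rule two_elems[OF linked_row[OF assms(1,3,4)]]) (use assms z in auto)
  show "c u z = c w z"
    using 1 2 linked_two[OF assms(1,2) z assms(2,4,3) z] assms(8) by metis
qed

text \<open>Of the three other vertices, one shares the color of \<open>u\<close> at
  \<open>y\<close> and a different one that at \<open>y1\<close>; the last one shares neither and is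
  therefore opposite everywhere.\<close>

lemma C8_antipode:
  assumes C8: "C8 k l" and u: "u \<in> F g k"
  shows "\<exists>u'\<in>F g k. opp_row g l u u'"
proof -
  have linked: "linked k l" using C8 by (simp add: C8_def)
  obtain y where y: "y \<in> F g l" using FK_ne linked_K[OF linked] by blast
  obtain y1 where y1: "y1 \<in> F g l" "y1 \<noteq> y" "c u y1 = c u y" using linked_rowE[OF linked u y] .
  obtain v1 where v1: "v1 \<in> F g k" "v1 \<noteq> u" "c v1 y = c u y" using linked_colE[OF linked u y] .
  obtain v2 where v2: "v2 \<in> F g k" "v2 \<noteq> u" "c v2 y1 = c u y1" using linked_colE[OF linked u y1(1)] .
  have "v1 \<noteq> v2"
  proof
    assume "v1 = v2"
    then have "same_row g l u v1"
      using row_determined[OF linked u v1(1) y y1(1)] y1 v1 v2 by auto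
    then show False using C8 u v1 unfolding C8_def by metis
  qed
  obtain v3 where v3: "v3 \<in> F g k" "v3 \<noteq> u" "v3 \<noteq> v1" "v3 \<noteq> v2"
    using ex_fourth[OF linked_card[OF linked]] by metis
  have n: "c v3 y \<noteq> c u y" "c v3 y1 \<noteq> c u y"
    using two_elems[OF linked_col[OF linked u y] u _ v1(1) v1(3) v1(2)[symmetric] v3(1)]
      two_elems[OF linked_col[OF linked u y1(1)] u _ v2(1) v2(3) v2(2)[symmetric] v3(1)] v3 y1(3) by simp_all
  then have e: "c v3 y = c v3 y1" using linked_two[OF linked v3(1) y u y v3(1) y1(1)] by blast
  have "c u z \<noteq> c v3 z" if z: "z \<in> F g l" for z
  proof (cases "z = y \<or> z = y1")
    case True then show ?thesis using n y1 by auto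
  next
    case False
    then have a: "c u z \<noteq> c u y" "c v3 z \<noteq> c v3 y"
      using two_elems[OF linked_row[OF linked u y] y refl y1(1,3) y1(2)[symmetric] z]
        two_elems[OF linked_row[OF linked v3(1) y] y refl y1(1) e[symmetric] y1(2)[symmetric] z] by blast+
    then have "c v3 z = c u y" using linked_two[OF linked v3(1) z v3(1) y u y] n by auto
    then show ?thesis using a by simp
  qed
  then show ?thesis using v3 unfolding opp_row_def by blast
qed

lemma C8_antipode_unique:
  assumes C8: "C8 k l" and F: "u \<in> F g k" "v \<in> F g k" "w \<in> F g k" "opp_row g l u v" "opp_row g l u w"
  shows "v = w"
proof -
  have linked: "linked k l" using C8 by (simp add: C8_def)
  have "same_row g l v w" unfolding same_row_def
    using linked_two[OF linked F(2) _ F(1) _ F(3)] F(4,5) unfolding opp_row_def by metis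
  then show ?thesis using C8 F unfolding C8_def by blast
qed

text \<open>Vertices at distance two on an 8-cycle have exactly one common neighbor. Either color
  may play the part of adjacency, since the bipartite complement is again an 8-cycle.\<close>

lemma C8_half:
  assumes C8: "C8 k l" and F: "u \<in> F g k" "w \<in> F g k" "w \<noteq> u" "\<not> opp_row g l u w"
    and y: "y \<in> F g l" "y' \<in> F g l" "y \<noteq> y'" "c u y = c u y'"
  shows "c w y = c u y \<longleftrightarrow> c w y' \<noteq> c u y'"
proof -
  have linked: "linked k l" using C8 by (simp add: C8_def)
  obtain v where v: "v \<in> F g k" "opp_row g l u v" using C8_antipode[OF C8 F(1)] by blast
  have "w \<noteq> v" using v F by blast
  show ?thesis
  proof
    assume "c w y = c u y"
    then show "c w y' \<noteq> c u y'"
      using row_determined[OF linked F(1,2) y] C8 F unfolding C8_def by metis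
  next
    assume n: "c w y' \<noteq> c u y'"
    show "c w y = c u y"
    proof (rule ccontr)
      assume n': "c w y \<noteq> c u y"
      have a: "c u y \<noteq> c v y" "c u y' \<noteq> c v y'" using v(2) y unfolding opp_row_def by auto
      have "c w y = c v y" using linked_two[OF linked F(2) y(1) F(1) y(1) v(1) y(1)] a n' by metis
      moreover have "c w y' = c v y'" using linked_two[OF linked F(2) y(2) F(1) y(2) v(1) y(2)] a n by metis
      moreover have "c v y = c v y'" using linked_two[OF linked v(1) y(1) F(1) y(1) v(1) y(2)] a y by metis
      ultimately have "same_row g l v w" using row_determined[OF linked v(1) F(2) y(1-3)] by metis
      then show False using C8 v(1) F \<open>w \<noteq> v\<close> unfolding C8_def by metis
    qed
  qed
qed

text \<open>Hence in an 8-cycle the antipode is the only vertex of a fiber that a color can single out.\<close>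

lemma C8_others:
  assumes C8: "C8 k l" and F: "u \<in> F g k" "w \<in> F g k" "w2 \<in> F g k" "w \<noteq> u" "w2 \<noteq> u" "w2 \<noteq> w" "\<not> opp_row g l u w" "\<not> opp_row g l u w2"
  shows "c u w = c u w2"
proof -
  have linked: "linked k l" using C8 by (simp add: C8_def)
  obtain v where v: "v \<in> F g k" "opp_row g l u v" using C8_antipode[OF C8 F(1)] by blast
  obtain y0 where y0: "y0 \<in> F g l" using FK_ne linked_K[OF linked] by blast
  obtain y1 where y1: "y1 \<in> F g l" "y1 \<noteq> y0" "c u y1 = c u y0" using linked_rowE[OF linked F(1) y0] .
  have "c w y0 = c u y0 \<longleftrightarrow> c w y1 \<noteq> c u y1" using C8_half[OF C8 F(1,2,4,7) y0 y1(1)] y1 by metis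
  then obtain y y' where y: "y \<in> F g l" "y' \<in> F g l" "c u y = c u y'" "c w y = c u y" "c w y' \<noteq> c u y'"
    using y0 y1 by metis
  \<comment> \<open>As \<open>u\<close> has the same color to \<open>y\<close> and
    \<open>y'\<close>, the triangle with apex \<open>w\<close> can be moved from \<open>u\<close>,
    \<open>y\<close> to \<open>u\<close>, \<open>y'\<close>. The new apex has the color of
    \<open>w\<close> from \<open>u\<close> but another color to \<open>y'\<close> than
    \<open>w\<close> has; only \<open>w2\<close> is left for it.\<close>
  obtain w' where w': "w' \<in> W g" "c u w' = c u w" "c w' y' = c w y" "c w' w' = c w w"
    using ext_point[of u g y u g y' w] F y F_W by metis
  have w'F: "w' \<in> F g k" using w' F by (auto simp: F_def)
  have "w' \<noteq> w" using w' y by auto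
  moreover have "w' \<noteq> v" using w' y v unfolding opp_row_def by auto
  moreover have "w' \<noteq> u" using diag[of u g w u g] w' F F_W by metis
  moreover have "F g k = {u, v, w, w2}"
  proof (rule four_elems)
    have "v \<noteq> u" using v y unfolding opp_row_def by auto
    then show "distinct [u, v, w, w2]" using F v by auto
  qed (use F v card_F_le in auto)
  ultimately have "w' = w2" using w'F by auto
  then show ?thesis using w' by simp
qed

text \<open>An antipode toward \<open>m\<close> is one toward \<open>l\<close>, since antipodes are
  singled out by color. Hence \<open>u\<close> and \<open>w\<close> with the same color to some
  \<open>y\<close> in \<open>l\<close> are not antipodes toward \<open>m\<close> and agree at some
  \<open>z\<close> there. A further \<open>z2\<close> with the color of \<open>z\<close> to
  \<open>y\<close> sees the set \<open>{u, w}\<close>, which \<open>y\<close> determines, as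
  \<open>z\<close> does; so \<open>u\<close> and \<open>w\<close> agree at \<open>z\<close> and
  \<open>z2\<close> in one color, against \<open>C8_half\<close>.\<close>

lemma C8_unique:
  assumes l: "C8 k l" and m: "C8 k m"
  shows "l = m"
proof (rule ccontr)
  assume "l \<noteq> m"
  have linked: "linked k l" "linked k m" using l m by (auto simp: C8_def)
  have opp_row: "opp_row g l u v" if u: "u \<in> F g k" "v \<in> F g k" and a: "opp_row g m u v" for g u v
  proof (rule ccontr)
    assume n: "\<not> opp_row g l u v"
    obtain z where "z \<in> F g m" using FK_ne linked_K[OF linked(2)] by blast
    then have "v \<noteq> u" using a by (auto simp: opp_row_def)
    obtain u' where u': "u' \<in> F g k" "opp_row g l u u'" using C8_antipode[OF l u(1)] by blast
    obtain w where w: "w \<in> F g k" "w \<noteq> u" "w \<noteq> u'" "w \<noteq> v"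
      using ex_fourth[OF linked_card[OF linked(1)]] by metis
    have "\<not> opp_row g l u w" using C8_antipode_unique[OF l u(1) u'(1) w(1) u'(2)] w by blast
    then have "c u v = c u w" using C8_others[OF l u w(1) \<open>v \<noteq> u\<close> w(2,4) n] by blast
    then have "opp_row g m u w" using opp_row_transfer[of u g v u g w m] a u w F_W by metis
    then show False using C8_antipode_unique[OF m u w(1) a] w by blast
  qed
  obtain y where y: "y \<in> F False l" using FK_ne linked_K[OF linked(1)] by blast
  obtain u where u: "u \<in> F False k" using FK_ne linked_K[OF linked(1)] by blast
  obtain w where w: "w \<in> F False k" "w \<noteq> u" "c w y = c u y" using linked_colE[OF linked(1) u y] .
  have "\<not> opp_row False m u w" using opp_row[OF u w(1)] w y unfolding opp_row_def by metis
  note half = C8_half[OF m u w(1,2) this]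
  obtain z0 where z0: "z0 \<in> F False m" using FK_ne linked_K[OF linked(2)] by blast
  obtain z1 where z1: "z1 \<in> F False m" "z1 \<noteq> z0" "c u z1 = c u z0" using linked_rowE[OF linked(2) u z0] .
  obtain z where z: "z \<in> F False m" "c w z = c u z" using half[OF z0 z1(1)] z0 z1 by metis
  obtain z2 where z2: "z2 \<in> F False m" "z2 \<noteq> z" "c z2 y = c z y"
    using red_col[of m l z False y] linked_K[OF linked(1)] linked_K[OF linked(2)] \<open>l \<noteq> m\<close> z y by metis
  have yz: "c y z2 = c y z" using transp[of z2 False y z False y] z2 z y F_W by metis
  have "c v z2 = c u z" if v: "v \<in> F False k" "c v y = c u y" for v
  proof -
    obtain v' where v': "v' \<in> W False" "c y v' = c y v" "c v' z = c v z2" "c v' v' = c v v"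
      using ext_point[of y False z2 y False z v] yz y z z2 v F_W by metis
    have v'F: "v' \<in> F False k" using v' v by (auto simp: F_def)
    have "c v' y = c v y" using transp[of y False v' y False v] v' v y F_W by metis
    then have "v' = u \<or> v' = w"
      using two_elems[OF linked_col[OF linked(1) u y] u refl w(1,3) w(2)[symmetric] v'F] v(2) by simp
    then show ?thesis using v' z by auto
  qed
  then have "c u z2 = c u z" "c w z2 = c u z" using u w by auto
  then show False using half[OF z(1) z2(1)] z z2 by metis
qed

end

context coherent_pair
begin

text \<open>A failure at \<open>u\<close>, \<open>v\<close> produces a further vertex with the color
  of \<open>v\<close> from \<open>x\<close> and, symmetrically, one with the color of
  \<open>u\<close>. With four vertices these coincide, so all colors from \<open>x\<close> to other
  vertices are equal. Then the fiber has a single color off the diagonal, and nothing can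
  fail.\<close>

lemma fiber_rigid:
  assumes x: "x \<in> F g k" "x' \<in> F h k" and f: "bij_betw f (W g) (W h)" "\<And>w. w \<in> W g \<Longrightarrow> c x' (f w) = c x w"
    and uv: "u \<in> F g k" "v \<in> F g k"
  shows "c (f u) (f v) = c u v"
proof (rule ccontr)
  assume fail: "c (f u) (f v) \<noteq> c u v"
  note W = F_W[OF x(1)] F_W[OF x(2)]
  have bij: "bij_betw f (F g k) (F h k)" using ext_fiber[OF f(1) W] f(2) by blast
  have fF: "f w \<in> F h k" if "w \<in> F g k" for w using bij that by (auto dest: bij_betwE)
  have fx: "f x = x'" using diag[OF W(2) F_W[OF fF[OF x(1)]] W(1)] f(2)[OF W(1)] by simp
  have ne: "u \<noteq> v" using fail fF uv by (auto simp: F_def)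
  have tr: "c (f b) (f a) = c b a" if "c (f a) (f b) = c a b" "a \<in> F g k" "b \<in> F g k" for a b
    using transp[of "f a" h "f b" a g b] that fF F_W by metis
  have neu: "u \<noteq> x" using fail fx f(2)[OF F_W[OF uv(2)]] by auto
  have nev: "v \<noteq> x" using fail tr[of x u] fx f(2)[OF F_W[OF uv(1)]] uv x by auto
  have third: "\<exists>w\<in>F g k. w \<noteq> x \<and> w \<noteq> a \<and> w \<noteq> b \<and> c x w = c x b"
    if ab: "a \<in> F g k" "b \<in> F g k" "a \<noteq> x" "b \<noteq> x" "a \<noteq> b" "c (f a) (f b) \<noteq> c a b" for a b
  proof -
    obtain b' where b': "b' \<in> W h" "c x' b' = c x b" "c b' (f a) = c b a" "c b' b' = c b b"
      using ext_point[of x g a x' h "f a" b] ab W fF F_W f(2) by metis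
    have b'F: "b' \<in> F h k" using b' ab by (auto simp: F_def)
    have "b' \<noteq> f b" using b'(3) tr[of b a] ab by auto
    moreover have "b' \<noteq> x'" using diag[OF W(1) F_W[OF ab(2)] W(2)] b' ab by metis
    moreover have "b' \<noteq> f a" using diag[of b g a "f a" h] b' ab fF F_W by metis
    moreover obtain w where "w \<in> F g k" "b' = f w" using bij b'F by (auto simp: bij_betw_def)
    ultimately show ?thesis using b'(2) f(2)[of w] fx F_W by metis
  qed
  obtain w where w: "w \<in> F g k" "w \<noteq> x" "w \<noteq> u" "w \<noteq> v" "c x w = c x v" using third[OF uv neu nev ne fail] by blast
  have "c (f v) (f u) \<noteq> c v u" using fail tr uv by blast
  then obtain w2 where w2: "w2 \<in> F g k" "w2 \<noteq> x" "w2 \<noteq> u" "w2 \<noteq> v" "c x w2 = c x u"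
    using third[OF uv(2,1) nev neu ne[symmetric]] by blast
  have "{x, u, v, w} = F g k"
    by (rule card_seteq) (use x uv w neu nev ne card_F_le[of g k] in \<open>auto simp: numeral_eq_Suc\<close>)
  moreover then have "w2 = w" using w2 by blast
  ultimately have all: "c x y = c x u" if "y \<in> F g k" "y \<noteq> x" for y using that w w2 by auto
  have "c a b = c x u" if ab: "a \<in> F i k" "b \<in> F i k" "a \<noteq> b" for i a b
  proof -
    obtain b' where b': "b' \<in> W g" "c x b' = c a b" "c b' b' = c b b" using ext_point1[OF ab(1) x(1) F_W[OF ab(2)]] by blast
    then have "b' \<noteq> x" using diag[OF F_W[OF ab(1)] F_W[OF ab(2)] W(1)] ab(3) by auto
    then show ?thesis using all b' ab by (auto simp: F_def)
  qed
  moreover have "f u \<noteq> f v" using bij uv ne by (auto simp: bij_betw_def inj_on_def)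
  ultimately show False using fail uv ne fF by metis
qed

end

context reduced_pair
begin

lemma C8_not_K22: "C8 k l \<Longrightarrow> \<not> K22 k l"
proof
  assume a: "C8 k l" "K22 k l"
  then have "k \<in> K" by (simp add: C8_def linked_def)
  then obtain u where "u \<in> F False k" using FK_ne by blast
  then show False using a unfolding C8_def K22_def by metis
qed

lemma C8_sym: "C8 k l \<Longrightarrow> C8 l k"
  using K22_sym K22_or_C8 C8_not_K22 linked_sym unfolding C8_def by blast

lemma color_swap: "a \<in> F g k \<Longrightarrow> b \<in> F g l \<Longrightarrow> a' \<in> F h k \<Longrightarrow> b' \<in> F h l \<Longrightarrow> c a b = c a' b' \<longleftrightarrow> c b a = c b' a'"
  using transp F_W by meson

lemma K22_same:
  assumes T: "K22 m k" and x: "x \<in> F g k" and z: "z \<in> F g m" "z' \<in> F g m"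
  shows "c z' x = c z x \<longleftrightarrow> same_row g k z z'"
proof -
  obtain v where v: "v \<in> F g m" "v \<noteq> z" "same_row g k z v" using T z unfolding K22_def by blast
  show ?thesis
  proof
    assume "c z' x = c z x"
    then have "z' = z \<or> z' = v" using K22_partner[OF T z(1) v z(2) x] by blast
    then show "same_row g k z z'" using v unfolding same_row_def by auto
  next
    assume "same_row g k z z'" then show "c z' x = c z x" using x unfolding same_row_def by auto
  qed
qed

text \<open>For two squares the color is a parity: moving one end out of its matched pair flips it,
  and there are only two colors.\<close>

lemma K22_color:
  assumes T: "K22 k l" and F: "x \<in> F g k" "u \<in> F g k" "y \<in> F g l" "v \<in> F g l"
  shows "c u v = c x y \<longleftrightarrow> (same_row g l x u \<longleftrightarrow> same_row g k y v)"
proof -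
  have linked: "linked k l" using T by (simp add: K22_def)
  have 1: "c u v = c x v \<longleftrightarrow> same_row g l x u" using K22_same[OF T F(4,1,2)] .
  have 2: "c x v = c x y \<longleftrightarrow> same_row g k y v"
    using K22_same[OF K22_sym[OF T] F(1,3,4)] color_swap[OF F(1,4) F(1,3)] by simp
  show ?thesis using 1 2 linked_two[OF linked F(2,4) F(1,4) F(1,3)] by metis
qed

text \<open>Let \<open>z\<close> be the antipode of \<open>y\<close>. One of \<open>y\<close> and
  \<open>z\<close> has the color of \<open>v\<close> from \<open>x\<close>, and
  \<open>C8_half\<close> applies to it together with \<open>v\<close>.\<close>

lemma C8_color:
  assumes C: "C8 k l" and F: "x \<in> F g k" "u \<in> F g k" "y \<in> F g l" "v \<in> F g l"
    and u: "u \<noteq> x" "\<not> opp_row g l x u" and v: "v \<noteq> y" "\<not> opp_row g k y v"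
  shows "c u v = c x v \<longleftrightarrow> c u y \<noteq> c x y"
proof -
  have linked: "linked k l" using C by (simp add: C8_def)
  obtain z where z: "z \<in> F g l" "opp_row g k y z" using C8_antipode[OF C8_sym[OF C] F(3)] by blast
  have "z \<noteq> v" using z v by blast
  have nz: "c w z \<noteq> c w y" if "w \<in> F g k" for w
    using z(2) color_swap[OF that z(1) that F(3)] that unfolding opp_row_def by metis
  have "c u z = c x z \<longleftrightarrow> c u y = c x y"
    using nz[OF F(1)] nz[OF F(2)] linked_two[OF linked F(2) z(1) F(1) F(3) F(1) z(1)] 
      linked_two[OF linked F(2) F(3) F(1) z(1) F(1) F(3)] by metis
  moreover have "c x v = c x y \<or> c x v = c x z"
    using nz[OF F(1)] linked_two[OF linked F(1,4) F(1,3) F(1) z(1)] by metis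
  ultimately show ?thesis
    using C8_half[OF C F(1,2) u F(3,4) v(1)[symmetric]] C8_half[OF C F(1,2) u z(1) F(4) \<open>z \<noteq> v\<close>] by metis
qed

section \<open>Gluing along base points\<close>

definition base_points :: "('b \<Rightarrow> 'a) \<Rightarrow> ('b \<Rightarrow> 'a) \<Rightarrow> bool" where
  "base_points \<xi> \<xi>' \<longleftrightarrow> (\<forall>k\<in>K. \<xi> k \<in> F False k \<and> \<xi>' k \<in> F True k)"

definition matched :: "('b \<Rightarrow> 'a) \<Rightarrow> ('b \<Rightarrow> 'a) \<Rightarrow> 'b \<Rightarrow> 'b \<Rightarrow> bool" where
  "matched \<xi> \<xi>' k l \<longleftrightarrow> c (\<xi> k) (\<xi> l) = c (\<xi>' k) (\<xi>' l)"

text \<open>Individualizing the base points fixes the fiber maps, up to the choice of an orientation in an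
  8-cycle, which is settled by the base point of the unique partner fiber.\<close>

lemma extend_base_points:
  assumes \<xi>: "base_points \<xi> \<xi>'"
  shows "\<exists>\<phi>. (\<forall>u\<in>U K. \<phi> u \<in> W True \<and> c (\<phi> u) (\<phi> u) = c u u) \<and>
    (\<forall>u\<in>U K. \<forall>v\<in>U K. matched \<xi> \<xi>' (c u u) (c v v) \<longrightarrow> c (\<phi> u) (\<phi> v) = c u v)"
proof -
  have \<xi>F: "\<xi> k \<in> F False k" "\<xi>' k \<in> F True k" if "k \<in> K" for k using \<xi> that by (auto simp: base_points_def)
  have "\<exists>f. bij_betw f (W False) (W True) \<and> (\<forall>w\<in>W False. c (\<xi>' k) (f w) = c (\<xi> k) w) \<and>
     (\<forall>l. C8 k l \<and> matched \<xi> \<xi>' k l \<longrightarrow> (\<forall>w\<in>W False. c (f w) (\<xi>' l) = c w (\<xi> l)))" if k: "k \<in> K" for k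
  proof -
    \<comment> \<open>\<open>p\<close> is the unique fiber joined to \<open>k\<close> by an 8-cycle
      if the base points there are matched, and \<open>k\<close> itself otherwise. Extending from
      the pair \<open>\<xi> k\<close>, \<open>\<xi> p\<close> makes the map on fiber
      \<open>k\<close> respect both base points.\<close>
    obtain p where p: "p \<in> K" "matched \<xi> \<xi>' k p" "\<And>l. C8 k l \<Longrightarrow> matched \<xi> \<xi>' k l \<Longrightarrow> l = p"
    proof (cases "\<exists>l. C8 k l \<and> matched \<xi> \<xi>' k l")
      case True
      then obtain l where l: "C8 k l" "matched \<xi> \<xi>' k l" by blast
      show ?thesis
      proof (rule that[of l])
        show "l \<in> K" using l(1) by (simp add: C8_def linked_def)
      qed (use l C8_unique in blast)+
    next
      case False
      have "matched \<xi> \<xi>' k k" using F_c[OF \<xi>F(1)[OF k]] F_c[OF \<xi>F(2)[OF k]] by (simp add: matched_def)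
      then show ?thesis using that[of k] k False by blast
    qed
    have "c (\<xi> k) (\<xi> p) = c (\<xi>' k) (\<xi>' p)" using p by (simp add: matched_def)
    from ext[OF F_W[OF \<xi>F(1)[OF k]] F_W[OF \<xi>F(1)[OF p(1)]] F_W[OF \<xi>F(2)[OF k]] F_W[OF \<xi>F(2)[OF p(1)]] this]
    show ?thesis using p(3) by blast
  qed
  then obtain f where f: "\<And>k. k \<in> K \<Longrightarrow> bij_betw (f k) (W False) (W True)"
    "\<And>k w. k \<in> K \<Longrightarrow> w \<in> W False \<Longrightarrow> c (\<xi>' k) (f k w) = c (\<xi> k) w"
    "\<And>k l w. k \<in> K \<Longrightarrow> C8 k l \<Longrightarrow> matched \<xi> \<xi>' k l \<Longrightarrow> w \<in> W False \<Longrightarrow> c (f k w) (\<xi>' l) = c w (\<xi> l)"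
    by metis
  have fF: "f k u \<in> F True k" if "k \<in> K" "u \<in> F False k" for k u
    using ext_fiber[OF f(1)[OF that(1)] F_W[OF \<xi>F(1)[OF that(1)]] F_W[OF \<xi>F(2)[OF that(1)]], of k] f(2)[OF that(1)] that(2)
    by (auto dest: bij_betwE)
  have main: "c (f k u) (f l v) = c u v" if kl: "k \<in> K" "l \<in> K" and M: "matched \<xi> \<xi>' k l" and uv: "u \<in> F False k" "v \<in> F False l" for k l u v
  proof -
    define x y x' y' u' v' where xy: "x = \<xi> k" "y = \<xi> l" "x' = \<xi>' k" "y' = \<xi>' l" "u' = f k u" "v' = f l v"
    have F: "x \<in> F False k" "y \<in> F False l" "x' \<in> F True k" "y' \<in> F True l" "u' \<in> F True k" "v' \<in> F True l"
      using \<xi>F kl fF uv by (auto simp: xy)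
    note W = F[THEN F_W] uv[THEN F_W]
    have xy': "c x y = c x' y'" using M by (simp add: matched_def xy)
    have xu: "c x u = c x' u'" and yv: "c y v = c y' v'" using f(2)[OF kl(1) W(7)] f(2)[OF kl(2) W(8)] by (simp_all add: xy)
    have "c u v = c u' v'"
    proof (cases "linked k l")
      case False
      show ?thesis
      proof (cases "k = l")
        case True
        then show ?thesis using fiber_rigid[OF F(1,3) f(1)[OF kl(1)]] f(2)[OF kl(1)] uv by (simp add: xy)
      next
        case False
        then have "uniform k l" using \<open>\<not> linked k l\<close> kl by (simp add: linked_def)
        then show ?thesis using uv F unfolding uniform_def by blast
      qed
    next
      case linked: True
      from K22_or_C8[OF linked] show ?thesis
      proof
        assume T: "K22 k l"
        have "same_row False l x u \<longleftrightarrow> same_row True l x' u'"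
          using same_row_transfer[OF W(1,7,3,5) xu] same_row_transfer[OF W(3,5,1,7) xu[symmetric]] by blast
        moreover have "same_row False k y v \<longleftrightarrow> same_row True k y' v'"
          using same_row_transfer[OF W(2,8,4,6) yv] same_row_transfer[OF W(4,6,2,8) yv[symmetric]] by blast
        ultimately have "c u v = c x y \<longleftrightarrow> c u' v' = c x y"
          using K22_color[OF T F(1) uv(1) F(2) uv(2)] K22_color[OF T F(3,5,4,6)] xy' by simp
        then show ?thesis using linked_two[OF linked uv F(1,2) F(5,6)] by metis
      next
        assume C: "C8 k l"
        have M': "matched \<xi> \<xi>' l k" using M color_swap[OF F(1,2,3,4)] by (simp add: matched_def xy)
        have uy: "c u y = c u' y'" using f(3)[OF kl(1) C M W(7)] by (simp add: xy)
        have "c v x = c v' x'" using f(3)[OF kl(2) C8_sym[OF C] M' W(8)] by (simp add: xy)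
        then have xv: "c x v = c x' v'" using color_swap[OF uv(2) F(1) F(6,3)] by simp
        have ax: "opp_row False l x u \<longleftrightarrow> opp_row True l x' u'"
          using opp_row_transfer[OF W(1,7,3,5) xu] opp_row_transfer[OF W(3,5,1,7) xu[symmetric]] by blast
        have ay: "opp_row False k y v \<longleftrightarrow> opp_row True k y' v'"
          using opp_row_transfer[OF W(2,8,4,6) yv] opp_row_transfer[OF W(4,6,2,8) yv[symmetric]] by blast
        have ex: "u = x \<longleftrightarrow> u' = x'"
          using diag[OF W(1,7,3)] diag[OF W(3,5,1)] xu by metis
        have ey: "v = y \<longleftrightarrow> v' = y'"
          using diag[OF W(2,8,4)] diag[OF W(4,6,2)] yv by metis
        \<comment> \<open>If \<open>u\<close> or \<open>v\<close> is a base point or the antipode of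
          one, the known colors to \<open>x\<close> and \<open>y\<close> decide; the last case is
          \<open>C8_color\<close>.\<close>
        consider "u = x" | "v = y" | "opp_row False l x u" | "opp_row False k y v"
          | "u \<noteq> x" "v \<noteq> y" "\<not> opp_row False l x u" "\<not> opp_row False k y v" by blast
        then show ?thesis
        proof cases
          case 1 then show ?thesis using ex xv by simp
        next
          case 2 then show ?thesis using ey uy by simp
        next
          case 3
          then have "c u v \<noteq> c x v" "c u' v' \<noteq> c x v" using ax xv uv F unfolding opp_row_def by metis+
          then show ?thesis using linked_two[OF linked uv F(1) uv(2) F(5,6)] by blast
        next
          case 4
          then have "c v u \<noteq> c y u" "c v' u' \<noteq> c y' u'" using ay uv F unfolding opp_row_def by metis+
          then have "c u v \<noteq> c u y" "c u' v' \<noteq> c u y"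
            using color_swap[OF uv(2,1) F(2) uv(1)] color_swap[OF F(6,5) F(4,5)] uy by auto
          then show ?thesis using linked_two[OF linked uv uv(1) F(2) F(5,6)] by blast
        next
          case 5
          have "c u v = c x v \<longleftrightarrow> c u y \<noteq> c x y" using C8_color[OF C F(1) uv(1) F(2) uv(2)] 5 by blast
          moreover have "c u' v' = c x' v' \<longleftrightarrow> c u' y' \<noteq> c x' y'" using C8_color[OF C F(3,5,4,6)] 5 ex ey ax ay by blast
          ultimately have "c u v = c x v \<longleftrightarrow> c u' v' = c x v" using xv uy xy' by metis
          then show ?thesis using linked_two[OF linked uv F(1) uv(2) F(5,6)] by metis
        qed
      qed
    qed
    then show ?thesis by (simp add: xy)
  qed
  have U: "u \<in> F False (c u u)" "c u u \<in> K" if "u \<in> U K" for u using that by (auto simp: U_def F_def)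
  show ?thesis
  proof (rule exI[of _ "\<lambda>u. f (c u u) u"], intro conjI ballI impI)
    fix u assume u: "u \<in> U K"
    show "f (c u u) u \<in> W True" "c (f (c u u) u) (f (c u u) u) = c u u" using F_W[OF fF[OF U(2,1)[OF u]]] F_c[OF fF[OF U(2,1)[OF u]]] by auto
    fix v assume v: "v \<in> U K" and M: "matched \<xi> \<xi>' (c u u) (c v v)"
    show "c (f (c u u) u) (f (c v v) v) = c u v" by (rule main[OF U(2)[OF u] U(2)[OF v] M U(1)[OF u] U(1)[OF v]])
  qed
qed

text \<open>Match \<open>a\<close> and \<open>b\<close>, then erect one triangle over this pair for
  \<open>p\<close> and another for \<open>q\<close>. Nothing relates the two apexes, so only the
  pair \<open>p\<close>, \<open>q\<close> stays open. Repetitions among the four fibers are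
  allowed.\<close>

lemma base_points_exist:
  assumes K: "a \<in> K" "b \<in> K" "p \<in> K" "q \<in> K"
  shows "\<exists>\<xi> \<xi>'. base_points \<xi> \<xi>' \<and>
    (\<forall>k\<in>{a, b, p, q}. \<forall>l\<in>{a, b, p, q}. k = l \<or> {k, l} \<noteq> {p, q} \<longrightarrow> matched \<xi> \<xi>' k l)"
proof -
  define \<xi> where "\<xi> k = (SOME x. x \<in> F False k)" for k
  define \<eta> where "\<eta> k = (SOME x. x \<in> F True k)" for k
  have \<xi>: "\<xi> k \<in> F False k" and \<eta>: "\<eta> k \<in> F True k" if "k \<in> K" for k
    using FK_ne[OF that] by (auto simp: \<xi>_def \<eta>_def some_in_eq)
  note FF = \<xi>[OF K(1)] \<xi>[OF K(2)] \<xi>[OF K(3)] \<xi>[OF K(4)]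
  note WW = FF[THEN F_W]
  define xa where "xa = \<eta> a"
  have xa: "xa \<in> F True a" using \<eta> K by (simp add: xa_def)
  obtain xb where xb: "xb \<in> F True b" "c xa xb = c (\<xi> a) (\<xi> b)"
    using ext_point1[OF FF(1) xa WW(2)] F_c[OF FF(2)] by (auto intro: FI)
  obtain xp where xp: "xp \<in> F True p" "c xa xp = c (\<xi> a) (\<xi> p)" "c xp xb = c (\<xi> p) (\<xi> b)"
    using ext_point[OF WW(1,2) F_W[OF xa] F_W[OF xb(1)] xb(2)[symmetric] WW(3)] F_c[OF FF(3)] by (auto intro: FI)
  obtain xq where xq: "xq \<in> F True q" "c xa xq = c (\<xi> a) (\<xi> q)" "c xq xb = c (\<xi> q) (\<xi> b)"
    using ext_point[OF WW(1,2) F_W[OF xa] F_W[OF xb(1)] xb(2)[symmetric] WW(4)] F_c[OF FF(4)] by (auto intro: FI)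
  note XW = F_W[OF xa] F_W[OF xb(1)] F_W[OF xp(1)] F_W[OF xq(1)]
  define \<xi>' where "\<xi>' k = (if k = a then xa else if k = b then xb else if k = p then xp else if k = q then xq else \<eta> k)" for k
  have va: "\<xi>' a = xa" by (simp add: \<xi>'_def)
  have vb: "\<xi>' b = xb" using diag[OF XW(1,2) WW(1)] xb by (auto simp: \<xi>'_def)
  have vp: "\<xi>' p = xp" using diag[OF XW(1,3) WW(1)] diag[OF XW(3,2) WW(2)] xp by (auto simp: \<xi>'_def)
  have vq: "q \<noteq> p \<Longrightarrow> \<xi>' q = xq" using diag[OF XW(1,4) WW(1)] diag[OF XW(4,2) WW(2)] xq by (auto simp: \<xi>'_def)
  have bp: "base_points \<xi> \<xi>'" unfolding base_points_def \<xi>'_def using \<xi> \<eta> xa xb xp xq by auto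
  have self: "matched \<xi> \<xi>' k k" if "k \<in> K" for k
    using bp that F_c unfolding base_points_def matched_def by metis
  have sym: "matched \<xi> \<xi>' l k" if "matched \<xi> \<xi>' k l" "k \<in> K" "l \<in> K" for k l
    using bp that color_swap[of "\<xi> k" False k "\<xi> l" l "\<xi>' k" True "\<xi>' l"] unfolding base_points_def matched_def by metis
  have ab: "matched \<xi> \<xi>' a b" using xb by (simp add: matched_def va vb)
  have ap: "matched \<xi> \<xi>' a p" "matched \<xi> \<xi>' p b" using xp by (simp_all add: matched_def va vb vp)
  have aq: "matched \<xi> \<xi>' a q" "matched \<xi> \<xi>' q b" using xq ap by (cases "q = p"; simp add: matched_def va vb vq)+
  show ?thesis
  proof (intro exI conjI ballI impI)
    fix k l assume kl: "k \<in> {a, b, p, q}" "l \<in> {a, b, p, q}" "k = l \<or> {k, l} \<noteq> {p, q}"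
    have KK: "k \<in> K" "l \<in> K" using kl K by auto
    have "k = l \<or> k \<in> {a, b} \<or> l \<in> {a, b}" using kl by (auto simp: insert_commute)
    moreover have "matched \<xi> \<xi>' d e" if "d \<in> {a, b}" "e \<in> {a, b, p, q}" for d e
      using that ab ap aq self K sym[OF ab K(1,2)] sym[OF ap(2) K(3,2)] sym[OF aq(2) K(4,2)] by blast
    ultimately show "matched \<xi> \<xi>' k l" using self[OF KK(1)] sym[OF _ KK(2,1)] kl by blast
  qed (rule bp)
qed

lemma partial_iso_of_matched:
  assumes "base_points \<xi> \<xi>'" "\<And>k l. k \<in> K \<Longrightarrow> l \<in> K \<Longrightarrow> matched \<xi> \<xi>' k l"
  shows "partial_iso K"
proof -
  obtain \<phi> where "\<forall>u\<in>U K. \<phi> u \<in> W True" "\<forall>u\<in>U K. \<forall>v\<in>U K. matched \<xi> \<xi>' (c u u) (c v v) \<longrightarrow> c (\<phi> u) (\<phi> v) = c u v"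
    using extend_base_points[OF assms(1)] by blast
  then show ?thesis using assms(2) unfolding partial_iso_def by (intro exI[of _ \<phi>]) (auto simp: U_def)
qed

lemma matched_not_linked:
  assumes "base_points \<xi> \<xi>'" "k \<in> K" "l \<in> K" "\<not> linked k l"
  shows "matched \<xi> \<xi>' k l"
proof (cases "k = l")
  case True
  then show ?thesis using assms F_c unfolding base_points_def matched_def by metis
next
  case False
  then have "uniform k l" using assms by (simp add: linked_def)
  then show ?thesis using assms unfolding base_points_def matched_def uniform_def by blast
qed

text \<open>Only fibers of size 4 are linked, and three fibers can be matched completely: use
  \<open>base_points_exist\<close> with equal last arguments. Pairs that are not linked match by
  uniformity.\<close>

lemma partial_iso_three_fibers:
  assumes "card {k \<in> K. card (F False k) = 4} \<le> 3"
  shows "partial_iso K"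
proof (cases "K = {}")
  case True
  then show ?thesis by (simp add: partial_iso_def U_def)
next
  case False
  define Q where "Q = {k \<in> K. card (F False k) = 4}"
  have "finite fibers" using fin by (simp add: fibers_def)
  then have finQ: "finite Q" using Kfib unfolding Q_def by (auto intro: finite_subset)
  obtain a b p where abp: "a \<in> K" "b \<in> K" "p \<in> K" "Q \<subseteq> {a, b, p}"
  proof -
    from finQ obtain xs where xs: "set xs = Q" "distinct xs" using finite_distinct_list by blast
    then have len: "length xs \<le> 3" using assms distinct_card[OF xs(2)] by (simp add: Q_def)
    obtain z where z: "z \<in> K" using False by blast
    have QK: "set xs \<subseteq> K" using xs Q_def by auto
    consider "xs = []" | d where "xs = [d]" | d e where "xs = [d, e]" | d e f where "xs = [d, e, f]"
      using len by (cases xs rule: list.exhaust; cases "tl xs" rule: list.exhaust; cases "tl (tl xs)" rule: list.exhaust; cases "tl (tl (tl xs))") auto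
    then show ?thesis
    proof cases
      case 1 then show ?thesis using that[of z z z] z xs by auto
    next
      case (2 d) then show ?thesis using that[of d d d] QK xs by auto
    next
      case (3 d e) then show ?thesis using that[of d e e] QK xs by auto
    next
      case (4 d e f) then show ?thesis using that[of d e f] QK xs by auto
    qed
  qed
  obtain \<xi> \<xi>' where \<xi>: "base_points \<xi> \<xi>'" "\<forall>k\<in>{a, b, p}. \<forall>l\<in>{a, b, p}. matched \<xi> \<xi>' k l"
    using base_points_exist[OF abp(1,2,3,3)] by (auto simp: doubleton_eq_iff)
  show ?thesis
  proof (rule partial_iso_of_matched[OF \<xi>(1)])
    fix k l assume kl: "k \<in> K" "l \<in> K"
    show "matched \<xi> \<xi>' k l"
    proof (cases "linked k l")
      case True
      then have "k \<in> Q" "l \<in> Q" using linked_card[OF True] linked_card[OF linked_sym[OF True]] kl by (auto simp: Q_def)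
      then show ?thesis using \<xi>(2) abp(4) by blast
    next
      case False
      then show ?thesis using matched_not_linked[OF \<xi>(1) kl] by blast
    qed
  qed
qed

section \<open>Four linked fibers\<close>

definition same_matching :: "'b \<Rightarrow> 'b \<Rightarrow> 'b \<Rightarrow> bool" where
  "same_matching m k l \<longleftrightarrow> (\<forall>g. \<forall>z\<in>F g m. \<forall>z2\<in>F g m. same_row g k z z2 \<longrightarrow> same_row g l z z2)"

text \<open>If \<open>x\<close> told \<open>y\<close> and \<open>y2\<close> apart, the other vertex
  \<open>y3\<close> with the color of \<open>y\<close> from \<open>x\<close> would have the other
  color to \<open>z\<close>. Moving the triangle \<open>x\<close>, \<open>y\<close>,
  \<open>z\<close> to \<open>x\<close>, \<open>y3\<close> gives some \<open>z'\<close> with the row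
  of \<open>z\<close> toward \<open>k\<close>, hence also toward \<open>l\<close>, so
  \<open>z\<close> has equal colors to \<open>y\<close> and \<open>y3\<close>, a
  contradiction.\<close>

lemma comp_step:
  assumes T: "K22 k m" "K22 l m" and kl: "linked k l" and d: "same_matching m k l"
    and F: "x \<in> F g k" "y \<in> F g l" "y2 \<in> F g l" "z \<in> F g m" and e: "c y z = c y2 z"
  shows "c x y = c x y2"
proof (rule ccontr)
  assume n: "c x y \<noteq> c x y2"
  have lm: "linked l m" using T by (simp add: K22_def)
  obtain y3 where y3: "y3 \<in> F g l" "y3 \<noteq> y" "c x y3 = c x y" using linked_rowE[OF kl F(1,2)] .
  have "y \<noteq> y2" using n by blast
  have "y3 \<noteq> y2" using n y3 by metis
  then have n3: "c y3 z \<noteq> c y z"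
    using two_elems[OF linked_col[OF lm F(2,4)] F(2) refl F(3) e[symmetric] \<open>y \<noteq> y2\<close> y3(1)] y3 by blast
  obtain z' where z': "z' \<in> W g" "c x z' = c x z" "c z' y3 = c z y" "c z' z' = c z z"
    using ext_point[OF F_W[OF F(1)] F_W[OF F(2)] F_W[OF F(1)] F_W[OF y3(1)] y3(3)[symmetric] F_W[OF F(4)]] by blast
  have z'F: "z' \<in> F g m" using z' F by (auto simp: F_def)
  have "c z' x = c z x" using color_swap[OF F(1) z'F F(1,4)] z' by simp
  then have "same_row g k z z'" using K22_same[OF K22_sym[OF T(1)] F(1,4) z'F] by blast
  then have "same_row g l z z'" using d F(4) z'F unfolding same_matching_def by blast
  then have "c z y3 = c z y" using y3 z'(3) unfolding same_row_def by auto
  then show False using n3 color_swap[OF F(4) y3(1) F(4,2)] by simp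
qed

text \<open>If \<open>k\<close> and \<open>l\<close> induce the same matching on \<open>m\<close>,
  the link between them is the composition of the links through \<open>m\<close> and carries no
  information of its own.\<close>

lemma comp_color:
  assumes T: "K22 k m" "K22 l m" and kl: "linked k l" and d: "same_matching m k l"
    and F: "x \<in> F g k" "y \<in> F g l" "z \<in> F g m" and F': "x' \<in> F h k" "y' \<in> F h l" "z' \<in> F h m"
    and e: "c x z = c x' z'" "c y z = c y' z'"
  shows "c x y = c x' y'"
proof -
  obtain y2 where y2: "y2 \<in> W h" "c x' y2 = c x y" "c y2 z' = c y z" "c y2 y2 = c y y"
    using ext_point[OF F_W[OF F(1)] F_W[OF F(3)] F_W[OF F'(1)] F_W[OF F'(3)] e(1) F_W[OF F(2)]] by blast
  have "y2 \<in> F h l" using y2 F by (auto simp: F_def)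
  then show ?thesis using comp_step[OF T kl d F'(1) _ F'(2,3)] y2 e by metis
qed

text \<open>Base points match all pairs of fibers but one, and matching this one too would give an
  isomorphism. So the color of no pair may be a consequence of the others: every pair is linked, and
  by \<open>comp_color\<close> no fiber has equal matchings toward two others.\<close>

lemma four_fibers:
  assumes K4: "card K = 4" and bad: "\<not> partial_iso K"
  shows "\<forall>k\<in>K. \<forall>l\<in>K. k \<noteq> l \<longrightarrow> K22 k l"
    and "\<forall>m\<in>K. \<forall>k\<in>K - {m}. \<forall>l\<in>K - {m, k}. \<forall>g. \<forall>u\<in>F g m. \<forall>v\<in>F g m. u \<noteq> v \<longrightarrow> same_row g k u v \<longrightarrow> \<not> same_row g l u v"
    and "\<forall>p\<in>K. \<forall>q\<in>K - {p}. \<exists>\<phi>. (\<forall>u\<in>U K. \<phi> u \<in> W True \<and> c (\<phi> u) (\<phi> u) = c u u) \<and>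
      (\<forall>u\<in>U K. \<forall>v\<in>U K. {c u u, c v v} \<noteq> {p, q} \<longrightarrow> c (\<phi> u) (\<phi> v) = c u v)"
proof -
  have bp: "\<exists>a b \<xi> \<xi>'. K = {a, b, p, q} \<and> distinct [a, b, p, q] \<and> base_points \<xi> \<xi>' \<and> (\<forall>k\<in>K. \<forall>l\<in>K. {k, l} \<noteq> {p, q} \<longrightarrow> matched \<xi> \<xi>' k l)"
    if pq: "p \<in> K" "q \<in> K" "p \<noteq> q" for p q
  proof -
    have "card (K - {p, q}) = 2" using K4 pq by (simp add: card_Diff_subset)
    then obtain a b where ab: "K - {p, q} = {a, b}" "a \<noteq> b" by (auto simp: card_2_iff)
    then have Keq: "K = {a, b, p, q}" "distinct [a, b, p, q]" using pq by auto
    obtain \<xi> \<xi>' where "base_points \<xi> \<xi>'"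
       "\<forall>k\<in>{a, b, p, q}. \<forall>l\<in>{a, b, p, q}. k = l \<or> {k, l} \<noteq> {p, q} \<longrightarrow> matched \<xi> \<xi>' k l"
      using base_points_exist[of a b p q] Keq(1) by blast
    then show ?thesis using Keq by blast
  qed
  have never: "\<not> matched \<xi> \<xi>' p q" if "p \<in> K" "q \<in> K" "p \<noteq> q" "base_points \<xi> \<xi>'" "\<forall>k\<in>K. \<forall>l\<in>K. {k, l} \<noteq> {p, q} \<longrightarrow> matched \<xi> \<xi>' k l" for p q \<xi> \<xi>'
  proof
    assume m: "matched \<xi> \<xi>' p q"
    then have "matched \<xi> \<xi>' q p" using color_swap[of "\<xi> p" False p "\<xi> q" q "\<xi>' p" True "\<xi>' q"] that(1,2,4) unfolding base_points_def matched_def by metis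
    with m have "matched \<xi> \<xi>' k l" if "k \<in> K" "l \<in> K" for k l
      using \<open>\<forall>k\<in>K. \<forall>l\<in>K. _\<close> that by (metis doubleton_eq_iff)
    then show False using partial_iso_of_matched[OF that(4)] bad by blast
  qed
  have linked: "linked p q" if "p \<in> K" "q \<in> K" "p \<noteq> q" for p q
    using bp[OF that] never[OF that] matched_not_linked that by metis
  have nodir: "\<not> same_matching m p q" if K: "m \<in> K" "p \<in> K" "q \<in> K" and ne: "m \<noteq> p" "m \<noteq> q" "p \<noteq> q" and T: "K22 p m" "K22 q m" for m p q
  proof
    assume d: "same_matching m p q"
    obtain \<xi> \<xi>' where b: "base_points \<xi> \<xi>'" "\<forall>k\<in>K. \<forall>l\<in>K. {k, l} \<noteq> {p, q} \<longrightarrow> matched \<xi> \<xi>' k l"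
      using bp[OF K(2,3) ne(3)] by blast
    have "matched \<xi> \<xi>' p m" "matched \<xi> \<xi>' q m" using b(2) K ne by (metis doubleton_eq_iff)+
    then have "matched \<xi> \<xi>' p q"
      using comp_color[OF T linked[OF K(2,3) ne(3)] d, of "\<xi> p" False "\<xi> q" "\<xi> m" "\<xi>' p" True "\<xi>' q" "\<xi>' m"] b(1) K
      unfolding matched_def base_points_def by blast
    then show False using never[OF K(2,3) ne(3) b] by blast
  qed
  have K22_all: "K22 k l" if kl: "k \<in> K" "l \<in> K" "k \<noteq> l" for k l
  proof (rule ccontr)
    assume "\<not> K22 k l"
    then have C: "C8 k l" using K22_or_C8 linked[OF kl] by blast
    obtain p q where "K = {p, q, k, l}" "distinct [p, q, k, l]" using bp[OF kl] by blast
    then have pq: "p \<in> K" "q \<in> K" "p \<noteq> q" "p \<noteq> k" "q \<noteq> k" "p \<noteq> l" "q \<noteq> l" by auto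
    have T: "K22 k p" "K22 k q"
      using K22_or_C8[OF linked[of k p]] K22_or_C8[OF linked[of k q]] C8_unique[OF C] pq kl by metis+
    \<comment> \<open>The partner toward \<open>p\<close> is singled out by a color, so it can only
      be the antipode on the 8-cycle. The same holds for \<open>q\<close>, so \<open>p\<close> and
      \<open>q\<close> would induce one matching on \<open>k\<close>.\<close>
    have an: "opp_row g l u v" if P: "K22 k p" and uv: "u \<in> F g k" "v \<in> F g k" "v \<noteq> u" "same_row g p u v" for g u v p
    proof (rule ccontr)
      assume n: "\<not> opp_row g l u v"
      obtain u' where u': "u' \<in> F g k" "opp_row g l u u'" using C8_antipode[OF C uv(1)] by blast
      obtain w where w: "w \<in> F g k" "w \<noteq> u" "w \<noteq> u'" "w \<noteq> v"
        using ex_fourth[OF linked_card[OF linked[OF kl]]] by metis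
      have "\<not> opp_row g l u w" using C8_antipode_unique[OF C uv(1) u'(1) w(1) u'(2)] w by blast
      then have e: "c u v = c u w" using C8_others[OF C uv(1) uv(2) w(1) uv(3) w(2,4) n] by blast
      have "same_row g p u w" by (rule same_row_transfer[OF _ _ _ _ e uv(4)]) (use uv w F_W in blast)+
      moreover obtain y where "y \<in> F g p" using P FK_ne unfolding K22_def linked_def by blast
      ultimately show False using K22_partner[OF P uv w(1)] w unfolding same_row_def by metis
    qed
    have "same_matching k p q" unfolding same_matching_def
    proof (intro allI ballI impI)
      fix g z z2 assume z: "z \<in> F g k" "z2 \<in> F g k" "same_row g p z z2"
      show "same_row g q z z2"
      proof (cases "z2 = z")
        case False
        obtain v where v: "v \<in> F g k" "v \<noteq> z" "same_row g q z v" using T(2) z unfolding K22_def by blast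
        have "z2 = v" using C8_antipode_unique[OF C z(1,2) v(1)] an[OF T(1) z(1,2) False z(3)] an[OF T(2) z(1) v] by blast
        then show ?thesis using v by simp
      qed (simp add: same_row_def)
    qed
    then show False using nodir[of k p q] kl pq T K22_sym by metis
  qed
  then show "\<forall>k\<in>K. \<forall>l\<in>K. k \<noteq> l \<longrightarrow> K22 k l" by blast
  show "\<forall>m\<in>K. \<forall>k\<in>K - {m}. \<forall>l\<in>K - {m, k}. \<forall>g. \<forall>u\<in>F g m. \<forall>v\<in>F g m. u \<noteq> v \<longrightarrow> same_row g k u v \<longrightarrow> \<not> same_row g l u v"
  proof (intro ballI allI impI notI)
    fix m k l g u v
    assume mkl: "m \<in> K" "k \<in> K - {m}" "l \<in> K - {m, k}" and uv: "u \<in> F g m" "v \<in> F g m" "u \<noteq> v"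
      and e: "same_row g k u v" "same_row g l u v"
    have T: "K22 m k" "K22 m l" using K22_all mkl by auto
    have "same_matching m k l" unfolding same_matching_def
    proof (intro allI ballI impI)
      fix h z z2 assume z: "z \<in> F h m" "z2 \<in> F h m" "same_row h k z z2"
      obtain v' where v': "v' \<in> W h" "c z v' = c u v" "c v' v' = c v v" using ext_point1[OF uv(1) z(1) F_W[OF uv(2)]] by blast
      have v'F: "v' \<in> F h m" using v' uv by (auto simp: F_def)
      have "v' \<noteq> z" using diag[OF F_W[OF uv(1)] F_W[OF uv(2)] F_W[OF z(1)]] v' uv by metis
      have e': "same_row h k z v'" "same_row h l z v'"
        using same_row_transfer[OF F_W[OF uv(1)] F_W[OF uv(2)] F_W[OF z(1)] v'(1) v'(2)[symmetric]] e by auto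
      obtain y where y: "y \<in> F h k" using FK_ne mkl by blast
      have "c z2 y = c z y" using z y unfolding same_row_def by auto
      then have "z2 = z \<or> z2 = v'"
        using K22_partner[OF T(1) z(1) v'F \<open>v' \<noteq> z\<close> e'(1) z(2) y] by blast
      then show "same_row h l z z2" using e' by (auto simp: same_row_def)
    qed
    then show False using nodir[of m k l] mkl T K22_sym by auto
  qed
  show "\<forall>p\<in>K. \<forall>q\<in>K - {p}. \<exists>\<phi>. (\<forall>u\<in>U K. \<phi> u \<in> W True \<and> c (\<phi> u) (\<phi> u) = c u u) \<and>
      (\<forall>u\<in>U K. \<forall>v\<in>U K. {c u u, c v v} \<noteq> {p, q} \<longrightarrow> c (\<phi> u) (\<phi> v) = c u v)"
  proof (intro ballI)
    fix p q assume pq: "p \<in> K" "q \<in> K - {p}"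
    obtain \<xi> \<xi>' where b: "base_points \<xi> \<xi>'" "\<forall>k\<in>K. \<forall>l\<in>K. {k, l} \<noteq> {p, q} \<longrightarrow> matched \<xi> \<xi>' k l"
      using bp[of p q] pq by blast
    show "\<exists>\<phi>. (\<forall>u\<in>U K. \<phi> u \<in> W True \<and> c (\<phi> u) (\<phi> u) = c u u) \<and>
      (\<forall>u\<in>U K. \<forall>v\<in>U K. {c u u, c v v} \<noteq> {p, q} \<longrightarrow> c (\<phi> u) (\<phi> v) = c u v)"
      using extend_base_points[OF b(1)] b(2) unfolding U_def by blast
  qed
qed

end

context coherent_pair
begin

text \<open>Without a partial isomorphism at least four fibers of size 4 remain. They use up all 16
  vertices, so the reduction has removed nothing.\<close>

theorem partial_iso_or_four_fibers:
  assumes "card (W False) \<le> 16" "\<not> partial_iso fibers"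
  shows "reduced fibers \<and> card fibers = 4 \<and> (\<forall>k\<in>fibers. \<forall>g. card (F g k) = 4) \<and> card (W False) = 16"
proof -
  obtain K where K: "K \<subseteq> fibers" "reduced K" "\<not> partial_iso K" using reduce assms(2) by blast
  interpret reduced_pair W c K by unfold_locales (use K in auto)
  define Q where "Q = {k \<in> K. card (F False k) = 4}"
  have "finite fibers" using fin by (simp add: fibers_def)
  then have finQ: "finite Q" using K unfolding Q_def by (auto intro: finite_subset)
  have "\<not> card Q \<le> 3" using partial_iso_three_fibers K(3) by (auto simp: Q_def)
  have "card (\<Union>k\<in>Q. F False k) = (\<Sum>k\<in>Q. card (F False k))"
    by (rule card_UN_disjoint) (use finQ in \<open>auto dest: F_c\<close>)
  also have "\<dots> = 4 * card Q" by (simp add: Q_def)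
  finally have un: "card (\<Union>k\<in>Q. F False k) = 4 * card Q" .
  have sub: "(\<Union>k\<in>Q. F False k) \<subseteq> W False" by (auto simp: F_def)
  have "4 * card Q \<le> card (W False)" using card_mono[OF fin sub] un by simp
  then have Q4: "card Q = 4" and W16: "card (W False) = 16" using \<open>\<not> card Q \<le> 3\<close> assms(1) by auto
  have "(\<Union>k\<in>Q. F False k) = W False"
    by (rule card_subset_eq[OF fin sub]) (use un Q4 W16 in simp)
  then have "fibers \<subseteq> Q" by (auto simp: fibers_def F_def)
  then have "fibers = K" "Q = K" using K(1) by (auto simp: Q_def)
  moreover then have "card (F g k) = 4" if "k \<in> K" for g k using that card_F[of g k False] by (auto simp: Q_def)
  ultimately show ?thesis using K(2) Q4 W16 by simp
qed

end

section \<open>Structure of graphs that are not amenable\<close>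

text \<open>Transposition exchanges the two components of the counted pairs, so the property passes
  from each round to the next.\<close>

lemma (in wl_family) color_transp:
  assumes init: "\<And>g h x y x' y'. \<lbrakk>x \<in> W g; y \<in> W g; x' \<in> W h; y' \<in> W h; e 0 x y = e 0 x' y'\<rbrakk> \<Longrightarrow> e 0 y x = e 0 y' x'"
    and "x \<in> W g" "y \<in> W g" "x' \<in> W h" "y' \<in> W h" "e i x y = e i x' y'"
  shows "e i y x = e i y' x'"
  using assms(2-)
proof (induction i arbitrary: g h x y x' y')
  case 0
  then show ?case using init by blast
next
  case (Suc i)
  obtain f where f: "bij_betw f (W g) (W h)" "\<forall>w\<in>W g. e i x' (f w) = e i x w \<and> e i (f w) y' = e i w y"
    using color_Suc_bij[OF Suc.prems] by blast
  have fW: "f w \<in> W h" if "w \<in> W g" for w using f(1) that by (auto dest: bij_betwE)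
  have "e i x y = e i x' y'" by (rule color_downward[OF Suc.prems]) simp
  then have "e i y x = e i y' x'" using Suc.IH[OF Suc.prems(1-4)] by blast
  moreover have "e i y' (f w) = e i y w \<and> e i (f w) x' = e i w x" if w: "w \<in> W g" for w
    using Suc.IH[of "f w" h y' w g y] Suc.IH[of x' h "f w" x g w] f(2) w fW[OF w] Suc.prems(1-4) by simp
  ultimately show ?case using color_SucI[OF Suc.prems(2,1,4,3) _ f(1)] by blast
qed

lemma vertex_color_wl2:
  assumes "\<And>i. wl2_color G i u v = wl2_color H i u' v'"
  shows "u = v \<longleftrightarrow> u' = v'" "u = v \<Longrightarrow> vcol G u = vcol H u'" "u \<noteq> v \<Longrightarrow> adj G u v \<longleftrightarrow> adj H u' v'"
  using assms[of 0] by (auto simp: initial_color_def split: if_splits)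

text \<open>Diagonal pairs are recognizable in round 0, so a color-preserving matching of pairs
  restricts to an injection of vertices.\<close>

lemma wl2_equivalent_diagonal:
  assumes "finite (V G)" "finite (V H)" "wl2_equivalent G H"
  shows "\<exists>f. inj_on f (V G) \<and> f ` V G \<subseteq> V H \<and> (\<forall>v\<in>V G. \<forall>i. wl2_color H i (f v) (f v) = wl2_color G i v v)"
proof -
  obtain F where F: "bij_betw F (V G \<times> V G) (V H \<times> V H)"
    "\<forall>u\<in>V G. \<forall>v\<in>V G. \<forall>i. wl2_color H i (fst (F (u, v))) (snd (F (u, v))) = wl2_color G i u v"
    using assms(3) unfolding wl2_equivalent_iff[OF assms(1,2)] by blast
  define f where "f v = fst (F (v, v))" for v
  have f: "F (v, v) = (f v, f v) \<and> f v \<in> V H" if "v \<in> V G" for v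
  proof -
    have "F (v, v) \<in> V H \<times> V H" using F(1) that by (auto dest: bij_betwE)
    moreover have "fst (F (v, v)) = snd (F (v, v))"
      using vertex_color_wl2(1)[of H "fst (F (v, v))" "snd (F (v, v))" G v v] F(2) that by auto
    ultimately show ?thesis unfolding f_def by (cases "F (v, v)") auto
  qed
  have "inj_on f (V G)"
  proof (rule inj_onI)
    fix u v assume *: "u \<in> V G" "v \<in> V G" "f u = f v"
    then have "F (u, u) = F (v, v)" using f by auto
    then have "(u, u) = (v, v)" using F(1) * by (intro inj_onD[of F "V G \<times> V G"]) (auto simp: bij_betw_def)
    then show "u = v" by simp
  qed
  moreover have "wl2_color H i (f v) (f v) = wl2_color G i v v" if "v \<in> V G" for v i
    using F(2)[rule_format, OF that that] f[OF that] by simp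
  ultimately show ?thesis using f by (intro exI[of _ f]) auto
qed

lemma wl2_equivalent_fiber_le:
  assumes "finite (V G)" "finite (V H)" "wl2_equivalent G H"
  shows "card {v \<in> V G. (\<lambda>i. wl2_color G i v v) = k} \<le> card {v \<in> V H. (\<lambda>i. wl2_color H i v v) = k}"
proof -
  obtain f where f: "inj_on f (V G)" "f ` V G \<subseteq> V H" "\<forall>v\<in>V G. \<forall>i. wl2_color H i (f v) (f v) = wl2_color G i v v"
    using wl2_equivalent_diagonal[OF assms] by blast
  show ?thesis
    by (rule card_inj_on_le[of f]) (use f assms(2) in \<open>auto intro: inj_on_subset\<close>)
qed

lemma wl2_equivalent_class_le:
  assumes "finite (V G)" "finite (V H)" "wl2_equivalent G H"
  shows "card {v \<in> V G. vcol G v = k} \<le> card {v \<in> V H. vcol H v = k}"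
proof -
  obtain f where f: "inj_on f (V G)" "f ` V G \<subseteq> V H" "\<forall>v\<in>V G. \<forall>i. wl2_color H i (f v) (f v) = wl2_color G i v v"
    using wl2_equivalent_diagonal[OF assms] by blast
  have "vcol H (f v) = vcol G v" if "v \<in> V G" for v
    using f(3) that vertex_color_wl2(2)[of H "f v" "f v" G v v] by blast
  then show ?thesis
    by (intro card_inj_on_le[of f]) (use f assms(2) in \<open>auto intro: inj_on_subset\<close>)
qed

lemma wl2_equivalent_fiber_card:
  assumes "finite (V G)" "finite (V H)" "wl2_equivalent G H"
  shows "card {v \<in> V G. (\<lambda>i. wl2_color G i v v) = k} = card {v \<in> V H. (\<lambda>i. wl2_color H i v v) = k}"
  using wl2_equivalent_fiber_le[OF assms] wl2_equivalent_fiber_le[OF assms(2,1) wl2_equivalent_sym[OF assms]]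
  by (rule antisym)

lemma wl2_equivalent_card:
  assumes "finite (V G)" "finite (V H)" "wl2_equivalent G H"
  shows "card (V G) = card (V H)"
proof -
  obtain F where "bij_betw F (V G \<times> V G) (V H \<times> V H)"
    using assms(3) unfolding wl2_equivalent_iff[OF assms(1,2)] by blast
  from bij_betw_same_card[OF this] have "card (V G) ^ 2 = card (V H) ^ 2" by (simp add: card_cartesian_product power2_eq_square)
  then show ?thesis by simp
qed

text \<open>Colors are functions of the round, so no stable round has to be named. The stable fibers
  refine the classes of \<open>vcol\<close>, which gives the bound 4.\<close>

lemma coherent_pair_joint:
  assumes G: "is_vc_graph G" and H: "is_vc_graph H" and eq: "wl2_equivalent G H"
    and le: "\<And>k. card {v \<in> V G. vcol G v = k} \<le> 4"
  shows "coherent_pair (joint_vertices G H) (\<lambda>x y i. joint_pair_color G H i x y)"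
proof -
  note finGH = is_vc_graph_finite[OF G] is_vc_graph_finite[OF H]
  interpret wl_family "joint_vertices G H" "joint_pair_color G H" by (rule wl_family_joint[OF finGH])
  have fG: "{v \<in> joint_vertices G H False. (\<lambda>i. joint_pair_color G H i v v) = k} = Inl ` {v \<in> V G. (\<lambda>i. wl2_color G i v v) = k}" for k
    by (auto simp: joint_vertices_def)
  have fH: "{v \<in> joint_vertices G H True. (\<lambda>i. joint_pair_color G H i v v) = k} = Inr ` {v \<in> V H. (\<lambda>i. wl2_color H i v v) = k}" for k
    by (auto simp: joint_vertices_def)
  have card: "card {v \<in> joint_vertices G H g. (\<lambda>i. joint_pair_color G H i v v) = k} = card {v \<in> V G. (\<lambda>i. wl2_color G i v v) = k}" for g k
    using wl2_equivalent_fiber_card[OF finGH eq, of k]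
    by (cases g) (simp_all only: fG fH card_image inj_Inl inj_Inr inj_on_subset[OF inj_Inl] inj_on_subset[OF inj_Inr] subset_UNIV)
  show ?thesis
  proof
    show "finite (joint_vertices G H g)" for g by (rule fin)
  next
    fix x g y x' h y'
    assume W: "x \<in> joint_vertices G H g" "y \<in> joint_vertices G H g" "x' \<in> joint_vertices G H h" "y' \<in> joint_vertices G H h"
      and e: "(\<lambda>i. joint_pair_color G H i x y) = (\<lambda>i. joint_pair_color G H i x' y')"
    have e': "joint_pair_color G H i x y = joint_pair_color G H i x' y'" for i using e by meson
    show "\<exists>f. bij_betw f (joint_vertices G H g) (joint_vertices G H h) \<and>
          (\<forall>w\<in>joint_vertices G H g. (\<lambda>i. joint_pair_color G H i x' (f w)) = (\<lambda>i. joint_pair_color G H i x w) \<and>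
              (\<lambda>i. joint_pair_color G H i (f w) y') = (\<lambda>i. joint_pair_color G H i w y))"
      using limit_color_bij[OF W e'] by (simp add: fun_eq_iff all_conj_distrib)
    show "(\<lambda>i. joint_pair_color G H i y x) = (\<lambda>i. joint_pair_color G H i y' x')"
    proof
      fix i
      show "joint_pair_color G H i y x = joint_pair_color G H i y' x'"
      proof (rule color_transp[OF _ W e'])
        fix x y x' y' g h
        assume "x \<in> joint_vertices G H g" "y \<in> joint_vertices G H g" "x' \<in> joint_vertices G H h" "y' \<in> joint_vertices G H h"
          "joint_pair_color G H 0 x y = joint_pair_color G H 0 x' y'"
        then show "joint_pair_color G H 0 y x = joint_pair_color G H 0 y' x'"
          using is_vc_graph_adj_sym[OF G] is_vc_graph_adj_sym[OF H]
          by (cases g; cases h) (auto simp: joint_vertices_def initial_color_def split: if_splits)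
      qed
    qed
  next
    fix x y z g h
    assume W: "x \<in> joint_vertices G H g" "y \<in> joint_vertices G H g" "z \<in> joint_vertices G H h"
      and e: "(\<lambda>i. joint_pair_color G H i x y) = (\<lambda>i. joint_pair_color G H i z z)"
    have "joint_pair_color G H 0 x y = joint_pair_color G H 0 z z" using e by meson
    then show "x = y" using W
      by (cases g; cases h) (auto simp: joint_vertices_def initial_color_def split: if_splits)
  next
    show "card {v \<in> joint_vertices G H g. (\<lambda>i. joint_pair_color G H i v v) = k} = card {v \<in> joint_vertices G H h. (\<lambda>i. joint_pair_color G H i v v) = k}" for g h k
      by (simp only: card)
  next
    fix g k
    have "card {v \<in> V G. (\<lambda>i. wl2_color G i v v) = k} \<le> 4"
    proof (cases "{v \<in> V G. (\<lambda>i. wl2_color G i v v) = k} = {}")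
      case False
      then obtain u where u: "u \<in> V G" "(\<lambda>i. wl2_color G i u u) = k" by blast
      have "vcol G v = vcol G u" if "(\<lambda>i. wl2_color G i v v) = k" for v
        using vertex_color_wl2(2)[of G v v G u u] fun_cong[OF trans[OF that u(2)[symmetric]]] by simp
      then have "{v \<in> V G. (\<lambda>i. wl2_color G i v v) = k} \<subseteq> {v \<in> V G. vcol G v = vcol G u}" by blast
      from card_mono[OF _ this] show ?thesis using finGH le[of "vcol G u"] by simp
    qed (simp only: card.empty)
    then show "card {v \<in> joint_vertices G H g. (\<lambda>i. joint_pair_color G H i v v) = k} \<le> 4" unfolding card .
  qed
qed

text \<open>\<open>\<pi> j u\<close> is the other vertex in the class of \<open>u\<close> that has
  the same neighbors in class \<open>j\<close>. \<open>D\<close> records for which classes and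
  directions partners are adjacent. The twist does not enter.\<close>

definition partner_map :: "('a, 'c) vc_graph \<Rightarrow> 'c set \<Rightarrow> 'c rel \<Rightarrow> ('c \<Rightarrow> 'a \<Rightarrow> 'a) \<Rightarrow> bool" where
  "partner_map G C D \<pi> \<longleftrightarrow> (\<forall>u\<in>V G. \<forall>j\<in>C - {vcol G u}.
     \<pi> j u \<in> V G \<and> vcol G (\<pi> j u) = vcol G u \<and> \<pi> j u \<noteq> u \<and> (adj G u (\<pi> j u) \<longleftrightarrow> (vcol G u, j) \<in> D) \<and>
     (\<forall>k\<in>C - {vcol G u, j}. \<pi> k u \<noteq> \<pi> j u) \<and>
     (\<forall>v\<in>V G. vcol G v = j \<longrightarrow> (\<forall>w\<in>V G. vcol G w = vcol G u \<longrightarrow> (adj G w v = adj G u v \<longleftrightarrow> w = u \<or> w = \<pi> j u))))"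

definition cfi :: "('a, 'c) vc_graph \<Rightarrow> 'c set \<Rightarrow> 'c rel \<Rightarrow> bool" where
  "cfi G C D \<longleftrightarrow> is_vc_graph G \<and> vcol G ` V G = C \<and> card C = 4 \<and> D \<subseteq> C \<times> C - Id \<and>
     (\<forall>i\<in>C. card {v \<in> V G. vcol G v = i} = 4) \<and> (\<exists>\<pi>. partner_map G C D \<pi>)"

lemma card_image_same_kernel:
  assumes "\<And>u v. u \<in> A \<Longrightarrow> v \<in> A \<Longrightarrow> f u = f v \<longleftrightarrow> g u = g v"
  shows "card (f ` A) = card (g ` A)"
proof -
  define h where "h y = g (inv_into A f y)" for y
  have h: "h (f u) = g u" if "u \<in> A" for u
    unfolding h_def using assms[of "inv_into A f (f u)" u] that by (simp add: inv_into_into f_inv_into_f)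
  have "g ` A = h ` f ` A" using h by (auto simp: image_iff)
  moreover have "inj_on h (f ` A)" using h assms by (auto simp: inj_on_def)
  ultimately show ?thesis by (simp add: card_image)
qed

lemma vc_isoI:
  assumes "finite (V G)" "finite (V H)" "card (V G) = card (V H)" "inj_on f (V G)" "\<And>u. u \<in> V G \<Longrightarrow> f u \<in> V H"
    "\<And>u v. u \<in> V G \<Longrightarrow> v \<in> V G \<Longrightarrow> adj G u v \<longleftrightarrow> adj H (f u) (f v)" "\<And>u. u \<in> V G \<Longrightarrow> vcol H (f u) = vcol G u"
  shows "vc_iso G H"
proof -
  have "f ` V G = V H" by (rule card_subset_eq[OF assms(2)]) (use assms in \<open>auto simp: card_image\<close>)
  then show ?thesis unfolding vc_iso_def bij_betw_def using assms by blast
qed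

text \<open>Translates the four linked fibers back into the graph: fibers fill the color classes,
  since the latter have at most four elements, and the two limit colors between two fibers are
  adjacency and nonadjacency.\<close>

theorem wl2_equivalent_iso_or_cfi:
  fixes G :: "('a, 'c) vc_graph" and H :: "('b, 'c) vc_graph"
  assumes G: "is_vc_graph G" and H: "is_vc_graph H" and eq: "wl2_equivalent G H"
    and le: "\<And>k. card {v \<in> V G. vcol G v = k} \<le> 4" and V16: "card (V G) \<le> 16" and noniso: "\<not> vc_iso G H"
  shows "card (V G) = 16 \<and> (\<exists>D. cfi G (vcol G ` V G) D)"
proof -
  note finGH = is_vc_graph_finite[OF G] is_vc_graph_finite[OF H]
  define c where "c x y i = joint_pair_color G H i x y" for x y i
  interpret coherent_pair "joint_vertices G H" c
    using coherent_pair_joint[OF G H eq le] unfolding c_def .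
  have cG: "c (Inl u) (Inl v) = (\<lambda>i. wl2_color G i u v)" for u v by (simp add: c_def fun_eq_iff)
  have cH: "c (Inr u) (Inr v) = (\<lambda>i. wl2_color H i u v)" for u v by (simp add: c_def fun_eq_iff)
  have WG: "Inl u \<in> joint_vertices G H False \<longleftrightarrow> u \<in> V G" for u by (auto simp: joint_vertices_def)
  have WH: "Inr u \<in> joint_vertices G H True \<longleftrightarrow> u \<in> V H" for u by (auto simp: joint_vertices_def)
  have WHE: "\<exists>v\<in>V H. x = Inr v" if "x \<in> joint_vertices G H True" for x using that by (auto simp: joint_vertices_def)
  have WGE: "\<exists>v\<in>V G. x = Inl v" if "x \<in> joint_vertices G H False" for x using that by (auto simp: joint_vertices_def)
  have adj_c: "adj G u v \<longleftrightarrow> adj G u' v'" if "c (Inl u) (Inl v) = c (Inl u') (Inl v')" "u \<noteq> v" for u v u' v'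
    using vertex_color_wl2(3)[of G u v G u' v'] fun_cong[OF that(1)[unfolded cG]] that(2) by blast
  have adj_cH: "(u = v \<longleftrightarrow> u' = v') \<and> (adj G u v \<longleftrightarrow> adj H u' v')" if "c (Inl u) (Inl v) = c (Inr u') (Inr v')" for u v u' v'
    using vertex_color_wl2(1,3)[of G u v H u' v'] fun_cong[OF that[unfolded cG cH]] G H
    unfolding is_vc_graph_iff by (cases "u = v") blast+
  have vcol_c: "vcol G u = vcol G v" if "c (Inl u) (Inl u) = c (Inl v) (Inl v)" for u v
    using vertex_color_wl2(2)[of G u u G v v] fun_cong[OF that[unfolded cG]] by blast
  have vcol_cH: "vcol G u = vcol H v" if "c (Inl u) (Inl u) = c (Inr v) (Inr v)" for u v
    using vertex_color_wl2(2)[of G u u H v v] fun_cong[OF that[unfolded cG cH]] by blast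
  have W_fib: "Inl u \<in> U fibers" if "u \<in> V G" for u
    using that by (auto simp: U_def fibers_def WG)
  \<comment> \<open>\<open>E\<close> marks pairs whose limit color \<open>\<phi>\<close> preserves.
    Elsewhere preserving adjacency is enough, provided the two ends lie in different fibers, which
    keeps the map injective.\<close>
  have iso: "vc_iso G H"
    if \<phi>: "\<forall>u\<in>U fibers. \<phi> u \<in> joint_vertices G H True \<and> c (\<phi> u) (\<phi> u) = c u u"
    and E: "\<And>u v. u \<in> V G \<Longrightarrow> v \<in> V G \<Longrightarrow> E u v \<Longrightarrow> c (\<phi> (Inl u)) (\<phi> (Inl v)) = c (Inl u) (Inl v)"
    and E': "\<And>u v u' v'. u \<in> V G \<Longrightarrow> v \<in> V G \<Longrightarrow> \<not> E u v \<Longrightarrow> \<phi> (Inl u) = Inr u' \<Longrightarrow> \<phi> (Inl v) = Inr v' \<Longrightarrow> c (Inl u) (Inl u) \<noteq> c (Inl v) (Inl v) \<and> (adj G u v \<longleftrightarrow> adj H u' v')"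
    for \<phi> E
  proof -
    have "\<exists>u'\<in>V H. \<phi> (Inl u) = Inr u'" if "u \<in> V G" for u using \<phi> W_fib[OF that] WHE by blast
    then obtain f where f: "\<And>u. u \<in> V G \<Longrightarrow> f u \<in> V H \<and> \<phi> (Inl u) = Inr (f u)" by metis
    show ?thesis
    proof (rule vc_isoI[OF finGH wl2_equivalent_card[OF finGH eq]])
      show "f u \<in> V H" if "u \<in> V G" for u using f that by blast
      show "vcol H (f u) = vcol G u" if "u \<in> V G" for u
        using vcol_cH[of u "f u"] \<phi> W_fib[OF that] f[OF that] by metis
      show "adj G u v \<longleftrightarrow> adj H (f u) (f v)" if "u \<in> V G" "v \<in> V G" for u v
        using adj_cH[of u v "f u" "f v"] E[OF that] E'[OF that] f[OF that(1)] f[OF that(2)] by metis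
      show "inj_on f (V G)"
      proof (rule inj_onI)
        fix u v assume uv: "u \<in> V G" "v \<in> V G" "f u = f v"
        then have "c (Inl u) (Inl u) = c (Inl v) (Inl v)" using \<phi> W_fib f by metis
        then have "E u v" using E'[OF uv(1,2)] f uv by metis
        then show "u = v" using adj_cH[of u v "f u" "f v"] E[OF uv(1,2)] f uv by metis
      qed
    qed
  qed
  have "\<not> partial_iso fibers"
  proof
    assume "partial_iso fibers"
    then obtain \<phi> where \<phi>: "\<forall>u\<in>U fibers. \<phi> u \<in> joint_vertices G H True" "\<forall>u\<in>U fibers. \<forall>v\<in>U fibers. c (\<phi> u) (\<phi> v) = c u v"
      unfolding partial_iso_def by blast
    have "vc_iso G H"
      by (rule iso[of \<phi> "\<lambda>_ _. True"]) (use \<phi> W_fib in auto)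
    with noniso show False by blast
  qed
  moreover have cardW: "card (joint_vertices G H False) = card (V G)" by (simp add: joint_vertices_def card_image)
  ultimately have quad: "reduced fibers" "card fibers = 4" "\<And>k g. k \<in> fibers \<Longrightarrow> card (F g k) = 4" "card (V G) = 16"
    using partial_iso_or_four_fibers V16 by auto
  interpret reduced_pair "joint_vertices G H" c fibers by unfold_locales (use quad in auto)
  note ff = four_fibers[OF quad(2) \<open>\<not> partial_iso fibers\<close>]
  define k where "k u = c (Inl u) (Inl u)" for u
  have kfib: "k u \<in> fibers" if "u \<in> V G" for u using that by (auto simp: fibers_def k_def WG)
  have inF: "Inl u \<in> F False (k u)" if "u \<in> V G" for u using that by (auto simp: F_def k_def WG)
  have FG: "F False (k u) = Inl ` {v \<in> V G. vcol G v = vcol G u}" if u: "u \<in> V G" for u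
  proof (rule card_subset_eq)
    show "F False (k u) \<subseteq> Inl ` {v \<in> V G. vcol G v = vcol G u}"
    proof
      fix x assume x: "x \<in> F False (k u)"
      then obtain v where v: "v \<in> V G" "x = Inl v" using WGE[OF F_W[OF x]] by blast
      then have "vcol G v = vcol G u" using vcol_c[of v u] F_c[OF x] by (simp add: k_def)
      then show "x \<in> Inl ` {v \<in> V G. vcol G v = vcol G u}" using v by blast
    qed
    then have "card (F False (k u)) \<le> card (Inl ` {v \<in> V G. vcol G v = vcol G u} :: ('a + 'b) set)"
      using finGH by (intro card_mono) auto
    then show "card (F False (k u)) = card (Inl ` {v \<in> V G. vcol G v = vcol G u} :: ('a + 'b) set)"
      using quad(3)[OF kfib[OF u], of False] le[of "vcol G u"] by (simp add: card_image)
    have "finite {v \<in> V G. vcol G v = vcol G u}" by (rule finite_subset[OF _ finGH(1)]) blast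
    then show "finite (Inl ` {v \<in> V G. vcol G v = vcol G u} :: ('a + 'b) set)" by (rule finite_imageI)
  qed
  have kv: "vcol G u = vcol G v \<longleftrightarrow> k u = k v" if "u \<in> V G" "v \<in> V G" for u v
  proof
    assume "vcol G u = vcol G v"
    then have "Inl v \<in> F False (k u)" using FG[OF that(1)] that by auto
    then show "k u = k v" by (simp add: F_def k_def)
  next
    assume "k u = k v"
    then show "vcol G u = vcol G v" unfolding k_def by (rule vcol_c)
  qed
  define C where "C = vcol G ` V G"
  have C4: "card C = 4"
    using card_image_same_kernel[of "V G" "vcol G" k] kv quad(2)
    by (simp add: C_def fibers_def k_def joint_vertices_def image_image)
  have class4: "card {v \<in> V G. vcol G v = i} = 4" if "i \<in> C" for i
    using FG that quad(3)[OF kfib, of _ False] by (auto simp: C_def card_image)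
  have T: "K22 (k u) (k v)" if "u \<in> V G" "v \<in> V G" "vcol G u \<noteq> vcol G v" for u v
    using ff(1) kfib kv that by auto
  \<comment> \<open>Were adjacency constant between two fibers, it would be the same constant in
    \<open>H\<close>, and the map preserving all colors except between these fibers would be an
    isomorphism.\<close>
  have vary: "\<exists>x y x2 y2. x \<in> V G \<and> y \<in> V G \<and> x2 \<in> V G \<and> y2 \<in> V G \<and> k x = k u \<and> k x2 = k u \<and> k y = k v \<and> k y2 = k v \<and> adj G x y \<noteq> adj G x2 y2"
    if uv: "u \<in> V G" "v \<in> V G" "k u \<noteq> k v" for u v
  proof (rule ccontr)
    assume const: "\<not> ?thesis"
    have constH: "adj H x' y' \<longleftrightarrow> adj G u v" if "x' \<in> V H" "y' \<in> V H" "c (Inr x') (Inr x') = k u" "c (Inr y') (Inr y') = k v" for x' y'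
    proof -
      have y'W: "Inr y' \<in> joint_vertices G H True" using that by (simp add: WH)
      have x'F: "Inr x' \<in> F True (k u)" using that by (auto simp: F_def WH)
      obtain y0 where y0: "y0 \<in> joint_vertices G H False" "c (Inl u) y0 = c (Inr x') (Inr y')" "c y0 y0 = c (Inr y') (Inr y')"
        using ext_point1[OF x'F inF[OF uv(1)] y'W] by blast
      obtain y where y: "y \<in> V G" "y0 = Inl y" using WGE[OF y0(1)] by blast
      have "k y = k v" using y0 y that by (simp add: k_def)
      then have "adj G u y \<longleftrightarrow> adj G u v" using const uv y by blast
      then show ?thesis using adj_cH[of u y x' y'] y0 y by simp
    qed
    have kv_mem: "k v \<in> fibers - {k u}" using kfib[OF uv(2)] uv(3) by simp
    obtain \<phi> where \<phi>: "\<forall>u\<in>U fibers. \<phi> u \<in> joint_vertices G H True \<and> c (\<phi> u) (\<phi> u) = c u u"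
      "\<forall>x\<in>U fibers. \<forall>y\<in>U fibers. {c x x, c y y} \<noteq> {k u, k v} \<longrightarrow> c (\<phi> x) (\<phi> y) = c x y"
      using ff(3)[rule_format, OF kfib[OF uv(1)] kv_mem] by blast
    have "vc_iso G H"
    proof (rule iso[OF \<phi>(1), of "\<lambda>x y. {k x, k y} \<noteq> {k u, k v}"])
      show "c (\<phi> (Inl x)) (\<phi> (Inl y)) = c (Inl x) (Inl y)" if "x \<in> V G" "y \<in> V G" "{k x, k y} \<noteq> {k u, k v}" for x y
        using \<phi>(2)[rule_format, OF W_fib[OF that(1)] W_fib[OF that(2)]] that(3) unfolding k_def by blast
      fix x y x' y' assume xy: "x \<in> V G" "y \<in> V G" "\<not> {k x, k y} \<noteq> {k u, k v}" "\<phi> (Inl x) = Inr x'" "\<phi> (Inl y) = Inr y'"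
      have V': "x' \<in> V H" "y' \<in> V H" "c (Inr x') (Inr x') = k x" "c (Inr y') (Inr y') = k y"
        using bspec[OF \<phi>(1) W_fib[OF xy(1)]] bspec[OF \<phi>(1) W_fib[OF xy(2)]] unfolding xy(4,5) WH k_def by blast+
      from xy(3) consider "k x = k u" "k y = k v" | "k x = k v" "k y = k u" by (auto simp: doubleton_eq_iff)
      then show "c (Inl x) (Inl x) \<noteq> c (Inl y) (Inl y) \<and> (adj G x y \<longleftrightarrow> adj H x' y')"
      proof cases
        case 1
        then have "adj G x y \<longleftrightarrow> adj G u v" using const xy uv by blast
        then show ?thesis using constH[OF V'(1,2)] V'(3,4) 1 uv(3) unfolding k_def by metis
      next
        case 2
        then have "adj G y x \<longleftrightarrow> adj G u v" using const xy uv by blast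
        then show ?thesis using constH[OF V'(2,1)] V'(3,4) 2 uv(3) is_vc_graph_adj_sym[OF G, of x y] is_vc_graph_adj_sym[OF H, of x' y']
          unfolding k_def by metis
      qed
    qed
    with noniso show False by blast
  qed
  have cadj: "c (Inl u) (Inl v) = c (Inl u2) (Inl v2) \<longleftrightarrow> (adj G u v \<longleftrightarrow> adj G u2 v2)"
    if uv: "u \<in> V G" "v \<in> V G" "u2 \<in> V G" "v2 \<in> V G" "k u2 = k u" "k v2 = k v" "k u \<noteq> k v" for u v u2 v2
  proof
    assume "c (Inl u) (Inl v) = c (Inl u2) (Inl v2)"
    then show "adj G u v \<longleftrightarrow> adj G u2 v2" using adj_c uv by blast
  next
    assume a: "adj G u v \<longleftrightarrow> adj G u2 v2"
    obtain x y where xy: "x \<in> V G" "y \<in> V G" "k x = k u" "k y = k v" "adj G x y \<noteq> adj G u v"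
      using vary[OF uv(1,2,7)] by metis
    have "linked (k u) (k v)" using T[OF uv(1,2)] kv[OF uv(1,2)] uv(7) by (simp add: K22_def)
    then show "c (Inl u) (Inl v) = c (Inl u2) (Inl v2)"
    proof (rule linked_two)
      show "Inl u \<in> F False (k u)" "Inl v \<in> F False (k v)" "Inl x \<in> F False (k u)" "Inl y \<in> F False (k v)"
        "Inl u2 \<in> F False (k u)" "Inl v2 \<in> F False (k v)" using inF uv xy by metis+
      show "c (Inl u) (Inl v) \<noteq> c (Inl x) (Inl y)" "c (Inl u2) (Inl v2) \<noteq> c (Inl x) (Inl y)"
        using adj_c[of u v x y] adj_c[of u2 v2 x y] xy(5) a uv(5,6,7) by metis+
    qed
  qed
  have part: "\<exists>v\<in>V G. vcol G v = vcol G u \<and> v \<noteq> u \<and> same_row False (k y0) (Inl u) (Inl v)"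
    if u: "u \<in> V G" and y0: "y0 \<in> V G" and neq: "vcol G u \<noteq> vcol G y0" for u y0
  proof -
    obtain v0 where v0: "v0 \<in> F False (k u)" "v0 \<noteq> Inl u" "same_row False (k y0) (Inl u) v0"
      using T[OF u y0 neq] inF[OF u] unfolding K22_def by metis
    then show ?thesis using FG[OF u] by auto
  qed
  define rep where "rep j = (SOME y. y \<in> V G \<and> vcol G y = j)" for j
  have rep: "rep j \<in> V G" "vcol G (rep j) = j" if "j \<in> C" for j
    using someI_ex[of "\<lambda>y. y \<in> V G \<and> vcol G y = j"] that unfolding rep_def C_def by blast+
  define \<pi> where "\<pi> j u = (SOME v. v \<in> V G \<and> vcol G v = vcol G u \<and> v \<noteq> u \<and> same_row False (k (rep j)) (Inl u) (Inl v))" for j u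
  have \<pi>: "\<pi> j u \<in> V G" "vcol G (\<pi> j u) = vcol G u" "\<pi> j u \<noteq> u" "same_row False (k (rep j)) (Inl u) (Inl (\<pi> j u))"
    if "u \<in> V G" "j \<in> C - {vcol G u}" for j u
  proof -
    have "vcol G u \<noteq> vcol G (rep j)" "rep j \<in> V G" using rep[of j] that(2) by auto
    then have "\<exists>v. v \<in> V G \<and> vcol G v = vcol G u \<and> v \<noteq> u \<and> same_row False (k (rep j)) (Inl u) (Inl v)"
      using part[OF that(1)] by blast
    from someI_ex[OF this]
    show "\<pi> j u \<in> V G" "vcol G (\<pi> j u) = vcol G u" "\<pi> j u \<noteq> u" "same_row False (k (rep j)) (Inl u) (Inl (\<pi> j u))"
      unfolding \<pi>_def by simp_all
  qed
  have partner: "adj G w y = adj G u y \<longleftrightarrow> w = u \<or> w = \<pi> j u"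
    if u: "u \<in> V G" "j \<in> C - {vcol G u}" and y: "y \<in> V G" "vcol G y = j" and w: "w \<in> V G" "vcol G w = vcol G u" for u j y w
  proof -
    have ky: "k y = k (rep j)" using kv[of y "rep j"] rep[of j] y u by auto
    have kw: "k w = k u" "k (\<pi> j u) = k u" using kv w u \<pi>[OF u] by metis+
    have neq: "k u \<noteq> k y" using kv[OF u(1) y(1)] u y by auto
    have K22: "K22 (k u) (k y)" using T[OF u(1) y(1)] u y by auto
    have "c (Inl w) (Inl y) = c (Inl u) (Inl y) \<longleftrightarrow> Inl w = (Inl u :: 'a + 'b) \<or> Inl w = (Inl (\<pi> j u) :: 'a + 'b)"
      by (rule K22_partner[OF K22]) (use inF[OF u(1)] inF[OF w(1)] inF[OF y(1)] inF[OF \<pi>(1)[OF u]] kw ky \<pi>[OF u] in auto)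
    then show ?thesis using cadj[OF w(1) y(1) u(1) y(1)] kw neq by simp
  qed
  have distinct: "\<pi> l u \<noteq> \<pi> j u" if u: "u \<in> V G" "j \<in> C - {vcol G u}" "l \<in> C - {vcol G u, j}" for u j l
  proof
    assume e: "\<pi> l u = \<pi> j u"
    have u': "l \<in> C - {vcol G u}" using u by auto
    have kk: "k u \<in> fibers" "k (rep j) \<in> fibers - {k u}" "k (rep l) \<in> fibers - {k u, k (rep j)}"
      using kfib[OF u(1)] kfib[OF rep(1)] kv[OF rep(1) u(1)] kv[OF rep(1) rep(1), of l j] rep(2) u by auto
    have "Inl (\<pi> j u) \<in> F False (k u)" using FG[OF u(1)] \<pi>[OF u(1,2)] by auto
    then show False
      using ff(2)[rule_format, OF kk inF[OF u(1)], of "Inl (\<pi> j u)"] \<pi>(3,4)[OF u(1,2)] \<pi>(4)[OF u(1) u'] e by auto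
  qed
  \<comment> \<open>The color of \<open>u\<close> and its partner occurs at \<open>u2\<close> too;
    since having equal rows toward class \<open>j\<close> is a property of the color, it leads from
    \<open>u2\<close> to its partner.\<close>
  have inner: "adj G u (\<pi> j u) \<longleftrightarrow> adj G u2 (\<pi> j u2)" if u: "u \<in> V G" "j \<in> C - {vcol G u}" and u2: "u2 \<in> V G" "vcol G u2 = vcol G u" for u u2 j
  proof -
    have j2: "j \<in> C - {vcol G u2}" using u u2 by simp
    have ku: "k u2 = k u" using kv u u2 by metis
    have u2F: "Inl u2 \<in> F False (k u)" using inF[OF u2(1)] ku by simp
    obtain v0 where v0: "v0 \<in> joint_vertices G H False" "c (Inl u2) v0 = c (Inl u) (Inl (\<pi> j u))" "c v0 v0 = c (Inl (\<pi> j u)) (Inl (\<pi> j u))"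
      using ext_point1[OF inF[OF u(1)] u2F, of "Inl (\<pi> j u)"] \<pi>(1)[OF u] by (auto simp: WG)
    obtain v where v: "v \<in> V G" "v0 = Inl v" using WGE[OF v0(1)] by blast
    have "k v = k (\<pi> j u)" using v0 v by (simp add: k_def)
    then have vc: "vcol G v = vcol G u2" using kv[OF v(1) \<pi>(1)[OF u]] \<pi>[OF u] u2 by simp
    have adj: "adj G u (\<pi> j u) \<longleftrightarrow> adj G u2 v" using adj_c[of u "\<pi> j u" u2 v] v0 v \<pi>(3)[OF u] by metis
    have "v \<noteq> u2"
    proof
      assume "v = u2"
      then have "Inl u = (Inl (\<pi> j u) :: 'a + 'b)" using diag[of "Inl u" False "Inl (\<pi> j u)" "Inl u2" False] v0 v u u2 \<pi>[OF u] by (simp add: WG)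
      then show False using \<pi>(3)[OF u] by simp
    qed
    have "same_row False (k (rep j)) (Inl u2) (Inl v)"
      using same_row_transfer[of "Inl u" False "Inl (\<pi> j u)" "Inl u2" False "Inl v"] \<pi>[OF u] u u2 v v0 by (simp add: WG)
    then have "c (Inl u2) (Inl (rep j)) = c (Inl v) (Inl (rep j))" using inF[OF rep(1)] u unfolding same_row_def by blast
    then have "adj G v (rep j) = adj G u2 (rep j)"
      using adj_c[of u2 "rep j" v "rep j"] rep[of j] u u2 by (metis DiffD1 DiffD2 singletonI)
    then have "v = \<pi> j u2" using partner[OF u2(1) j2 rep[of j] v(1) vc] \<open>v \<noteq> u2\<close> u by blast
    then show ?thesis using adj by simp
  qed
  define D where "D = {(i, j). i \<in> C \<and> j \<in> C \<and> i \<noteq> j \<and> adj G (rep i) (\<pi> j (rep i))}"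
  have "cfi G C D" unfolding cfi_def partner_map_def
  proof (intro conjI exI[of _ \<pi>] ballI)
    show "is_vc_graph G" by (rule G)
    show "vcol G ` V G = C" by (simp add: C_def)
    show "card C = 4" by (rule C4)
    show "D \<subseteq> C \<times> C - Id" by (auto simp: D_def)
    show "card {v \<in> V G. vcol G v = i} = 4" if "i \<in> C" for i by (rule class4[OF that])
    fix u j assume u: "u \<in> V G" "j \<in> C - {vcol G u}"
    show "\<pi> j u \<in> V G" "vcol G (\<pi> j u) = vcol G u" "\<pi> j u \<noteq> u" using \<pi>[OF u] by auto
    have uC: "vcol G u \<in> C" using u by (simp add: C_def)
    show "adj G u (\<pi> j u) \<longleftrightarrow> (vcol G u, j) \<in> D"
      using inner[OF u rep(1)[OF uC] rep(2)[OF uC]] u uC by (auto simp: D_def)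
    show "\<pi> l u \<noteq> \<pi> j u" if "l \<in> C - {vcol G u, j}" for l by (rule distinct[OF u that])
    show "vcol G v = j \<longrightarrow> (\<forall>w\<in>V G. vcol G w = vcol G u \<longrightarrow> (adj G w v = adj G u v \<longleftrightarrow> w = u \<or> w = \<pi> j u))" if "v \<in> V G" for v
      using partner[OF u that] by blast
  qed
  then show ?thesis using quad(4) by (auto simp: C_def)
qed

section \<open>The graphs of Cai, Fuerer and Immerman over four colors\<close>

unbundle bit_operations_syntax

lemma less_4: "(a::nat) < 4 \<longleftrightarrow> a = 0 \<or> a = 1 \<or> a = 2 \<or> a = 3" by auto

lemma xor_less_4:
  assumes "a < 4" "d < (4::nat)" shows "a XOR d < 4"
  using assms unfolding less_4 by (elim disjE) simp_all

text \<open>The subgroup \<open>{0, k}\<close> of the Klein group, which is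
  \<open>{0, 1, 2, 3}\<close> under \<open>XOR\<close>. For \<open>k \<noteq> 0\<close> it has index
  two and is the kernel of a character; \<open>ker_xor\<close> is the multiplicativity of this
  character.\<close>

definition ker :: "nat \<Rightarrow> nat \<Rightarrow> bool" where "ker k a \<longleftrightarrow> a = 0 \<or> a = k"

lemma ker_xor:
  assumes "k < 4" "k \<noteq> 0" "a < 4" "d < 4" shows "ker k (a XOR d) \<longleftrightarrow> (ker k a \<longleftrightarrow> ker k d)"
  using assms unfolding less_4 by (elim disjE) (simp_all add: ker_def)

lemma xor_eq_0_iff: "a XOR d = 0 \<longleftrightarrow> a = (d::nat)"
  by (metis xor.right_neutral xor.assoc xor_self_eq xor.commute)

lemma xor_left_cancel: "a XOR d = a XOR e \<longleftrightarrow> d = (e::nat)"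
  by (metis xor.assoc xor.left_neutral xor_self_eq)

text \<open>Two different nontrivial characters together map the Klein group bijectively to pairs of
  bits; the witness is the preimage.\<close>

lemma ker_independent:
  assumes "k < 4" "k \<noteq> 0" "l < 4" "l \<noteq> 0" "k \<noteq> l" shows "\<exists>t<4. ker k t = \<alpha> \<and> ker l t = \<beta>"
proof -
  let ?t = "if \<alpha> then if \<beta> then 0 else k else if \<beta> then l else k XOR l"
  have "k XOR l \<noteq> k" "k XOR l \<noteq> l" "k XOR l \<noteq> 0"
    using assms xor_left_cancel[of k l 0] xor_left_cancel[of l k 0] by (auto simp: xor.commute xor_eq_0_iff)
  then have "ker k ?t = \<alpha> \<and> ker l ?t = \<beta>" using assms by (auto simp: ker_def)
  moreover have "?t < 4" using assms xor_less_4 by simp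
  ultimately show ?thesis by blast
qed

text \<open>Each of the four elements enters three conditions, with the characters 1, 2 and 3, whose
  product is trivial. So an even number of the six \<open>ker\<close> conditions fails, and it
  cannot be one.\<close>

lemma no_twisted_clique:
  assumes "a0 < 4" "a1 < 4" "a2 < 4" "a3 < (4::nat)"
  shows "\<not> (\<not> ker 1 (a0 XOR a1) \<and> ker 2 (a0 XOR a2) \<and> ker 3 (a0 XOR a3) \<and> ker 3 (a1 XOR a2) \<and> ker 2 (a1 XOR a3) \<and> ker 1 (a2 XOR a3))"
proof -
  have k: "ker 3 a \<longleftrightarrow> (ker 1 a \<longleftrightarrow> ker 2 a)" if "a < 4" for a
    using that unfolding less_4 by (elim disjE) (simp_all add: ker_def)
  show ?thesis using assms by (simp add: ker_xor k) blast
qed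

text \<open>
  The graphs of Cai, Fuerer and Immerman over the complete graph on the four colors. Vertices of color \<open>i\<close>
  are the elements \<open>a\<close> of the Klein group, written \<open>4 * i + a\<close>; the matching in direction \<open>j\<close> on color
  class \<open>i\<close> is the translation by \<open>i XOR j\<close>, and \<open>D\<close> tells which matchings are edges.
\<close>

definition twisted :: "bool \<Rightarrow> nat \<Rightarrow> nat \<Rightarrow> bool" where
  "twisted b i j \<longleftrightarrow> b \<and> {i, j} = {0, 1}"

text \<open>Inside class \<open>i\<close> the translation from \<open>a\<close> to \<open>d\<close>
  is \<open>a XOR d\<close>, and its direction is recovered as
  \<open>i XOR (a XOR d)\<close>.\<close>

definition cfi_adj :: "nat rel \<Rightarrow> bool \<Rightarrow> nat \<Rightarrow> nat \<Rightarrow> nat \<Rightarrow> nat \<Rightarrow> bool" where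
  "cfi_adj D b i a j d \<longleftrightarrow>
     (if i = j then a \<noteq> d \<and> (i, i XOR (a XOR d)) \<in> D else ker (i XOR j) (a XOR d) \<noteq> twisted b i j)"

definition cfi_graph :: "nat rel \<Rightarrow> bool \<Rightarrow> (nat, nat) vc_graph" where
  "cfi_graph D b = \<lparr>ugraph = \<lparr>pverts = {..<16},
     parcs = {(u, v). u < 16 \<and> v < 16 \<and> cfi_adj D b (u div 4) (u mod 4) (v div 4) (v mod 4)}\<rparr>,
     vcol = (\<lambda>v. v div 4)\<rparr>"

lemma V_cfi_graph [simp]: "V (cfi_graph D b) = {..<16}" by (simp add: cfi_graph_def)

lemma vcol_cfi_graph [simp]: "vcol (cfi_graph D b) v = v div 4" by (simp add: cfi_graph_def)

lemma adj_cfi_graph: "adj (cfi_graph D b) u v \<longleftrightarrow> u < 16 \<and> v < 16 \<and> cfi_adj D b (u div 4) (u mod 4) (v div 4) (v mod 4)"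
  by (simp add: cfi_graph_def)

lemma cfi_adj_sym: "cfi_adj D b i a j d \<longleftrightarrow> cfi_adj D b j d i a"
  by (auto simp: cfi_adj_def twisted_def xor.commute insert_commute)

lemma is_vc_graph_cfi_graph [simp]: "is_vc_graph (cfi_graph D b)"
  unfolding is_vc_graph_iff by (auto simp: adj_cfi_graph cfi_adj_sym[of D b] cfi_adj_def[of D b _ _ _ _])

abbreviation arcs4 :: "nat rel" where "arcs4 \<equiv> {..<4} \<times> {..<4} - Id"

lemma cfi_cfi_graph:
  assumes "D \<subseteq> arcs4"
  shows "cfi (cfi_graph D b) {..<4} D"
  unfolding cfi_def partner_map_def
proof (intro conjI exI[of _ "\<lambda>j u. 4 * (u div 4) + (u mod 4 XOR (u div 4 XOR j))"] ballI)
  show "is_vc_graph (cfi_graph D b)" by simp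
  show "vcol (cfi_graph D b) ` V (cfi_graph D b) = {..<4}"
    by (auto simp: image_iff intro!: bexI[of _ "4 * _"])
  show "card {..<4::nat} = 4" by simp
  show "D \<subseteq> {..<4} \<times> {..<4} - Id" by (rule assms)
  show "card {v \<in> V (cfi_graph D b). vcol (cfi_graph D b) v = i} = 4" if "i \<in> {..<4}" for i
  proof -
    have "{v \<in> V (cfi_graph D b). vcol (cfi_graph D b) v = i} = {4 * i..<4 * i + 4}" using that by auto
    then show ?thesis by simp
  qed
  fix u j assume u: "u \<in> V (cfi_graph D b)" and j: "j \<in> {..<4} - {vcol (cfi_graph D b) u}"
  define i a where "i = u div 4" and "a = u mod 4"
  have ia: "i < 4" "a < 4" "u = 4 * i + a" using u by (auto simp: i_def a_def)
  have ij: "i \<noteq> j" "j < 4" using j by (auto simp: i_def)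
  have k: "i XOR j < 4" "i XOR j \<noteq> 0" using xor_less_4[OF ia(1) ij(2)] ij by (auto simp: xor_eq_0_iff)
  have al: "a XOR (i XOR j) < 4" by (rule xor_less_4[OF ia(2) k(1)])
  have ane: "a XOR (i XOR j) \<noteq> a" using k(2) by (metis xor.left_neutral xor.assoc xor_self_eq xor.commute)
  let ?v = "4 * (u div 4) + (u mod 4 XOR (u div 4 XOR j))"
  have v: "?v = 4 * i + (a XOR (i XOR j))" by (simp add: i_def a_def)
  have vd: "?v div 4 = i" "?v mod 4 = a XOR (i XOR j)" unfolding v using al by auto
  show "?v \<in> V (cfi_graph D b)" unfolding v using ia al by simp
  then have v16: "?v < 16" by simp
  show "vcol (cfi_graph D b) ?v = vcol (cfi_graph D b) u" using vd by (simp add: i_def)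
  show "?v \<noteq> u" unfolding v using ane ia by simp
  have "i XOR (a XOR (a XOR (i XOR j))) = j"
    by (metis xor.assoc xor_self_eq xor.left_neutral)
  then show "adj (cfi_graph D b) u ?v \<longleftrightarrow> (vcol (cfi_graph D b) u, j) \<in> D"
    unfolding adj_cfi_graph vd using u v16 ane by (simp add: cfi_adj_def i_def[symmetric] a_def[symmetric])
  show "4 * (u div 4) + (u mod 4 XOR (u div 4 XOR l)) \<noteq> ?v" if "l \<in> {..<4} - {vcol (cfi_graph D b) u, j}" for l
    using that by (simp add: xor_left_cancel)
  show "vcol (cfi_graph D b) y = j \<longrightarrow> (\<forall>w\<in>V (cfi_graph D b). vcol (cfi_graph D b) w = vcol (cfi_graph D b) u \<longrightarrow>
      (adj (cfi_graph D b) w y = adj (cfi_graph D b) u y) = (w = u \<or> w = ?v))" if y: "y \<in> V (cfi_graph D b)" for y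
  proof (intro impI ballI)
    fix w assume yj: "vcol (cfi_graph D b) y = j" and w: "w \<in> V (cfi_graph D b)" and wi: "vcol (cfi_graph D b) w = vcol (cfi_graph D b) u"
    define e d where "e = w mod 4" and "d = y mod 4"
    have we: "e < 4" "d < 4" "w div 4 = i" "y div 4 = j" using wi yj by (simp_all add: i_def e_def d_def)
    have w_eq: "w = 4 * i + e" unfolding we(3)[symmetric] e_def by simp
    have "(adj (cfi_graph D b) w y = adj (cfi_graph D b) u y) = (ker (i XOR j) (e XOR d) = ker (i XOR j) (a XOR d))"
      using u w y ij by (auto simp: adj_cfi_graph cfi_adj_def we(3,4) i_def[symmetric] a_def[symmetric] e_def[symmetric] d_def[symmetric])
    also have "\<dots> = ker (i XOR j) (e XOR a)" using ker_xor[OF k] we ia by metis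
    also have "\<dots> = (e = a \<or> e = a XOR (i XOR j))"
      unfolding ker_def by (metis xor.assoc xor.commute xor_self_eq xor.left_neutral)
    also have "\<dots> = (w = u \<or> w = ?v)"
    proof -
      have "w = 4 * i + z \<longleftrightarrow> e = z" for z using w_eq by linarith
      then show ?thesis unfolding v using ia(3) by metis
    qed
    finally show "(adj (cfi_graph D b) w y = adj (cfi_graph D b) u y) = (w = u \<or> w = ?v)" .
  qed
qed

text \<open>With respect to base points \<open>x i\<close> that are pairwise adjacent, except possibly \<open>x 0\<close> and \<open>x 1\<close>,
  the vertex \<open>4 * i + a\<close> is the partner of \<open>x i\<close> in direction \<open>i XOR a\<close>.\<close>

lemma cfi_normal_form:
  assumes "cfi G {..<4} D"
  shows "\<exists>b. vc_iso (cfi_graph D b) G"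
proof -
  have G: "is_vc_graph G" "vcol G ` V G = {..<4}" and class4: "\<And>i. i < 4 \<Longrightarrow> card {v \<in> V G. vcol G v = i} = 4"
    and D: "D \<subseteq> arcs4"
    using assms by (auto simp: cfi_def)
  obtain \<pi> where "partner_map G {..<4} D \<pi>" using assms unfolding cfi_def by blast
  note \<pi> = this[unfolded partner_map_def]
  define S where "S i = {v \<in> V G. vcol G v = i}" for i
  have sym: "adj G u v \<longleftrightarrow> adj G v u" for u v by (rule is_vc_graph_adj_sym[OF G(1)])
  have \<pi>S: "\<pi> j u \<in> S i" "\<pi> j u \<noteq> u" "adj G u (\<pi> j u) \<longleftrightarrow> (i, j) \<in> D" if "u \<in> S i" "j < 4" "i \<noteq> j" for u i j
    using \<pi>[rule_format, of u j] that by (auto simp: S_def)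
  have \<pi>d: "\<pi> k u \<noteq> \<pi> j u" if "u \<in> S i" "j < 4" "k < 4" "i \<noteq> j" "i \<noteq> k" "j \<noteq> k" for u i j k
    using \<pi>[rule_format, of u j] that by (auto simp: S_def)
  have \<pi>a: "(adj G w v \<longleftrightarrow> adj G u v) \<longleftrightarrow> w = u \<or> w = \<pi> j u" if "u \<in> S i" "w \<in> S i" "v \<in> S j" "j < 4" "i \<noteq> j" for u w v i j
    using \<pi>[rule_format, of u j] that by (auto simp: S_def)
  have Sne: "\<exists>v. v \<in> S i" if "i < 4" for i using class4[OF that] unfolding S_def by (metis (lifting) card.empty equals0I zero_neq_numeral)
  have \<pi>inv: "\<pi> j (\<pi> j u) = u" if "u \<in> S i" "j < 4" "i \<noteq> j" for u i j
  proof -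
    obtain v where v: "v \<in> S j" using Sne \<open>j < 4\<close> by blast
    note 1 = \<pi>S[OF that] note 2 = \<pi>S[OF 1(1) that(2,3)]
    have "adj G (\<pi> j (\<pi> j u)) v \<longleftrightarrow> adj G u v"
      using \<pi>a[OF 1(1) 2(1) v that(2,3)] \<pi>a[OF that(1) 1(1) v that(2,3)] by simp
    then show ?thesis using \<pi>a[OF that(1) 2(1) v that(2,3)] 2(2) by blast
  qed
  \<comment> \<open>The three partner maps are involutions without fixed points on four points and
    differ everywhere, so with the identity they form a Klein group.\<close>
  have \<pi>comp: "\<pi> j (\<pi> k u) = \<pi> l u" if u: "u \<in> S i" and l4: "j < 4" "k < 4" "l < 4" and d: "distinct [i, j, k, l]" for u i j k l
  proof -
    have ne: "i \<noteq> j" "i \<noteq> k" "i \<noteq> l" "j \<noteq> k" "j \<noteq> l" "k \<noteq> l" using d by auto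
    have i4: "i < 4" using u G(2) by (auto simp: S_def)
    have "card {u, \<pi> j u, \<pi> k u, \<pi> l u} = 4"
      using \<pi>S(2)[OF u l4(1) ne(1)] \<pi>S(2)[OF u l4(2) ne(2)] \<pi>S(2)[OF u l4(3) ne(3)]
        \<pi>d[OF u l4(1,2) ne(1,2,4)] \<pi>d[OF u l4(1,3) ne(1,3,5)] \<pi>d[OF u l4(2,3) ne(2,3,6)] by auto
    moreover have "{u, \<pi> j u, \<pi> k u, \<pi> l u} \<subseteq> S i"
      using u \<pi>S(1)[OF u l4(1) ne(1)] \<pi>S(1)[OF u l4(2) ne(2)] \<pi>S(1)[OF u l4(3) ne(3)] by auto
    moreover have "finite (S i)" using is_vc_graph_finite[OF G(1)] by (simp add: S_def)
    ultimately have S: "S i = {u, \<pi> j u, \<pi> k u, \<pi> l u}"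
      using card_subset_eq[of "S i" "{u, \<pi> j u, \<pi> k u, \<pi> l u}"] class4[OF i4] by (simp add: S_def)
    note k1 = \<pi>S[OF u l4(2) ne(2)] and kj = \<pi>S[OF \<pi>S(1)[OF u l4(2) ne(2)] l4(1) ne(1)]
    have "\<pi> j (\<pi> k u) \<noteq> u"
    proof
      assume "\<pi> j (\<pi> k u) = u"
      then have "\<pi> k u = \<pi> j u" using \<pi>inv[OF k1(1) l4(1) ne(1)] by simp
      then show False using \<pi>d[OF u l4(1,2) ne(1,2,4)] by simp
    qed
    moreover have "\<pi> j (\<pi> k u) \<noteq> \<pi> j u"
    proof
      assume "\<pi> j (\<pi> k u) = \<pi> j u"
      then have "\<pi> k u = u" using \<pi>inv[OF k1(1) l4(1) ne(1)] \<pi>inv[OF u l4(1) ne(1)] by simp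
      then show False using k1 by simp
    qed
    ultimately show ?thesis using kj(1,2) S by blast
  qed
  have ex1: "\<exists>u\<in>S i. adj G u v" if "v \<in> S j" "i < 4" "j < 4" "i \<noteq> j" for v i j
  proof -
    obtain u where u: "u \<in> S i" using Sne[OF \<open>i < 4\<close>] by blast
    have "card {u, \<pi> j u} < card (S i)" using class4[OF that(2)] by (simp add: S_def card_insert_if)
    then have "\<not> S i \<subseteq> {u, \<pi> j u}" using card_mono[of "{u, \<pi> j u}" "S i"] by auto
    then obtain w where "w \<in> S i" "w \<noteq> u" "w \<noteq> \<pi> j u" by blast
    then show ?thesis using \<pi>a[OF u _ that(1,3,4)] u by blast
  qed
  \<comment> \<open>\<open>u\<close> and its partner toward \<open>j\<close> agree in adjacency to
    \<open>v\<close> and differ in adjacency to \<open>v'\<close>, so one of them is adjacent to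
    both.\<close>
  have ex2: "\<exists>u\<in>S i. adj G u v \<and> adj G u v'" if "v \<in> S j" "v' \<in> S k" "i < 4" "j < 4" "k < 4" "i \<noteq> j" "i \<noteq> k" "j \<noteq> k" for v v' i j k
  proof -
    note hyps = that
    obtain u where u: "u \<in> S i" "adj G u v" using ex1[OF hyps(1,3,4,6)] by blast
    note p = \<pi>S[OF u(1) that(4,6)]
    have "adj G (\<pi> j u) v" using \<pi>a[OF u(1) p(1) that(1,4,6)] u by blast
    moreover have "adj G (\<pi> j u) v' \<noteq> adj G u v'"
      using \<pi>a[OF u(1) p(1) that(2,5,7)] p(2) \<pi>d[OF u(1) that(4,5,6,7,8)] by metis
    ultimately show ?thesis using u p by blast
  qed
  \<comment> \<open>\<open>x0\<close> and \<open>x1\<close> are chosen adjacent to \<open>x2\<close>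
    and \<open>x3\<close>; whether they are adjacent to each other can no longer be prescribed, and
    this is the twist.\<close>
  obtain x3 where x3: "x3 \<in> S 3" using Sne by force
  obtain x2 where x2: "x2 \<in> S 2" "adj G x2 x3" using ex1[OF x3, of 2] by auto
  obtain x1 where x1: "x1 \<in> S 1" "adj G x1 x2" "adj G x1 x3" using ex2[OF x2(1) x3, of 1] by auto
  obtain x0 where x0: "x0 \<in> S 0" "adj G x0 x2" "adj G x0 x3" using ex2[OF x2(1) x3, of 0] by auto
  define x where "x i = (if i = 0 then x0 else if i = 1 then x1 else if i = 2 then x2 else x3)" for i :: nat
  define b where "b \<longleftrightarrow> \<not> adj G x0 x1"
  have xS: "x i \<in> S i" if "i < 4" for i
    using that x0 x1 x2 x3 unfolding less_4 by (auto simp: x_def)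
  have xa: "adj G (x i) (x j) \<longleftrightarrow> \<not> twisted b i j" if "i < 4" "j < 4" "i \<noteq> j" for i j
  proof -
    have "adj G x1 x0 \<longleftrightarrow> \<not> b" "adj G x2 x0" "adj G x3 x0" "adj G x2 x1" "adj G x3 x1" "adj G x3 x2"
      using x0 x1 x2 sym unfolding b_def by blast+
    then show ?thesis using that x0 x1 x2 unfolding less_4
      by (elim disjE) (simp_all add: x_def b_def twisted_def doubleton_eq_iff)
  qed
  define \<psi> where "\<psi> i a = (if a = 0 then x i else \<pi> (i XOR a) (x i))" for i a
  have xor_ne: "i XOR a < 4" "i \<noteq> i XOR a" if "i < 4" "a < 4" "a \<noteq> 0" for i a :: nat
    using xor_less_4[OF that(1,2)] that(3) by (auto, metis xor.assoc xor.left_neutral xor_self_eq)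
  have \<psi>S: "\<psi> i a \<in> S i" if "i < 4" "a < 4" for i a
    using \<pi>S(1)[OF xS[OF that(1)] xor_ne[OF that]] xS[OF that(1)] by (auto simp: \<psi>_def)
  have step: "\<psi> i d = \<pi> (i XOR (a XOR d)) (\<psi> i a)" if i: "i < 4" and ad: "a < 4" "d < 4" "a \<noteq> d" for i a d
  proof -
    have ne: "a XOR d \<noteq> 0" "a XOR d < 4" using ad xor_less_4 by (auto simp: xor_eq_0_iff)
    note e = xor_ne[OF i ne(2,1)]
    consider "a = 0" | "d = 0" "a \<noteq> 0" | "a \<noteq> 0" "d \<noteq> 0" by blast
    then show ?thesis
    proof cases
      case 1 then show ?thesis using ad by (simp add: \<psi>_def)
    next
      case 2 then show ?thesis using \<pi>inv[OF xS[OF i] xor_ne[OF i ad(1)]] by (simp add: \<psi>_def)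
    next
      case 3
      have dis: "a XOR d \<noteq> a" "a XOR d \<noteq> d" using 3 by (metis xor.assoc xor.commute xor.left_neutral xor_self_eq)+
      have "\<pi> (i XOR (a XOR d)) (\<pi> (i XOR a) (x i)) = \<pi> (i XOR d) (x i)"
        by (rule \<pi>comp[OF xS[OF i] e(1) xor_ne(1)[OF i ad(1) 3(1)] xor_ne(1)[OF i ad(2) 3(2)]])
          (use e(2) xor_ne(2)[OF i ad(1) 3(1)] xor_ne(2)[OF i ad(2) 3(2)] dis ad in \<open>simp add: xor_left_cancel\<close>)
      then show ?thesis using 3 by (simp add: \<psi>_def)
    qed
  qed
  have inner: "adj G (\<psi> i a) (\<psi> i d) \<longleftrightarrow> cfi_adj D b i a i d" if i: "i < 4" and ad: "a < 4" "d < 4" for i a d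
  proof (cases "a = d")
    case True
    then show ?thesis using G(1) unfolding is_vc_graph_iff by (auto simp: cfi_adj_def)
  next
    case False
    then have ne: "a XOR d \<noteq> 0" "a XOR d < 4" using ad xor_less_4 by (auto simp: xor_eq_0_iff)
    show ?thesis using \<pi>S(3)[OF \<psi>S[OF i ad(1)] xor_ne[OF i ne(2,1)]] step[OF i ad False] False by (simp add: cfi_adj_def)
  qed
  have half: "(adj G (\<psi> i a) y \<longleftrightarrow> adj G (x i) y) \<longleftrightarrow> ker (i XOR j) a" if ij: "i < 4" "j < 4" "i \<noteq> j" and a: "a < 4" and y: "y \<in> S j" for i j a y
  proof -
    have "(adj G (\<psi> i a) y \<longleftrightarrow> adj G (x i) y) \<longleftrightarrow> \<psi> i a = x i \<or> \<psi> i a = \<pi> j (x i)"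
      by (rule \<pi>a[OF xS[OF ij(1)] \<psi>S[OF ij(1) a] y ij(2,3)])
    also have "\<dots> \<longleftrightarrow> a = 0 \<or> i XOR a = j"
    proof (cases "a = 0")
      case True then show ?thesis by (simp add: \<psi>_def)
    next
      case False
      then show ?thesis using \<pi>S(2)[OF xS[OF ij(1)] xor_ne[OF ij(1) a False]] \<pi>d[OF xS[OF ij(1)] ij(2) xor_ne(1)[OF ij(1) a False] ij(3) xor_ne(2)[OF ij(1) a False]]
        by (auto simp: \<psi>_def)
    qed
    also have "\<dots> \<longleftrightarrow> ker (i XOR j) a" unfolding ker_def by (metis xor.assoc xor.left_neutral xor_self_eq)
    finally show ?thesis .
  qed
  have cross: "adj G (\<psi> i a) (\<psi> j d) \<longleftrightarrow> cfi_adj D b i a j d" if ij: "i < 4" "j < 4" "i \<noteq> j" and ad: "a < 4" "d < 4" for i j a d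
  proof -
    have k: "i XOR j < 4" "i XOR j \<noteq> 0" using xor_less_4 ij by (auto simp: xor_eq_0_iff)
    have 1: "(adj G (\<psi> i a) (\<psi> j d) \<longleftrightarrow> adj G (x i) (\<psi> j d)) \<longleftrightarrow> ker (i XOR j) a" by (rule half[OF ij ad(1) \<psi>S[OF ij(2) ad(2)]])
    have "(adj G (\<psi> j d) (x i) \<longleftrightarrow> adj G (x j) (x i)) \<longleftrightarrow> ker (j XOR i) d" by (rule half[OF ij(2,1) ij(3)[symmetric] ad(2) xS[OF ij(1)]])
    then have 2: "(adj G (x i) (\<psi> j d) \<longleftrightarrow> adj G (x i) (x j)) \<longleftrightarrow> ker (i XOR j) d" using sym[of "x i"] by (simp add: xor.commute)
    show ?thesis using 1 2 xa[OF ij] ker_xor[OF k ad] ij(3) unfolding cfi_adj_def by (simp; blast)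
  qed
  have "vc_iso (cfi_graph D b) G"
  proof (rule vc_isoI[of _ _ "\<lambda>v. \<psi> (v div 4) (v mod 4)"])
    show "finite (V (cfi_graph D b))" "finite (V G)" using is_vc_graph_finite[OF G(1)] by auto
    have "V G = (\<Union>i<4. S i)" using G(2) by (auto simp: S_def)
    then have "card (V G) = (\<Sum>i<4. card (S i))"
      using is_vc_graph_finite[OF G(1)] by (simp only:) (rule card_UN_disjoint, auto simp: S_def)
    also have "\<dots> = 16" using class4 by (simp add: S_def)
    finally show "card (V (cfi_graph D b)) = card (V G)" by simp
    show "\<psi> (u div 4) (u mod 4) \<in> V G" "vcol G (\<psi> (u div 4) (u mod 4)) = vcol (cfi_graph D b) u" if "u \<in> V (cfi_graph D b)" for u
      using \<psi>S[of "u div 4" "u mod 4"] that by (auto simp: S_def)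
    show "adj (cfi_graph D b) u v \<longleftrightarrow> adj G (\<psi> (u div 4) (u mod 4)) (\<psi> (v div 4) (v mod 4))"
      if "u \<in> V (cfi_graph D b)" "v \<in> V (cfi_graph D b)" for u v
      using that inner[of "u div 4" "u mod 4" "v mod 4"] cross[of "u div 4" "v div 4" "u mod 4" "v mod 4"]
      by (cases "u div 4 = v div 4") (auto simp: adj_cfi_graph)
    show "inj_on (\<lambda>v. \<psi> (v div 4) (v mod 4)) (V (cfi_graph D b))"
    proof (rule inj_onI, rule ccontr)
      fix u v assume uv: "u \<in> V (cfi_graph D b)" "v \<in> V (cfi_graph D b)" "\<psi> (u div 4) (u mod 4) = \<psi> (v div 4) (v mod 4)" "u \<noteq> v"
      then have d: "u div 4 < 4" "v div 4 < 4" "u mod 4 < 4" "v mod 4 < 4" by auto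
      then have e: "u div 4 = v div 4" using \<psi>S[OF d(1,3)] \<psi>S[OF d(2,4)] uv(3) by (simp add: S_def)
      then have m: "u mod 4 \<noteq> v mod 4" using uv(4) by (metis div_mult_mod_eq)
      then have ne: "u mod 4 XOR v mod 4 \<noteq> 0" "u mod 4 XOR v mod 4 < 4" using d xor_less_4 by (auto simp: xor_eq_0_iff)
      show False using \<pi>S(2)[OF \<psi>S[OF d(1,3)] xor_ne[OF d(1) ne(2,1)]] step[OF d(1,3,4) m] uv(3) e by simp
    qed
  qed
  then show ?thesis by blast
qed

text \<open>The stable pair colors of the twisted and of the untwisted graph.\<close>

definition pair_type :: "bool \<Rightarrow> nat \<Rightarrow> nat \<Rightarrow> nat \<times> nat \<times> nat" where
  "pair_type b u v = (u div 4, v div 4, if u div 4 = v div 4 then u mod 4 XOR v mod 4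
     else of_bool (ker (u div 4 XOR v div 4) (u mod 4 XOR v mod 4) \<noteq> twisted b (u div 4) (v div 4)))"

lemma twisted_commute: "twisted b i j \<longleftrightarrow> twisted b j i"
  by (simp add: twisted_def insert_commute)

lemma pair_type_swap: "pair_type b w v = (case pair_type b v w of (i, j, x) \<Rightarrow> (j, i, x))"
  unfolding pair_type_def
  by (simp add: xor.commute[of "w div 4"] xor.commute[of "w mod 4"] twisted_commute[of b "w div 4"])

definition shift :: "(nat \<Rightarrow> nat) \<Rightarrow> nat \<Rightarrow> nat" where
  "shift t w = 4 * (w div 4) + (w mod 4 XOR t (w div 4))"

lemma shift_div_mod:
  assumes "t (w div 4) < 4"
  shows "shift t w div 4 = w div 4" "shift t w mod 4 = w mod 4 XOR t (w div 4)"
  using xor_less_4[of "w mod 4" "t (w div 4)"] assms by (simp_all add: shift_def)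

lemma bij_shift:
  assumes "\<And>l. l < 4 \<Longrightarrow> t l < 4"
  shows "bij_betw (shift t) {..<16} {..<16}"
proof (rule bij_betwI[of _ _ _ "shift t"])
  have "w div 4 < 4" "t (w div 4) < 4" if "w < 16" for w :: nat using that assms[of "w div 4"] by auto
  note * = this
  show closed: "shift t \<in> {..<16} \<rightarrow> {..<16}"
  proof (rule funcsetI)
    fix w :: nat assume "w \<in> {..<16}"
    then have "w div 4 < 4" "w mod 4 XOR t (w div 4) < 4" using * xor_less_4 by simp_all
    then show "shift t w \<in> {..<16}" unfolding shift_def by simp
  qed
  show "shift t (shift t w) = w" if "w \<in> {..<16}" for w
  proof -
    have "shift t (shift t w) = 4 * (w div 4) + ((w mod 4 XOR t (w div 4)) XOR t (w div 4))"
      unfolding shift_def[of t "shift t w"] using shift_div_mod[of t w] *(2)[of w] that by simp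
    also have "\<dots> = w" by (simp add: xor.assoc)
    finally show ?thesis .
  qed
  then show "shift t (shift t w) = w" if "w \<in> {..<16}" for w using that .
  show "shift t \<in> {..<16} \<rightarrow> {..<16}" by (rule closed)
qed

text \<open>
  Translations inside the color classes move the twist away from any two given vertices \<open>u\<close> and \<open>v\<close>:
  in a third class the two conditions on the translation are independent.
\<close>

lemma pair_type_extend:
  assumes u: "u < 16" "u' < 16" "v < 16" "v' < 16" and e: "pair_type b u v = pair_type b' u' v'"
  shows "\<exists>f. bij_betw f {..<16} {..<16} \<and> (\<forall>w<16. pair_type b u w = pair_type b' u' (f w) \<and> pair_type b w v = pair_type b' (f w) v')"
proof -
  define i j a a' d d' where ij: "i = u div 4" "j = v div 4" "a = u mod 4" "a' = u' mod 4" "d = v mod 4" "d' = v' mod 4"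
  have ij': "u' div 4 = i" "v' div 4 = j" using e by (auto simp: pair_type_def ij)
  have lt: "i < 4" "j < 4" "a < 4" "a' < 4" "d < 4" "d' < 4" using u by (auto simp: ij)
  have x: "a XOR a' < 4" "d XOR d' < 4" using lt xor_less_4 by auto
  \<comment> \<open>Let a vertex of class \<open>i\<close> be moved by \<open>r\<close> and class
    \<open>l\<close> by \<open>t\<close>. Pair types with twists \<open>b\<close> and
    \<open>b'\<close> then correspond if the character of \<open>i XOR l\<close> at
    \<open>s = t XOR r\<close> makes up for the difference of the twists; this is
    \<open>P i l s\<close>.\<close>
  define P where "P i l s \<longleftrightarrow> ker (i XOR l) s = (twisted b i l = twisted b' i l)" for i l s
  have sw: "a XOR d = a' XOR d' \<Longrightarrow> a XOR a' = d XOR d'"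
    by (metis xor.assoc xor.commute xor_self_eq xor.right_neutral)
  have same: "i = j \<Longrightarrow> a XOR a' = d XOR d'"
    using e ij' by (intro sw) (simp add: pair_type_def ij)
  have cross: "P i j ((a XOR a') XOR (d XOR d'))" if "i \<noteq> j"
  proof -
    have k: "i XOR j < 4" "i XOR j \<noteq> 0" using xor_less_4 lt that by (auto simp: xor_eq_0_iff)
    have "ker (i XOR j) (a XOR d) \<noteq> twisted b i j \<longleftrightarrow> ker (i XOR j) (a' XOR d') \<noteq> twisted b' i j"
      using e ij' that by (simp add: pair_type_def ij of_bool_eq_iff)
    then show ?thesis unfolding P_def using k lt x by (simp add: ker_xor) blast
  qed
  have "\<exists>t<4. (if l = i then t = a XOR a' else P i l (t XOR (a XOR a'))) \<and> (if l = j then t = d XOR d' else P j l (t XOR (d XOR d')))"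
    if l: "l < 4" for l
  proof -
    have k: "i \<noteq> l \<Longrightarrow> i XOR l < 4 \<and> i XOR l \<noteq> 0" "j \<noteq> l \<Longrightarrow> j XOR l < 4 \<and> j XOR l \<noteq> 0"
      using xor_less_4 lt l by (auto simp: xor_eq_0_iff)
    have PX: "P i l (t XOR s) \<longleftrightarrow> (ker (i XOR l) t = (ker (i XOR l) s = (twisted b i l = twisted b' i l)))" if "i \<noteq> l" "t < 4" "s < 4" for t s
      using k(1)[OF that(1)] that by (simp add: P_def ker_xor) blast
    have PX': "P j l (t XOR s) \<longleftrightarrow> (ker (j XOR l) t = (ker (j XOR l) s = (twisted b j l = twisted b' j l)))" if "j \<noteq> l" "t < 4" "s < 4" for t s
      using k(2)[OF that(1)] that by (simp add: P_def ker_xor) blast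
    \<comment> \<open>In the classes of \<open>u\<close> and \<open>v\<close> the translation is
      forced, and its consistency is the equality of pair types. In other classes the two conditions
      coincide if \<open>i = j\<close> and otherwise involve different characters.\<close>
    consider "l = i" "l = j" | "l = i" "l \<noteq> j" | "l \<noteq> i" "l = j" | "l \<noteq> i" "l \<noteq> j" "i = j" | "l \<noteq> i" "l \<noteq> j" "i \<noteq> j" by blast
    then show ?thesis
    proof cases
      case 1 then show ?thesis using same x by (intro exI[of _ "a XOR a'"]) simp
    next
      case 2
      then have "P j l ((a XOR a') XOR (d XOR d'))" using cross unfolding P_def twisted_def by (simp add: xor.commute insert_commute)
      then show ?thesis using 2 x by (intro exI[of _ "a XOR a'"]) simp
    next
      case 3
      then have "P i l ((d XOR d') XOR (a XOR a'))" using cross by (simp add: xor.commute)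
      then show ?thesis using 3 x by (intro exI[of _ "d XOR d'"]) simp
    next
      case 4
      obtain t where "t < 4" "ker (i XOR l) t = (ker (i XOR l) (a XOR a') = (twisted b i l = twisted b' i l))"
      proof -
        have "i XOR l \<noteq> 0 \<and> i XOR l < 4" using k 4 by blast
        then have "ker (i XOR l) 0" "\<exists>t<4. \<not> ker (i XOR l) t"
          using ker_independent[of "i XOR l" 1 False False] ker_independent[of "i XOR l" 2 False False]
          by (simp add: ker_def, (cases "i XOR l = 1"; simp; blast))
        then show ?thesis using that[of 0] that by (cases "ker (i XOR l) (a XOR a') = (twisted b i l = twisted b' i l)") auto
      qed
      then show ?thesis using 4 PX[of t "a XOR a'"] same x by (intro exI[of _ t]) auto
    next
      case 5
      have "i XOR l \<noteq> j XOR l" using 5 xor_left_cancel[of l i j] by (simp add: xor.commute)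
      then obtain t where "t < 4" "ker (i XOR l) t = (ker (i XOR l) (a XOR a') = (twisted b i l = twisted b' i l))"
          "ker (j XOR l) t = (ker (j XOR l) (d XOR d') = (twisted b j l = twisted b' j l))"
        using ker_independent[of "i XOR l" "j XOR l"] k 5 by metis
      then show ?thesis using 5 PX[of t "a XOR a'"] PX'[of t "d XOR d'"] x by (intro exI[of _ t]) auto
    qed
  qed
  then obtain t where t: "\<And>l. l < 4 \<Longrightarrow> t l < 4"
    "\<And>l. l < 4 \<Longrightarrow> if l = i then t l = a XOR a' else P i l (t l XOR (a XOR a'))"
    "\<And>l. l < 4 \<Longrightarrow> if l = j then t l = d XOR d' else P j l (t l XOR (d XOR d'))" by metis
  have key: "pair_type b (4 * m + s) w = pair_type b' (4 * m + s') (shift t w)"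
    if w: "w < 16" and m: "m < 4" "s < 4" "s' < 4" and tm: "if w div 4 = m then t (w div 4) = s XOR s' else P m (w div 4) (t (w div 4) XOR (s XOR s'))" for m s s' w
  proof -
    define l y where "l = w div 4" and "y = w mod 4"
    have l: "l < 4" "y < 4" "t l < 4" using w t(1)[of l] by (auto simp: l_def y_def)
    have sh: "shift t w div 4 = l" "shift t w mod 4 = y XOR t l" using shift_div_mod[of t w] l by (simp_all add: l_def y_def)
    have mm: "(4 * m + s) div 4 = m" "(4 * m + s) mod 4 = s" "(4 * m + s') div 4 = m" "(4 * m + s') mod 4 = s'" using m by auto
    show ?thesis
    proof (cases "l = m")
      case True
      then have "t l = s XOR s'" using tm by (simp add: l_def)
      then have "s' XOR (y XOR t l) = s XOR y" by (metis xor.assoc xor.commute xor_self_eq xor.right_neutral)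
      then show ?thesis using True unfolding pair_type_def sh mm l_def[symmetric] y_def[symmetric] by simp
    next
      case False
      then have "P m l (t l XOR (s XOR s'))" using tm by (simp add: l_def)
      moreover have k: "m XOR l < 4" "m XOR l \<noteq> 0" using xor_less_4 m l False by (auto simp: xor_eq_0_iff)
      ultimately have "(ker (m XOR l) (s XOR y) \<noteq> twisted b m l) = (ker (m XOR l) (s' XOR (y XOR t l)) \<noteq> twisted b' m l)"
        unfolding P_def using m l xor_less_4 by (simp add: ker_xor) blast
      then show ?thesis using False unfolding pair_type_def sh mm l_def[symmetric] y_def[symmetric] by simp
    qed
  qed
  have flip: "pair_type b w v = pair_type b' w' v'" if "pair_type b v w = pair_type b' v' w'" for w w' v v'
    unfolding pair_type_swap[of _ w] pair_type_swap[of _ w'] that ..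
  have uu: "u = 4 * i + a" "u' = 4 * i + a'" "v = 4 * j + d" "v' = 4 * j + d'"
    using ij' by (simp_all add: ij) (metis mult_div_mod_eq)+
  show ?thesis
  proof (intro exI[of _ "shift t"] conjI allI impI)
    show "bij_betw (shift t) {..<16} {..<16}" by (rule bij_shift[OF t(1)])
    fix w :: nat assume w: "w < 16"
    then have l: "w div 4 < 4" by auto
    show "pair_type b u w = pair_type b' u' (shift t w)"
      unfolding uu using key[OF w lt(1,3,4)] t(2)[OF l] by simp
    show "pair_type b w v = pair_type b' (shift t w) v'"
      by (rule flip) (unfold uu, use key[OF w lt(2,5,6)] t(3)[OF l] in simp)
  qed
qed

text \<open>In round 0 the pair type decides equality, vertex color and adjacency, the last with the
  same \<open>D\<close> on both sides. The extension property of pair types carries this through all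
  rounds.\<close>

lemma pair_type_wl2_color:
  assumes "u < 16" "u' < 16" "v < 16" "v' < 16" "pair_type b u v = pair_type b' u' v'"
  shows "wl2_color (cfi_graph D b) n u v = wl2_color (cfi_graph D b') n u' v'"
  using assms
proof (induction n arbitrary: u v u' v')
  case 0
  define i j where ij: "i = u div 4" "j = v div 4"
  have d: "u' div 4 = i" "v' div 4 = j" using 0(5) by (auto simp: pair_type_def ij)
  show ?case
  proof (cases "i = j")
    case True
    then have x: "u mod 4 XOR v mod 4 = u' mod 4 XOR v' mod 4" using 0(5) d by (simp add: pair_type_def ij)
    have "u = v \<longleftrightarrow> u mod 4 = v mod 4" "u' = v' \<longleftrightarrow> u' mod 4 = v' mod 4"
      using True d ij by (metis mult_div_mod_eq)+
    moreover have "u mod 4 = v mod 4 \<longleftrightarrow> u' mod 4 = v' mod 4" using x xor_eq_0_iff by metis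
    ultimately show ?thesis using True x d 0(1-4)
      by (simp add: initial_color_def adj_cfi_graph cfi_adj_def ij[symmetric])
  next
    case False
    then have "u \<noteq> v" "u' \<noteq> v'" using d ij by auto
    then show ?thesis using False d 0
      by (simp add: initial_color_def adj_cfi_graph cfi_adj_def ij[symmetric] pair_type_def of_bool_eq_iff)
  qed
next
  case (Suc n)
  obtain f where f: "bij_betw f {..<16} {..<16}"
    "\<forall>w<16. pair_type b u w = pair_type b' u' (f w) \<and> pair_type b w v = pair_type b' (f w) v'"
    using pair_type_extend[OF Suc.prems] by blast
  have "f w < 16" if "w < 16" for w using f(1) that by (auto dest: bij_betwE)
  then have IH: "wl2_color (cfi_graph D b') n u' (f w) = wl2_color (cfi_graph D b) n u w \<and>
      wl2_color (cfi_graph D b') n (f w) v' = wl2_color (cfi_graph D b) n w v" if "w < 16" for w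
    using Suc.IH[of u u' w "f w"] Suc.IH[of w "f w" v v'] f(2) Suc.prems(1-4) that by simp
  have "image_mset (\<lambda>w. (wl2_color (cfi_graph D b) n u w, wl2_color (cfi_graph D b) n w v)) (mset_set {..<16}) =
    image_mset (\<lambda>w. (wl2_color (cfi_graph D b') n u' w, wl2_color (cfi_graph D b') n w v')) (mset_set {..<16})"
    using IH by (intro image_mset_bijI[OF f(1)]) simp
  then show ?case using Suc.IH[OF Suc.prems] by simp
qed

text \<open>Pairs between the classes 0 and 1 are matched by moving the second vertex by 2, which
  lies outside the kernel \<open>{0, 1}\<close> of the character 1 and so undoes the twist. This
  matching of pairs is not induced by a map of vertices.\<close>

lemma wl2_equivalent_twist: "wl2_equivalent (cfi_graph D False) (cfi_graph D True)"
proof -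
  define t where "t i j = (if {i, j} = {0, 1} then 2 else 0 :: nat)" for i j :: nat
  have t4: "t i j < 4" for i j by (simp add: t_def)
  define E where "E = (\<lambda>(u, v). (u, shift (t (u div 4)) v))"
  have bij: "bij_betw (shift (t i)) {..<16} {..<16}" for i by (rule bij_shift[OF t4])
  have sh: "shift (t i) (shift (t i) v) = v" if "v < 16" for i v
  proof -
    have "shift (t i) (shift (t i) v) = 4 * (v div 4) + ((v mod 4 XOR t i (v div 4)) XOR t i (v div 4))"
      unfolding shift_def[of "t i" "shift (t i) v"] using shift_div_mod[of "t i" v] t4 by simp
    then show ?thesis by (simp add: xor.assoc)
  qed
  have lt: "shift (t i) v < 16" if "v < 16" for i v using bij_betwE[OF bij] that by auto
  have "bij_betw E ({..<16} \<times> {..<16}) ({..<16} \<times> {..<16})"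
    by (rule bij_betwI[of _ _ _ E]) (auto simp: E_def sh lt)
  moreover have "wl2_color (cfi_graph D True) n (fst (E (u, v))) (snd (E (u, v))) = wl2_color (cfi_graph D False) n u v"
    if "u < 16" "v < 16" for u v n
  proof -
    have lt4: "u div 4 < 4" "v div 4 < 4" "u mod 4 < 4" "v mod 4 < 4" using that by auto
    have sd: "shift (t (u div 4)) v div 4 = v div 4" "shift (t (u div 4)) v mod 4 = v mod 4 XOR t (u div 4) (v div 4)"
      by (rule shift_div_mod[OF t4])+
    have "pair_type False u v = pair_type True u (shift (t (u div 4)) v)"
    proof (cases "{u div 4, v div 4} = {0, 1}")
      case True
      then have x: "u div 4 XOR v div 4 = 1" "u div 4 \<noteq> v div 4" by (auto simp: doubleton_eq_iff)
      have "ker 1 (u mod 4 XOR (v mod 4 XOR 2)) \<noteq> ker 1 (u mod 4 XOR v mod 4)"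
        using lt4 xor_less_4[of "v mod 4" 2] by (simp add: ker_xor) (simp add: ker_def)
      then show ?thesis unfolding pair_type_def sd
        using x True by (simp add: t_def twisted_def)
    next
      case False
      then show ?thesis unfolding pair_type_def sd
        by (simp add: t_def twisted_def)
    qed
    then show ?thesis
      using pair_type_wl2_color[of u u v "shift (t (u div 4)) v" False True D n] that lt by (simp add: E_def)
  qed
  ultimately show ?thesis
    by (subst wl2_equivalent_iff) (auto intro!: exI[of _ E])
qed

section \<open>A clique that tells the two twists apart\<close>

definition rainbow :: "('a, 'c) vc_graph \<Rightarrow> bool" where
  "rainbow G \<longleftrightarrow> (\<exists>x. \<forall>i\<in>vcol G ` V G. x i \<in> V G \<and> vcol G (x i) = i \<and> (\<forall>j\<in>vcol G ` V G - {i}. adj G (x i) (x j)))"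

lemma rainbow_iso:
  assumes "vc_iso G H" "rainbow G"
  shows "rainbow H"
proof -
  obtain f where f: "bij_betw f (V G) (V H)" "\<forall>u \<in> V G. \<forall>v \<in> V G. adj G u v \<longleftrightarrow> adj H (f u) (f v)"
     "\<forall>v \<in> V G. vcol H (f v) = vcol G v" using assms(1) unfolding vc_iso_def by blast
  have im: "vcol H ` V H = vcol G ` V G"
    using f(3) unfolding bij_betw_imp_surj_on[OF f(1), symmetric] by (auto simp: image_iff)
  obtain x where x: "\<forall>i\<in>vcol G ` V G. x i \<in> V G \<and> vcol G (x i) = i \<and> (\<forall>j\<in>vcol G ` V G - {i}. adj G (x i) (x j))"
    using assms(2) unfolding rainbow_def by blast
  have fV: "f u \<in> V H" if "u \<in> V G" for u using f(1) that by (auto dest: bij_betwE)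
  show ?thesis unfolding rainbow_def im
  proof (rule exI[of _ "f \<circ> x"], intro ballI conjI)
    fix i assume i: "i \<in> vcol G ` V G"
    note xi = bspec[OF x i]
    show "(f \<circ> x) i \<in> V H" "vcol H ((f \<circ> x) i) = i" using xi f(3) fV by auto
    fix j assume j: "j \<in> vcol G ` V G - {i}"
    then have "x j \<in> V G" "adj G (x i) (x j)" using x xi by blast+
    then show "adj H ((f \<circ> x) i) ((f \<circ> x) j)" using xi f(2) by simp
  qed
qed

lemma V_recolor [simp]: "V (recolor p G) = V G" and adj_recolor [simp]: "adj (recolor p G) u v \<longleftrightarrow> adj G u v"
  and vcol_recolor [simp]: "vcol (recolor p G) v = p (vcol G v)"
  by (simp_all add: recolor_def)

lemma is_vc_graph_recolor [simp]: "is_vc_graph (recolor p G) \<longleftrightarrow> is_vc_graph G"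
  by (simp add: is_vc_graph_def recolor_def)

lemma recolor_recolor: "recolor p (recolor q G) = recolor (p \<circ> q) G"
  by (simp add: recolor_def comp_assoc)

lemma recolor_id [simp]: "recolor id G = G"
  by (simp add: recolor_def)

lemma rainbow_recolor:
  assumes "inj p" "rainbow G"
  shows "rainbow (recolor p G)"
proof -
  obtain x where x: "\<forall>i\<in>vcol G ` V G. x i \<in> V G \<and> vcol G (x i) = i \<and> (\<forall>j\<in>vcol G ` V G - {i}. adj G (x i) (x j))"
    using assms(2) unfolding rainbow_def by blast
  have im: "vcol (recolor p G) ` V (recolor p G) = p ` vcol G ` V G" by auto
  show ?thesis unfolding rainbow_def im
  proof (rule exI[of _ "x \<circ> inv p"], intro ballI conjI)
    fix i' assume "i' \<in> p ` vcol G ` V G"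
    then obtain i where i: "i' = p i" "i \<in> vcol G ` V G" by blast
    note xi = bspec[OF x i(2)]
    show "(x \<circ> inv p) i' \<in> V (recolor p G)" "vcol (recolor p G) ((x \<circ> inv p) i') = i'"
      using xi assms(1) by (simp_all add: i(1))
    fix j' assume "j' \<in> p ` vcol G ` V G - {i'}"
    then obtain j where j: "j' = p j" "j \<in> vcol G ` V G - {i}" unfolding i(1) by fast
    show "adj (recolor p G) ((x \<circ> inv p) i') ((x \<circ> inv p) j')"
      using xi j(2) assms(1) by (simp add: i(1) j(1))
  qed
qed

lemma vc_iso_recolor: "vc_iso G H \<Longrightarrow> vc_iso (recolor p G) (recolor p H)"
  unfolding vc_iso_def by auto

text \<open>Pair colors are terms over the vertex colors, so a renaming acts on them by the map
  function of the datatype.\<close>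

lemma wl2_color_recolor: "wl2_color (recolor p G) i u v = map_pair_color p (wl2_color G i u v)"
  by (induction i arbitrary: u v) (simp_all add: initial_color_def image_mset.compositionality comp_def map_prod_def)

lemma wl2_palette_recolor: "wl2_palette (recolor p G) i = image_mset (map_pair_color p) (wl2_palette G i)"
  unfolding wl2_palette_def
  by (simp add: image_mset.compositionality) (rule image_mset_cong, auto simp: wl2_color_recolor)

lemma wl2_equivalent_recolor:
  assumes "finite (V G)" "finite (V H)" "wl2_equivalent G H"
  shows "wl2_equivalent (recolor p G) (recolor p H)"
  using assms(3) unfolding wl2_equivalent_iff_palette[OF assms(1,2)]
  by (subst wl2_equivalent_iff_palette) (simp_all add: assms(1,2) wl2_palette_recolor)

text \<open>Without twist the vertices \<open>4 * i\<close> form such a clique; with twist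
  \<open>no_twisted_clique\<close> excludes it.\<close>

lemma rainbow_cfi_graph: "rainbow (cfi_graph D b) \<longleftrightarrow> \<not> b"
proof
  have im: "vcol (cfi_graph D b) ` V (cfi_graph D b) = {..<4}"
    by (auto simp: image_iff intro!: bexI[of _ "4 * _"])
  {
    assume "\<not> b"
    then have "adj (cfi_graph D b) (4 * i) (4 * j)" if "i < 4" "j < 4" "i \<noteq> j" for i j
      using that by (simp add: adj_cfi_graph cfi_adj_def twisted_def ker_def)
    then show "rainbow (cfi_graph D b)" unfolding rainbow_def im by (intro exI[of _ "\<lambda>i. 4 * i"]) auto
  next
    assume "rainbow (cfi_graph D b)"
    then obtain x where x: "\<forall>i<4. x i < 16 \<and> x i div 4 = i \<and> (\<forall>j<4. j \<noteq> i \<longrightarrow> adj (cfi_graph D b) (x i) (x j))"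
      unfolding rainbow_def im by auto
    have *: "ker (i XOR j) (x i mod 4 XOR x j mod 4) \<noteq> twisted b i j" if "i < 4" "j < 4" "i \<noteq> j" for i j
    proof -
      have d: "x i div 4 = i" "x j div 4 = j" "adj (cfi_graph D b) (x i) (x j)" using x that by auto
      then show ?thesis using that(3) unfolding adj_cfi_graph cfi_adj_def d(1,2) by simp
    qed
    show "\<not> b"
    proof
      assume b
      then show False using no_twisted_clique[of "x 0 mod 4" "x 1 mod 4" "x 2 mod 4" "x 3 mod 4"]
        *[of 0 1] *[of 0 2] *[of 0 3] *[of 1 2] *[of 1 3] *[of 2 3] by (simp add: twisted_def doubleton_eq_iff)
    qed
  }
qed

lemma cfi_recolor:
  assumes p: "inj p" and G: "cfi G C D"
  shows "cfi (recolor p G) (p ` C) (map_prod p p ` D)"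
proof -
  obtain \<pi> where \<pi>: "partner_map G C D \<pi>" using G unfolding cfi_def by blast
  have G': "is_vc_graph G" "vcol G ` V G = C" "card C = 4" "D \<subseteq> C \<times> C - Id" "\<And>i. i \<in> C \<Longrightarrow> card {v \<in> V G. vcol G v = i} = 4"
    using G unfolding cfi_def by blast+
  have "partner_map (recolor p G) (p ` C) (map_prod p p ` D) (\<lambda>j. \<pi> (inv p j))"
    unfolding partner_map_def
  proof (intro ballI)
    fix u j' assume u: "u \<in> V (recolor p G)" and j': "j' \<in> p ` C - {vcol (recolor p G) u}"
    then obtain j where j: "j' = p j" "j \<in> C - {vcol G u}" by auto
    have D: "(p x, p y) \<in> map_prod p p ` D \<longleftrightarrow> (x, y) \<in> D" for x y using p by (auto simp: inj_eq)
    have u': "u \<in> V G" using u by simp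
    note * = \<pi>[unfolded partner_map_def, rule_format, OF u' j(2)]
    show "\<pi> (inv p j') u \<in> V (recolor p G) \<and> vcol (recolor p G) (\<pi> (inv p j') u) = vcol (recolor p G) u \<and> \<pi> (inv p j') u \<noteq> u \<and>
       (adj (recolor p G) u (\<pi> (inv p j') u) \<longleftrightarrow> (vcol (recolor p G) u, j') \<in> map_prod p p ` D) \<and>
       (\<forall>k\<in>p ` C - {vcol (recolor p G) u, j'}. \<pi> (inv p k) u \<noteq> \<pi> (inv p j') u) \<and>
       (\<forall>v\<in>V (recolor p G). vcol (recolor p G) v = j' \<longrightarrow> (\<forall>w\<in>V (recolor p G). vcol (recolor p G) w = vcol (recolor p G) u \<longrightarrow>
         (adj (recolor p G) w v = adj (recolor p G) u v \<longleftrightarrow> w = u \<or> w = \<pi> (inv p j') u)))"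
      using * p unfolding j V_recolor adj_recolor vcol_recolor inv_f_f[OF p] inj_eq[OF p] D by (auto simp: inj_eq)
  qed
  moreover have "card {v \<in> V (recolor p G). vcol (recolor p G) v = i} = 4" if "i \<in> p ` C" for i
    using that G'(5) by (auto simp: inj_eq[OF p])
  moreover have "map_prod p p ` D \<subseteq> p ` C \<times> p ` C - Id" using G'(4) p by (auto simp: inj_eq)
  moreover have "vcol (recolor p G) ` V (recolor p G) = p ` C" using G'(2) by (auto simp: image_iff)
  ultimately show ?thesis using G' p unfolding cfi_def by (auto simp: card_image inj_on_subset)
qed

section \<open>The digraph as an invariant of the equivalence class\<close>

lemma cfi_finite: "cfi G C D \<Longrightarrow> finite (V G)"
  by (simp add: cfi_def is_vc_graph_finite)

lemma cfi_class_le: 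
  assumes "cfi G C D" shows "card {v \<in> V G. vcol G v = k} \<le> 4"
proof (cases "k \<in> C")
  case False
  then have "{v \<in> V G. vcol G v = k} = {}" using assms unfolding cfi_def by blast
  then show ?thesis by (metis card.empty le0)
qed (use assms in \<open>simp add: cfi_def\<close>)

lemma cfi_card:
  assumes "cfi G C D" shows "card (V G) = 16"
proof -
  have C: "finite C" "card C = 4" using assms by (auto simp: cfi_def intro: card_ge_0_finite)
  have "V G = (\<Union>i\<in>C. {v \<in> V G. vcol G v = i})" using assms by (auto simp: cfi_def)
  then have "card (V G) = card (\<Union>i\<in>C. {v \<in> V G. vcol G v = i})" by simp
  also have "\<dots> = (\<Sum>i\<in>C. card {v \<in> V G. vcol G v = i})"
    using cfi_finite[OF assms] C(1) by (intro card_UN_disjoint) auto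
  also have "\<dots> = 16" using assms C by (simp add: cfi_def)
  finally show ?thesis .
qed

text \<open>Being partners in direction \<open>j\<close> is visible in triangles with an apex in
  class \<open>j\<close>, so limit colors know which partners are adjacent. Exchanging the graphs
  turns the inclusions into equalities.\<close>

lemma cfi_wl2_equivalent_subset:
  assumes G: "cfi G C D" and H: "cfi H C' D'" and eq: "wl2_equivalent G H"
  shows "C \<subseteq> C'" "D \<subseteq> D'"
proof -
  have vc: "is_vc_graph G" "is_vc_graph H" and C: "vcol G ` V G = C" "vcol H ` V H = C'" and DC: "D \<subseteq> C \<times> C - Id"
    using G H by (auto simp: cfi_def)
  have "card {v \<in> V H. vcol H v = i} > 0" if "i \<in> C" for i
    using wl2_equivalent_class_le[OF cfi_finite[OF G] cfi_finite[OF H] eq, of i] G that by (simp add: cfi_def)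
  then show CC: "C \<subseteq> C'" using C(2) by (fastforce simp: card_gt_0_iff)
  obtain \<pi> where \<pi>: "partner_map G C D \<pi>" using G unfolding cfi_def by blast
  obtain \<rho> where \<rho>: "partner_map H C' D' \<rho>" using H unfolding cfi_def by blast
  define c where "c x y i = joint_pair_color G H i x y" for x y i
  interpret coherent_pair "joint_vertices G H" c
    using coherent_pair_joint[OF vc eq cfi_class_le[OF G]] unfolding c_def .
  have cG: "c (Inl u) (Inl v) = (\<lambda>i. wl2_color G i u v)" for u v by (simp add: c_def fun_eq_iff)
  have cH: "c (Inr u) (Inr v) = (\<lambda>i. wl2_color H i u v)" for u v by (simp add: c_def fun_eq_iff)
  have W: "Inl u \<in> joint_vertices G H False \<longleftrightarrow> u \<in> V G" "Inr v \<in> joint_vertices G H True \<longleftrightarrow> v \<in> V H" for u v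
    by (auto simp: joint_vertices_def)
  have vcol_cH: "vcol G u = vcol H v" if "c (Inl u) (Inl u) = c (Inr v) (Inr v)" for u v
    using vertex_color_wl2(2)[of G u u H v v] fun_cong[OF that[unfolded cG cH]] by blast
  have adj_cH: "(u = v \<longleftrightarrow> u' = v') \<and> (adj G u v \<longleftrightarrow> adj H u' v')" if "c (Inl u) (Inl v) = c (Inr u') (Inr v')" for u v u' v'
    using vertex_color_wl2(1,3)[of G u v H u' v'] fun_cong[OF that[unfolded cG cH]] vc
    unfolding is_vc_graph_iff by (cases "u = v") blast+
  show "D \<subseteq> D'"
  proof (rule subrelI)
    fix i j assume ij: "(i, j) \<in> D"
    then have ijC: "i \<in> C" "j \<in> C" "i \<noteq> j" using DC by auto
    obtain u where u: "u \<in> V G" "vcol G u = i" using C ijC by blast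
    have jj: "j \<in> C - {vcol G u}" using ijC u by simp
    note p = \<pi>[unfolded partner_map_def, rule_format, OF u(1) jj]
    define v where "v = \<pi> j u"
    have v: "v \<in> V G" "vcol G v = i" "v \<noteq> u" "adj G u v" using p u ij by (simp_all add: v_def)
    obtain F where F: "bij_betw F (V G \<times> V G) (V H \<times> V H)"
      "\<forall>u\<in>V G. \<forall>v\<in>V G. \<forall>i. wl2_color H i (fst (F (u, v))) (snd (F (u, v))) = wl2_color G i u v"
      using eq unfolding wl2_equivalent_iff[OF cfi_finite[OF G] cfi_finite[OF H]] by blast
    obtain u' v' where uv': "F (u, v) = (u', v')" by (cases "F (u, v)")
    have "(u', v') \<in> V H \<times> V H" using bij_betwE[OF F(1)] u v uv'[symmetric] by auto
    then have V': "u' \<in> V H" "v' \<in> V H" by auto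
    have e: "c (Inl u) (Inl v) = c (Inr u') (Inr v')"
      unfolding cG cH using F(2)[rule_format, OF u(1) v(1)] uv' by simp
    note en = end_colors[OF W(1)[THEN iffD2, OF u(1)] W(1)[THEN iffD2, OF v(1)] W(2)[THEN iffD2, OF V'(1)] W(2)[THEN iffD2, OF V'(2)] e]
    have c': "vcol H u' = i" "vcol H v' = i" using vcol_cH[OF en(1)] vcol_cH[OF en(2)] u v by auto
    have a': "u' \<noteq> v'" "adj H u' v'" using adj_cH[OF e] v by auto
    have j': "j \<in> C' - {vcol H u'}" using CC ijC c' by auto
    note q = \<rho>[unfolded partner_map_def, rule_format, OF V'(1) j']
    obtain y' where y': "y' \<in> V H" "vcol H y' = j" using j' C by blast
    obtain y0 where y0: "y0 \<in> joint_vertices G H False" "c (Inl u) y0 = c (Inr u') (Inr y')" "c y0 (Inl v) = c (Inr y') (Inr v')" "c y0 y0 = c (Inr y') (Inr y')"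
      using ext_point[OF W(2)[THEN iffD2, OF V'(1)] W(2)[THEN iffD2, OF V'(2)] W(1)[THEN iffD2, OF u(1)] W(1)[THEN iffD2, OF v(1)] e[symmetric] W(2)[THEN iffD2, OF y'(1)]] by blast
    obtain y where y: "y \<in> V G" "y0 = Inl y" using y0(1) by (auto simp: joint_vertices_def)
    have yj: "vcol G y = j" using vcol_cH[of y y'] y0(4) y y' by simp
    have "adj G v y = adj G u y" using p y yj v u unfolding v_def by metis
    then have "adj H v' y' = adj H u' y'"
      using adj_cH[of u y u' y'] adj_cH[of y v y' v'] y0 y is_vc_graph_adj_sym[OF vc(1), of y v] is_vc_graph_adj_sym[OF vc(2), of y' v'] by simp
    then have "v' = \<rho> j u'" using q y' V' c' a' by metis
    then show "(i, j) \<in> D'" using q a' c' by auto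
  qed
qed

lemma cfi_wl2_equivalent:
  assumes G: "cfi G C D" and H: "cfi H C' D'" and eq: "wl2_equivalent G H"
  shows "C = C'" "D = D'"
  using cfi_wl2_equivalent_subset[OF assms]
    cfi_wl2_equivalent_subset[OF H G wl2_equivalent_sym[OF cfi_finite[OF G] cfi_finite[OF H] eq]] by auto

section \<open>Digraphs on four points up to isomorphism\<close>

text \<open>Pairs of a permutation and a fixed point are counted in two ways: by the
  orbit-stabilizer relation \<open>stab\<close>, each orbit contributes
  \<open>card P\<close>.\<close>

lemma burnside:
  fixes act :: "('a \<Rightarrow> 'a) \<Rightarrow> 'x \<Rightarrow> 'x"
  assumes P: "finite P" "id \<in> P" "\<And>p q. p \<in> P \<Longrightarrow> q \<in> P \<Longrightarrow> p \<circ> q \<in> P" "\<And>p. p \<in> P \<Longrightarrow> bij p \<and> inv p \<in> P"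
    and X: "finite X" "\<And>p x. p \<in> P \<Longrightarrow> x \<in> X \<Longrightarrow> act p x \<in> X"
    and act: "\<And>x. x \<in> X \<Longrightarrow> act id x = x" "\<And>p q x. p \<in> P \<Longrightarrow> q \<in> P \<Longrightarrow> x \<in> X \<Longrightarrow> act (p \<circ> q) x = act p (act q x)"
  shows "(\<Sum>p\<in>P. card {x \<in> X. act p x = x}) = card P * card ((\<lambda>x. (\<lambda>p. act p x) ` P) ` X)"
proof -
  define orb where "orb x = (\<lambda>p. act p x) ` P" for x
  have inv_act: "act (inv p) (act p x) = x" if "p \<in> P" "x \<in> X" for p x
    using act(2)[of "inv p" p x] act(1)[OF that(2)] P(4)[OF that(1)] that by (simp add: bij_is_inj)
  have orb_eq: "orb y = orb x" if x: "x \<in> X" and y: "y \<in> orb x" for x y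
  proof -
    obtain q where q: "q \<in> P" "y = act q x" using y by (auto simp: orb_def)
    have "orb (act r z) \<subseteq> orb z" if "r \<in> P" "z \<in> X" for r z
    proof
      fix w assume "w \<in> orb (act r z)"
      then obtain p where "p \<in> P" "w = act p (act r z)" by (auto simp: orb_def)
      then have "w = act (p \<circ> r) z" "p \<circ> r \<in> P" using act(2)[of p r z] that P(3) by auto
      then show "w \<in> orb z" unfolding orb_def by blast
    qed
    from this[OF q(1) x] this[of "inv q" y] show ?thesis
      using q P(4)[OF q(1)] X(2)[OF q(1) x] inv_act[OF q(1) x] by auto
  qed
  have self: "x \<in> orb x" if "x \<in> X" for x using act(1)[OF that] P(2) unfolding orb_def by force
  have orbX: "orb x \<subseteq> X" if "x \<in> X" for x using X(2) that by (auto simp: orb_def)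
  have stab: "card P = card (orb x) * card {p \<in> P. act p x = x}" if x: "x \<in> X" for x
  proof -
    have "card {p \<in> P. act p x = y} = card {p \<in> P. act p x = x}" if "y \<in> orb x" for y
    proof -
      obtain q where q: "q \<in> P" "y = act q x" using \<open>y \<in> orb x\<close> by (auto simp: orb_def)
      have "bij_betw (\<lambda>p. q \<circ> p) {p \<in> P. act p x = x} {p \<in> P. act p x = y}"
      proof (rule bij_betwI[of _ _ _ "\<lambda>p. inv q \<circ> p"])
        show "(\<lambda>p. q \<circ> p) \<in> {p \<in> P. act p x = x} \<rightarrow> {p \<in> P. act p x = y}"
          using q P(3) act(2) x by auto
        show "(\<lambda>p. inv q \<circ> p) \<in> {p \<in> P. act p x = y} \<rightarrow> {p \<in> P. act p x = x}"
          using q P(3,4) act(2) x inv_act by auto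
        show "inv q \<circ> (q \<circ> p) = p" for p using P(4)[OF q(1)] by (simp add: o_assoc bij_is_inj)
        show "q \<circ> (inv q \<circ> p) = p" for p using P(4)[OF q(1)] by (simp add: o_assoc bij_is_surj surj_iff[THEN iffD1])
      qed
      then show ?thesis using bij_betw_same_card by fastforce
    qed
    then have "(\<Sum>y\<in>orb x. card {p \<in> P. act p x = y}) = card (orb x) * card {p \<in> P. act p x = x}" by simp
    moreover have "(\<Sum>p\<in>P. 1) = (\<Sum>y\<in>orb x. \<Sum>p\<in>{p \<in> P. act p x = y}. 1::nat)"
      unfolding orb_def by (rule sum.image_gen[OF P(1)])
    ultimately show ?thesis by simp
  qed
  have "(\<Sum>p\<in>P. card {x \<in> X. act p x = x}) = (\<Sum>p\<in>P. \<Sum>x\<in>X. of_bool (act p x = x))"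
    using X(1) by (intro sum.cong refl) (simp add: Int_def)
  also have "\<dots> = (\<Sum>x\<in>X. \<Sum>p\<in>P. of_bool (act p x = x))" by (rule sum.swap)
  also have "\<dots> = (\<Sum>x\<in>X. card {p \<in> P. act p x = x})"
    using P(1) by (intro sum.cong refl) (simp add: Int_def)
  also have "\<dots> = (\<Sum>Q\<in>orb ` X. \<Sum>x\<in>{x \<in> X. orb x = Q}. card {p \<in> P. act p x = x})"
    by (rule sum.image_gen[OF X(1)])
  also have "\<dots> = (\<Sum>Q\<in>orb ` X. card P)"
  proof (rule sum.cong[OF refl])
    fix Q assume "Q \<in> orb ` X"
    then obtain y where y: "y \<in> X" "Q = orb y" by blast
    have Q: "{x \<in> X. orb x = Q} = Q" using orb_eq[OF y(1)] orbX[OF y(1)] self y(2) by blast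
    have fin: "finite Q" using y P(1) by (simp add: orb_def)
    have "Q \<noteq> {}" using self y by blast
    have c: "card Q * card {p \<in> P. act p x = x} = card P" if "x \<in> Q" for x
      using stab[of x] orb_eq[OF y(1), of x] orbX[OF y(1)] that y(2) by auto
    have "card Q * (\<Sum>x\<in>Q. card {p \<in> P. act p x = x}) = (\<Sum>x\<in>Q. card P)"
      unfolding sum_distrib_left by (rule sum.cong[OF refl c])
    then have "card Q * (\<Sum>x\<in>Q. card {p \<in> P. act p x = x}) = card Q * card P" by simp
    then show "(\<Sum>x\<in>{x \<in> X. orb x = Q}. card {p \<in> P. act p x = x}) = card P"
      unfolding Q using fin \<open>Q \<noteq> {}\<close> by simp
  qed
  finally show ?thesis by (simp add: orb_def[abs_def] mult.commute)
qed

text \<open>Invariant sets correspond to sets of orbits. Any positive \<open>n\<close> with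
  \<open>q ^^ n\<close> trivial on \<open>A\<close> is admissible, as an orbit is listed as a set
  and repetitions do not count.\<close>

lemma card_fixed_subsets:
  fixes q :: "'a \<Rightarrow> 'a"
  assumes A: "finite A" "q ` A \<subseteq> A" and n: "n > 0" "\<And>x. x \<in> A \<Longrightarrow> (q ^^ n) x = x"
  shows "card {D \<in> Pow A. q ` D = D} = 2 ^ card ((\<lambda>x. (\<lambda>k. (q ^^ k) x) ` {..<n}) ` A)"
proof -
  define orb where "orb x = (\<lambda>k. (q ^^ k) x) ` {..<n}" for x
  have orbI: "(q ^^ k) x \<in> orb x" if "x \<in> A" for x k
    using funpow_mod_eq[OF n(2)[OF that], of k] n(1) unfolding orb_def by (metis imageI lessThan_iff mod_less_divisor)
  have orbA: "(q ^^ k) x \<in> A" if "x \<in> A" for x k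
    using that A(2) by (induction k) auto
  have orb_closed: "orb y = orb x" if x: "x \<in> A" "y \<in> orb x" for x y
  proof -
    obtain k where k: "k < n" "y = (q ^^ k) x" using x by (auto simp: orb_def)
    have "x = (q ^^ (n - k)) y" using k n(2)[OF x(1)] by (simp add: funpow_add[symmetric, THEN fun_cong, unfolded comp_def])
    have "orb y \<subseteq> orb x"
    proof
      fix z assume "z \<in> orb y"
      then obtain l where "z = (q ^^ l) y" by (auto simp: orb_def)
      then have "z = (q ^^ (l + k)) x" using k by (simp add: funpow_add)
      then show "z \<in> orb x" using orbI x by simp
    qed
    moreover have "orb x \<subseteq> orb y"
    proof
      fix z assume "z \<in> orb x"
      then obtain l where "z = (q ^^ l) x" by (auto simp: orb_def)
      then have "z = (q ^^ (l + (n - k))) y" using \<open>x = _\<close> by (simp add: funpow_add)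
      then show "z \<in> orb y" using orbI[of y] orbA[OF x(1), of k] k by simp
    qed
    ultimately show ?thesis by blast
  qed
  have self: "x \<in> orb x" if "x \<in> A" for x using orbI[OF that, of 0] by simp
  have orb_sub: "orb x \<subseteq> A" if "x \<in> A" for x using orbA[OF that] by (auto simp: orb_def)
  have q_orb: "q ` orb x = orb x" if x: "x \<in> A" for x
  proof -
    have "q ` orb x \<subseteq> orb x"
      using orbI[OF x, of "Suc _"] by (auto simp: orb_def simp del: funpow.simps) (metis comp_apply funpow.simps(2) imageE)
    moreover have "z \<in> q ` orb x" if "z \<in> orb x" for z
    proof -
      have zA: "z \<in> A" using orb_sub[OF x] that by blast
      have "z = q ((q ^^ (n - 1)) z)" using n(2)[OF zA] n(1) by (metis Suc_diff_1 comp_apply funpow.simps(2))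
      moreover have "(q ^^ (n - 1)) z \<in> orb x" using orbI[OF zA] orb_closed[OF x that] by blast
      ultimately show ?thesis by blast
    qed
    ultimately show ?thesis by blast
  qed
  have "bij_betw Union (Pow (orb ` A)) {D \<in> Pow A. q ` D = D}"
    unfolding bij_betw_def
  proof (intro conjI subset_antisym)
    show "inj_on Union (Pow (orb ` A))"
    proof (rule inj_onI)
      have *: "S = {C \<in> orb ` A. C \<inter> \<Union>S \<noteq> {}}" if S: "S \<in> Pow (orb ` A)" for S
      proof (intro subset_antisym subsetI)
        fix C assume "C \<in> S" then show "C \<in> {C \<in> orb ` A. C \<inter> \<Union>S \<noteq> {}}" using S self by fast
      next
        fix C assume "C \<in> {C \<in> orb ` A. C \<inter> \<Union>S \<noteq> {}}"
        then obtain x z C' where "x \<in> A" "C = orb x" "z \<in> C" "C' \<in> S" "z \<in> C'" by blast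
        moreover then obtain y where "y \<in> A" "C' = orb y" using S by blast
        ultimately have "C = C'" using orb_closed[of x z] orb_closed[of y z] by simp
        then show "C \<in> S" using \<open>C' \<in> S\<close> by simp
      qed
      fix S T assume "S \<in> Pow (orb ` A)" "T \<in> Pow (orb ` A)" "\<Union>S = \<Union>T"
      then show "S = T" using *[of S] *[of T] by simp
    qed
    show "Union ` Pow (orb ` A) \<subseteq> {D \<in> Pow A. q ` D = D}"
    proof (intro image_subsetI CollectI conjI)
      fix S assume S: "S \<in> Pow (orb ` A)"
      then show "\<Union>S \<in> Pow A" using orb_sub by blast
      have "q ` C = C" if "C \<in> S" for C using S that q_orb by blast
      then show "q ` \<Union>S = \<Union>S" by (simp add: image_Union)
    qed
    show "{D \<in> Pow A. q ` D = D} \<subseteq> Union ` Pow (orb ` A)"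
    proof
      fix D assume D: "D \<in> {D \<in> Pow A. q ` D = D}"
      have "(q ^^ k) x \<in> D" if "x \<in> D" for x k using that D by (induction k) auto
      then have "D = \<Union> (orb ` D)" using self D by (fastforce simp: orb_def)
      then show "D \<in> Union ` Pow (orb ` A)" using D by (intro image_eqI[of _ _ "orb ` D"]) auto
    qed
  qed
  then have "card {D \<in> Pow A. q ` D = D} = card (Pow (orb ` A))" by (rule bij_betw_same_card[symmetric])
  then show ?thesis using A(1) by (simp add: card_Pow orb_def[abs_def])
qed

section \<open>Evaluation over the 24 permutations\<close>

definition list_arcs :: "(nat \<times> nat) list" where
  "list_arcs = [(0,1),(0,2),(0,3),(1,0),(1,2),(1,3),(2,0),(2,1),(2,3),(3,0),(3,1),(3,2)]"

text \<open>The orbits on arcs of a permutation given by the list of its values. The number 12 is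
  the least common multiple of the cycle lengths 1, 2, 3, 4, hence an exponent for all permutations
  of four points.\<close>

definition list_orbits :: "nat list \<Rightarrow> (nat \<times> nat) set set" where
  "list_orbits xs = set (map (\<lambda>(i, j). set (map (\<lambda>k. ((nth xs ^^ k) i, (nth xs ^^ k) j)) [0..<12])) list_arcs)"

definition list_perms :: "nat list list" where
  "list_perms = permutations_of_set_list [0, 1, 2, 3]"

lemma list_perms_order: "\<forall>xs\<in>set list_perms. \<forall>i\<in>set [0, 1, 2, 3]. (nth xs ^^ 12) i = i"
  by code_simp

definition relabel :: "(nat \<Rightarrow> nat) \<Rightarrow> nat rel \<Rightarrow> nat rel" where
  "relabel p D = map_prod p p ` D"

definition relabelings :: "nat rel \<Rightarrow> nat rel set" where
  "relabelings D = (\<lambda>p. relabel p D) ` {p. p permutes {..<4}}"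

text \<open>Orbits on arcs by cycle type: 12 for the identity, 7 for the 6 transpositions, 6 for the
  3 double transpositions, 4 for the 8 three-cycles, 3 for the 6 four-cycles. Thus
  \<open>4096 + 768 + 192 + 128 + 48 = 5232\<close>.\<close>

lemma list_orbits_sum: "(\<Sum>xs\<leftarrow>list_perms. 2 ^ card (list_orbits xs)) = (5232::nat)"
  by code_simp


text \<open>Passes from permutations as functions, which form the acting group, to lists of values,
  on which the sum is evaluated.\<close>

lemma bij_perms: "bij_betw (\<lambda>p. map p [0, 1, 2, 3]) {p. p permutes {..<4::nat}} (set list_perms)"
proof -
  have lp: "set list_perms = permutations_of_set {0, 1, 2, 3}"
    unfolding list_perms_def using permutations_of_list[of "[0, 1, 2, 3 :: nat]"] by simp
  have eq: "{..<4::nat} = {0, 1, 2, 3}" by auto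
  have inj: "inj_on (\<lambda>p. map p [0, 1, 2, 3]) {p. p permutes {..<4::nat}}"
  proof (rule inj_onI)
    fix p q :: "nat \<Rightarrow> nat"
    assume "p \<in> {p. p permutes {..<4}}" "q \<in> {p. p permutes {..<4}}" and e: "map p [0, 1, 2, 3] = map q [0, 1, 2, 3]"
    then have pq: "p permutes {..<4}" "q permutes {..<4}" by auto
    show "p = q"
    proof
      fix x
      show "p x = q x"
        using e permutes_not_in[OF pq(1), of x] permutes_not_in[OF pq(2), of x] unfolding eq by (cases "x \<in> {0, 1, 2, 3}") auto
    qed
  qed
  have "(\<lambda>p. map p [0, 1, 2, 3]) ` {p. p permutes {..<4::nat}} \<subseteq> set list_perms"
    unfolding lp
  proof (intro image_subsetI)
    fix p :: "nat \<Rightarrow> nat" assume "p \<in> {p. p permutes {..<4}}"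
    then have p: "p permutes {0, 1, 2, 3}" by (simp add: eq)
    have "distinct (map p [0, 1, 2, 3])" using permutes_inj[OF p] by (simp add: inj_eq)
    then show "map p [0, 1, 2, 3] \<in> permutations_of_set {0, 1, 2, 3}"
      using permutes_image[OF p] by (intro permutations_of_setI) auto
  qed
  moreover have "card ((\<lambda>p. map p [0, 1, 2, 3]) ` {p. p permutes {..<4::nat}}) = card (set list_perms)"
    unfolding card_image[OF inj] lp by (simp add: card_permutations eq)
  ultimately show ?thesis unfolding bij_betw_def using inj by (simp add: card_subset_eq)
qed

lemma card_relabelings: "card (relabelings ` Pow ({..<4} \<times> {..<4} - Id)) = 218"
proof -
  let ?A = "{..<4} \<times> {..<4} - Id :: nat rel"
  let ?P = "{p. p permutes {..<4::nat}}"
  have "{..<4::nat} = {0, 1, 2, 3}" by auto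
  then have "?A = {0, 1, 2, 3} \<times> {0, 1, 2, 3} - Id" by simp
  also have "\<dots> = set list_arcs" by (simp add: list_arcs_def insert_Diff_if)
  finally have A: "?A = set list_arcs" .
  have fixed: "card {D \<in> Pow ?A. relabel p D = D} = 2 ^ card (list_orbits (map p [0, 1, 2, 3]))" if p: "p permutes {..<4}" for p
  proof -
    let ?xs = "map p [0, 1, 2, 3]"
    have nth: "?xs ! i = p i" if "i < 4" for i
    proof -
      have "i \<in> {0, 1, 2, 3}" using that by auto
      then show ?thesis by (elim insertE emptyE) auto
    qed
    have lt: "p i < 4" if "i < 4" for i using permutes_in_image[OF p, of i] that by simp
    have pw: "(nth ?xs ^^ k) i = (p ^^ k) i \<and> (p ^^ k) i < 4" if "i < 4" for k i
      using that
    proof (induction k)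
      case (Suc k)
      have "(nth ?xs ^^ Suc k) i = ?xs ! ((p ^^ k) i)" using Suc by simp
      then show ?case using nth[of "(p ^^ k) i"] lt[of "(p ^^ k) i"] Suc by simp
    qed simp
    have mp: "(map_prod p p ^^ k) x = ((p ^^ k) (fst x), (p ^^ k) (snd x))" for k x
      by (induction k) (simp_all add: map_prod_def case_prod_beta)
    have "?xs \<in> set list_perms" using bij_betwE[OF bij_perms] p by blast
    then have "(nth ?xs ^^ 12) i = i" if "i < 4" for i
    proof -
      have "i \<in> set [0, 1, 2, 3]" using that by auto
      then show ?thesis by (rule bspec[OF bspec[OF list_perms_order \<open>?xs \<in> _\<close>]])
    qed
    then have order: "(p ^^ 12) i = i" if "i < 4" for i using pw[OF that, of 12] that by simp
    have "card {D \<in> Pow ?A. map_prod p p ` D = D} = 2 ^ card ((\<lambda>x. (\<lambda>k. (map_prod p p ^^ k) x) ` {..<12}) ` ?A)"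
    proof (rule card_fixed_subsets)
      show "map_prod p p ` ?A \<subseteq> ?A" 
      proof (rule image_subsetI)
        fix x assume "x \<in> ?A"
        then obtain i j where "x = (i, j)" "i < 4" "j < 4" "i \<noteq> j" by auto
        then show "map_prod p p x \<in> ?A" using lt[of i] lt[of j] inj_eq[OF permutes_inj[OF p], of i j] by simp
      qed
      show "(map_prod p p ^^ 12) x = x" if "x \<in> ?A" for x
      proof -
        have "fst x < 4" "snd x < 4" using that by auto
        then show ?thesis unfolding mp by (simp only: order prod.collapse)
      qed
    qed auto
    moreover have "(\<lambda>x. (\<lambda>k. (map_prod p p ^^ k) x) ` {..<12}) ` ?A = list_orbits ?xs"
    proof -
      have "(\<lambda>k. (map_prod p p ^^ k) x) ` {..<12} = (\<lambda>(i, j). set (map (\<lambda>k. ((nth ?xs ^^ k) i, (nth ?xs ^^ k) j)) [0..<12])) x" if "x \<in> ?A" for x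
      proof -
        obtain i j where x: "x = (i, j)" by (cases x)
        then have ij: "i < 4" "j < 4" using that by auto
        show ?thesis unfolding x prod.case set_map set_upt mp fst_conv snd_conv
          by (rule image_cong) (auto simp only: pw[OF ij(1)] pw[OF ij(2)] atLeast0LessThan)
      qed
      then show ?thesis unfolding list_orbits_def set_map[of _ list_arcs] A[symmetric] by (rule image_cong[OF refl])
    qed
    ultimately show ?thesis unfolding relabel_def by simp
  qed
  have "(\<Sum>p\<in>?P. card {D \<in> Pow ?A. relabel p D = D}) = card ?P * card (relabelings ` Pow ?A)"
    unfolding relabelings_def
  proof (rule burnside)
    show "finite ?P" by (rule finite_permutations) simp
    show "relabel p D \<in> Pow ?A" if "p \<in> ?P" "D \<in> Pow ?A" for p D
    proof -
      have "p i < 4" if "i < 4" for i using permutes_in_image[of p "{..<4}" i] that \<open>p \<in> ?P\<close> by simp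
      moreover have "inj p" using \<open>p \<in> ?P\<close> by (auto intro: permutes_inj)
      ultimately have "map_prod p p x \<in> ?A" if "x \<in> ?A" for x
        using that by (cases x) (simp add: inj_eq)
      moreover have "f ` E \<in> Pow B" if "\<And>x. x \<in> B \<Longrightarrow> f x \<in> B" "E \<in> Pow B" for f and B E :: "nat rel"
        using that by blast
      ultimately show ?thesis using \<open>D \<in> Pow ?A\<close> unfolding relabel_def by metis
    qed
    show "relabel (p \<circ> q) D = relabel p (relabel q D)" for p q D
      by (simp add: relabel_def image_image map_prod_def case_prod_beta)
  qed (auto simp: relabel_def permutes_id permutes_compose permutes_bij permutes_inv map_prod.id)
  moreover have "(\<Sum>p\<in>?P. card {D \<in> Pow ?A. relabel p D = D}) = (\<Sum>p\<in>?P. 2 ^ card (list_orbits (map p [0, 1, 2, 3])))"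
    by (rule sum.cong) (use fixed in auto)
  moreover have "\<dots> = (\<Sum>xs\<in>set list_perms. 2 ^ card (list_orbits xs))"
    by (rule sum.reindex_bij_betw[OF bij_perms])
  moreover have "\<dots> = (\<Sum>xs\<leftarrow>list_perms. 2 ^ card (list_orbits xs))"
    by (rule sum_list_distinct_conv_sum_set[symmetric]) (code_simp)
  moreover have "card ?P = 24" by (subst card_permutations[of _ 4]) (simp_all add: fact_numeral)
  ultimately show ?thesis using list_orbits_sum by simp
qed

section \<open>Counting\<close>

lemma sym_trans_Image: "sym r \<Longrightarrow> trans r \<Longrightarrow> (x, y) \<in> r \<Longrightarrow> r `` {x} = r `` {y}"
  unfolding sym_def trans_def by blast

text \<open>Renamings are bijections of the whole color type, so a bijection from \<open>A\<close>
  to \<open>B\<close> is completed by one from \<open>B - A\<close> to \<open>A - B\<close> and by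
  the identity elsewhere.\<close>

lemma ex_bij_image:
  fixes A B :: "'c set"
  assumes "finite A" "finite B" "card A = card B"
  shows "\<exists>p. bij p \<and> p ` A = B"
proof -
  obtain f where f: "bij_betw f A B" using assms by (metis finite_same_card_bij)
  have "card (A \<union> B - A) = card (A \<union> B - B)" using assms by (simp add: card_Diff_subset)
  then obtain g where g: "bij_betw g (A \<union> B - A) (A \<union> B - B)" using finite_same_card_bij[of "A \<union> B - A" "A \<union> B - B"] assms(1,2) by auto
  define p where "p x = (if x \<in> A then f x else if x \<in> A \<union> B then g x else x)" for x
  have "bij_betw p A B" using f by (rule bij_betw_cong[THEN iffD1, rotated]) (simp add: p_def)
  moreover have "bij_betw p (A \<union> B - A) (A \<union> B - B)" using g by (rule bij_betw_cong[THEN iffD1, rotated]) (auto simp: p_def)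
  ultimately have "bij_betw p (A \<union> (A \<union> B - A)) (B \<union> (A \<union> B - B))" by (rule bij_betw_combine) blast
  then have "bij_betw p (A \<union> B) (A \<union> B)" by (simp add: Un_ac)
  then have "p permutes (A \<union> B)" by (rule bij_imp_permutes) (simp add: p_def)
  then show ?thesis using \<open>bij_betw p A B\<close> permutes_bij bij_betw_imp_surj_on by blast
qed

lemma card_class_le_multiplicity:
  assumes "is_vc_graph G"
  shows "card {v \<in> V G. vcol G v = k} \<le> color_multiplicity G"
proof (cases "k \<in> vcol G ` V G")
  case True
  then show ?thesis using is_vc_graph_finite[OF assms] unfolding color_multiplicity_def by (intro Max_ge) auto
next
  case False
  then have "{v \<in> V G. vcol G v = k} = {}" by blast
  then show ?thesis by (metis card.empty le0)
qed

lemma cfi_color_multiplicity: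
  assumes "cfi G C D"
  shows "color_multiplicity G = 4"
proof -
  have C: "vcol G ` V G = C" "\<And>i. i \<in> C \<Longrightarrow> card {v \<in> V G. vcol G v = i} = 4" "card C = 4" using assms by (auto simp: cfi_def)
  then have "C \<noteq> {}" by auto
  then have "(\<lambda>c. card {v \<in> V G. vcol G v = c}) ` vcol G ` V G = {4}" unfolding C(1) using C(2) by (auto simp: image_iff)
  then show ?thesis unfolding color_multiplicity_def by simp
qed

lemma cfi_vc_graphs: "cfi G C D \<Longrightarrow> G \<in> vc_graphs 16 4"
  using cfi_card[of G C D] cfi_color_multiplicity[of G C D] by (simp add: vc_graphs_def cfi_def)

section \<open>Relabeled digraphs and renamed graphs\<close>

lemma relabelings_self: "D \<in> relabelings D"
  unfolding relabelings_def by (rule image_eqI[of _ _ id]) (simp_all add: relabel_def map_prod.id permutes_id)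

lemma relabelings_trans: "D' \<in> relabelings D \<Longrightarrow> D'' \<in> relabelings D' \<Longrightarrow> D'' \<in> relabelings D"
  unfolding relabelings_def
proof (elim imageE CollectE)
  fix p q assume "D' = relabel p D" "D'' = relabel q D'" "p permutes {..<4}" "q permutes {..<4}"
  then show "D'' \<in> (\<lambda>p. relabel p D) ` {p. p permutes {..<4}}"
    by (intro image_eqI[of _ _ "q \<circ> p"]) (auto simp: relabel_def image_image map_prod_def case_prod_beta permutes_compose)
qed

lemma relabelings_sym: "D' \<in> relabelings D \<Longrightarrow> D \<in> relabelings D'"
  unfolding relabelings_def
proof (elim imageE CollectE)
  fix p assume p: "D' = relabel p D" "p permutes {..<4}"
  then show "D \<in> (\<lambda>p. relabel p D') ` {p. p permutes {..<4}}"
    by (intro image_eqI[of _ _ "inv p"]) (auto simp: relabel_def image_image map_prod_def case_prod_beta permutes_inv permutes_inverses)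
qed

lemma relabelings_eq_iff: "relabelings D = relabelings D' \<longleftrightarrow> D' \<in> relabelings D"
  using relabelings_self relabelings_trans relabelings_sym by blast

text \<open>The renaming is replaced by the identity outside the four colors; arcs of
  \<open>D\<close> do not see the change.\<close>

lemma relabel_in_relabelings:
  assumes p: "inj p" "p ` {..<4} = {..<4}" and D: "D \<subseteq> arcs4"
  shows "relabel p D \<in> relabelings D"
proof -
  define q where "q x = (if x < 4 then p x else x)" for x
  have "bij_betw q {..<4} {..<4}"
    using p by (auto simp: bij_betw_def q_def inj_on_def inj_def)
  then have "q permutes {..<4}" by (rule bij_imp_permutes) (simp add: q_def)
  moreover have "map_prod p p x = map_prod q q x" if "x \<in> D" for x
    using D that by (cases x) (auto simp: q_def)
  then have "relabel p D = relabel q D" unfolding relabel_def by (rule image_cong[OF refl])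
  ultimately show ?thesis unfolding relabelings_def by blast
qed

lemma wl2_equivalent_cfi_graph:
  assumes "inj p" "D \<subseteq> arcs4" "D' \<subseteq> arcs4" "wl2_equivalent (recolor p (cfi_graph D b)) (cfi_graph D' b')"
  shows "D' \<in> relabelings D"
  using cfi_wl2_equivalent[OF cfi_recolor[OF assms(1) cfi_cfi_graph[OF assms(2)]] cfi_cfi_graph[OF assms(3)] assms(4)]
    relabel_in_relabelings[OF assms(1) _ assms(2)] by (simp add: relabel_def)

lemma rainbow_recolor_iff:
  assumes "bij p"
  shows "rainbow (recolor p G) \<longleftrightarrow> rainbow G"
proof
  assume "rainbow (recolor p G)"
  then have "rainbow (recolor (inv p) (recolor p G))" using assms by (rule rainbow_recolor[OF bij_is_inj[OF bij_imp_bij_inv], rotated])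
  then show "rainbow G" using assms by (simp add: recolor_recolor bij_is_inj)
qed (rule rainbow_recolor[OF bij_is_inj[OF assms]])

lemma rainbow_iso_iff: "vc_iso G H \<Longrightarrow> rainbow G \<longleftrightarrow> rainbow H"
  using rainbow_iso[of G H] rainbow_iso[of H G] vc_iso_sym[of G H] by blast

lemma vc_iso_cfi_graph_twist:
  assumes "bij p" "bij q" "vc_iso (recolor p (cfi_graph D b)) (recolor q (cfi_graph D' b'))"
  shows "b = b'"
  using rainbow_iso_iff[OF assms(3)] by (simp add: rainbow_recolor_iff assms rainbow_cfi_graph)

text \<open>The recolored graph satisfies \<open>cfi\<close> over the same four colors and so has a
  normal form; the rainbow clique shows that its twist is unchanged.\<close>

lemma relabel_vc_iso:
  assumes D: "D \<subseteq> arcs4" and D': "D' \<in> relabelings D"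
  shows "\<exists>p. bij p \<and> vc_iso (recolor p (cfi_graph D b)) (cfi_graph D' b)"
proof -
  obtain p where p: "p permutes {..<4}" "D' = relabel p D" using D' by (auto simp: relabelings_def)
  then have b: "bij p" by (simp add: permutes_bij)
  have "cfi (recolor p (cfi_graph D b)) {..<4} D'"
    using cfi_recolor[OF bij_is_inj[OF b] cfi_cfi_graph[OF D]] p by (simp add: relabel_def permutes_image)
  then obtain b' where b': "vc_iso (cfi_graph D' b') (recolor p (cfi_graph D b))" using cfi_normal_form by blast
  then have "b' = b" using vc_iso_cfi_graph_twist[of id p D' b' D b] b by simp
  then show ?thesis using b b' vc_iso_sym by blast
qed

lemma wl2_equivalent_cfi_graphs: "wl2_equivalent (recolor p (cfi_graph D b)) (recolor p (cfi_graph D b'))"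
proof -
  have "wl2_equivalent (cfi_graph D b) (cfi_graph D b')"
    using wl2_equivalent_twist[of D] wl2_equivalent_sym[OF _ _ wl2_equivalent_twist[of D]]
      vc_iso_wl2_equivalent[OF _ _ vc_iso_refl, of "cfi_graph D b"]
    by (cases b; cases b') simp_all
  then show ?thesis by (intro wl2_equivalent_recolor) simp_all
qed

lemma cfi_iso_cfi_graph:
  fixes G :: "('a, nat) vc_graph"
  assumes G: "cfi G C D"
  shows "\<exists>p E b. bij p \<and> E \<subseteq> arcs4 \<and> vc_iso (recolor p (cfi_graph E b)) G"
proof -
  have C: "card C = 4" using G by (simp add: cfi_def)
  then have "finite C" by (metis card.infinite zero_neq_numeral)
  then obtain q where q: "bij q" "q ` C = {..<4::nat}"
    using ex_bij_image[of C "{..<4}"] C by auto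
  have c: "cfi (recolor q G) {..<4} (map_prod q q ` D)" using cfi_recolor[OF bij_is_inj[OF q(1)] G] q(2) by simp
  then obtain b where "vc_iso (cfi_graph (map_prod q q ` D) b) (recolor q G)" using cfi_normal_form by blast
  from vc_iso_recolor[OF this, of "inv q"]
  have "vc_iso (recolor (inv q) (cfi_graph (map_prod q q ` D) b)) G" using q(1) by (simp add: recolor_recolor bij_is_inj)
  moreover have "map_prod q q ` D \<subseteq> arcs4" using c by (simp add: cfi_def)
  ultimately show ?thesis using bij_imp_bij_inv[OF q(1)] by blast
qed

lemma wl2_equivalent_iso_or_cfi_graph:
  fixes G :: "('a, nat) vc_graph" and H :: "('b, nat) vc_graph"
  assumes "is_vc_graph G" "is_vc_graph H" "wl2_equivalent G H" "color_multiplicity G \<le> 4" "card (V G) \<le> 16" "\<not> vc_iso G H"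
  shows "\<exists>p D b. bij p \<and> D \<subseteq> arcs4 \<and> vc_iso (recolor p (cfi_graph D b)) G"
proof -
  have "card {v \<in> V G. vcol G v = k} \<le> 4" for k
    using card_class_le_multiplicity[OF assms(1)] assms(4) le_trans by blast
  then obtain D where "cfi G (vcol G ` V G) D" using wl2_equivalent_iso_or_cfi[OF assms(1-3) _ assms(5,6)] by blast
  then show ?thesis by (rule cfi_iso_cfi_graph)
qed

lemma cfi_recolor_cfi_graph: "bij p \<Longrightarrow> D \<subseteq> arcs4 \<Longrightarrow> cfi (recolor p (cfi_graph D b)) (p ` {..<4}) (map_prod p p ` D)"
  by (intro cfi_recolor cfi_cfi_graph bij_is_inj)

text \<open>An equivalent \<open>H\<close> isomorphic to neither twist would satisfy
  \<open>cfi\<close>, by the structure theorem with \<open>H\<close> as the first graph. Equivalence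
  gives it the same colors and the same \<open>D\<close>, and its normal form is then one of the
  two.\<close>

lemma wl2_class_cfi_graph:
  assumes p: "bij p" "D \<subseteq> arcs4" and H: "is_vc_graph H" "wl2_equivalent (recolor p (cfi_graph D b)) H"
  shows "\<exists>b. vc_iso (recolor p (cfi_graph D b)) H"
proof (rule ccontr)
  assume n: "\<not> ?thesis"
  let ?X = "recolor p (cfi_graph D b)"
  note cX = cfi_recolor_cfi_graph[OF p, of b]
  have fin: "finite (V H)" "finite (V ?X)" using is_vc_graph_finite[OF H(1)] by auto
  have eq: "wl2_equivalent H ?X" using wl2_equivalent_sym[OF fin(2,1) H(2)] .
  have "card {v \<in> V H. vcol H v = k} \<le> 4" for k
    using wl2_equivalent_class_le[OF fin eq, of k] cfi_class_le[OF cX, of k] by simp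
  moreover have "card (V H) \<le> 16" using wl2_equivalent_card[OF fin eq] by simp
  moreover have "\<not> vc_iso H ?X" using n vc_iso_sym by blast
  ultimately obtain E where E: "cfi H (vcol H ` V H) E"
    using wl2_equivalent_iso_or_cfi[OF H(1) _ eq] by auto
  let ?q = "inv p"
  have q: "bij ?q" "inj ?q" using p(1) by (simp_all add: bij_imp_bij_inv bij_is_inj)
  have cE: "cfi (recolor ?q H) (?q ` vcol H ` V H) (map_prod ?q ?q ` E)" using cfi_recolor[OF q(2) E] .
  have "wl2_equivalent (recolor ?q H) (recolor ?q ?X)" by (rule wl2_equivalent_recolor[OF fin eq])
  then have "wl2_equivalent (recolor ?q H) (cfi_graph D b)" using p(1) by (simp add: recolor_recolor bij_is_inj)
  from cfi_wl2_equivalent[OF cE cfi_cfi_graph[OF p(2)] this]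
  have "cfi (recolor ?q H) {..<4} D" using cE by simp
  then obtain b' where "vc_iso (cfi_graph D b') (recolor ?q H)" using cfi_normal_form by blast
  from vc_iso_recolor[OF this, of p] have "vc_iso (recolor p (cfi_graph D b')) H"
    using p(1) by (simp add: recolor_recolor bij_is_surj surj_iff[THEN iffD1])
  then show False using n by blast
qed

text \<open>The graph with the opposite twist is equivalent but not isomorphic.\<close>

lemma not_amenable_cfi_graph:
  assumes p: "bij p" and G: "is_vc_graph G" "vc_iso (recolor p (cfi_graph D b)) G"
  shows "\<not> wl2_amenable G"
proof
  assume am: "wl2_amenable G"
  let ?X = "\<lambda>b. recolor p (cfi_graph D b)"
  have fin: "finite (V G)" "finite (V (?X b))" "finite (V (?X (\<not> b)))" using is_vc_graph_finite[OF G(1)] by auto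
  have "wl2_equivalent G (?X b)" using vc_iso_wl2_equivalent[OF fin(1,2)] G(2) vc_iso_sym by blast
  then have "wl2_equivalent G (?X (\<not> b))"
    using wl2_equivalent_trans[OF fin] wl2_equivalent_cfi_graphs by blast
  then have "vc_iso G (?X (\<not> b))" using am unfolding wl2_amenable_def by simp
  then have "vc_iso (?X b) (?X (\<not> b))" using G(2) vc_iso_trans by blast
  then show False using vc_iso_cfi_graph_twist[OF p p] by blast
qed

section \<open>Equivalence relations on graphs and on classes\<close>

lemma sym_wl2_rel: "sym (wl2_rel :: ('a, 'c) vc_graph rel)" and trans_wl2_rel: "trans (wl2_rel :: ('a, 'c) vc_graph rel)"
proof -
  show "sym (wl2_rel :: ('a, 'c) vc_graph rel)"
    unfolding sym_def wl2_rel_def using wl2_equivalent_sym is_vc_graph_finite by auto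
  show "trans (wl2_rel :: ('a, 'c) vc_graph rel)"
  proof (rule transI)
    fix G H K :: "('a, 'c) vc_graph" assume "(G, H) \<in> wl2_rel" "(H, K) \<in> wl2_rel"
    then show "(G, K) \<in> wl2_rel"
      using wl2_equivalent_trans[of G H K] is_vc_graph_finite[of G] is_vc_graph_finite[of H] is_vc_graph_finite[of K]
      unfolding wl2_rel_def by blast
  qed
qed

lemma sym_iso_rel: "sym iso_rel" and trans_iso_rel: "trans iso_rel"
proof -
  show "sym iso_rel" unfolding sym_def iso_rel_def using vc_iso_sym by auto
  show "trans iso_rel" unfolding trans_def iso_rel_def using vc_iso_trans by blast
qed

lemma sym_iso_renaming_rel: "sym iso_renaming_rel"
proof (rule symI)
  fix G H :: "('a, 'c) vc_graph" assume "(G, H) \<in> iso_renaming_rel"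
  then obtain p where p: "is_vc_graph G" "is_vc_graph H" "bij p" "vc_iso (recolor p G) H" by (auto simp: iso_renaming_rel_def)
  from vc_iso_recolor[OF p(4), of "inv p"] have "vc_iso (recolor (inv p) H) G"
    using p(3) vc_iso_sym by (auto simp: recolor_recolor bij_is_inj)
  then show "(H, G) \<in> iso_renaming_rel" using p bij_imp_bij_inv by (auto simp: iso_renaming_rel_def)
qed

lemma trans_iso_renaming_rel: "trans iso_renaming_rel"
proof (rule transI)
  fix G H K :: "('a, 'c) vc_graph" assume "(G, H) \<in> iso_renaming_rel" "(H, K) \<in> iso_renaming_rel"
  then obtain p q where p: "is_vc_graph G" "is_vc_graph K" "bij p" "vc_iso (recolor p G) H" "bij q" "vc_iso (recolor q H) K"
    by (auto simp: iso_renaming_rel_def)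
  have "vc_iso (recolor (q \<circ> p) G) K" using vc_iso_trans[OF vc_iso_recolor[OF p(4), of q] p(6)] by (simp add: recolor_recolor)
  then show "(G, K) \<in> iso_renaming_rel" using p bij_comp by (auto simp: iso_renaming_rel_def)
qed

lemma sym_class_renaming_rel: "sym class_renaming_rel"
proof (rule symI)
  fix K L :: "('a, 'c) vc_graph set" assume "(K, L) \<in> class_renaming_rel"
  then obtain p where p: "bij p" "L = recolor p ` K" by (auto simp: class_renaming_rel_def)
  then have "K = recolor (inv p) ` L" by (simp add: image_image recolor_recolor bij_is_inj)
  then show "(L, K) \<in> class_renaming_rel" using bij_imp_bij_inv[OF p(1)] by (auto simp: class_renaming_rel_def)
qed

lemma trans_class_renaming_rel: "trans class_renaming_rel"
proof (rule transI)
  fix K L M :: "('a, 'c) vc_graph set" assume "(K, L) \<in> class_renaming_rel" "(L, M) \<in> class_renaming_rel"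
  then obtain p q where p: "bij p" "L = recolor p ` K" "bij q" "M = recolor q ` L" by (auto simp: class_renaming_rel_def)
  then have "M = recolor (q \<circ> p) ` K" by (simp add: image_image recolor_recolor)
  then show "(K, M) \<in> class_renaming_rel" using bij_comp[OF p(1,3)] by (auto simp: class_renaming_rel_def)
qed

lemma recolor_wl2_class:
  assumes p: "bij p"
  shows "recolor p ` (wl2_rel `` {G}) = wl2_rel `` {recolor p G}"
proof (intro subset_antisym image_subsetI subsetI)
  fix H assume "H \<in> wl2_rel `` {G}"
  then show "recolor p H \<in> wl2_rel `` {recolor p G}"
    using wl2_equivalent_recolor[of G H p] is_vc_graph_finite by (auto simp: wl2_rel_def)
next
  fix H assume "H \<in> wl2_rel `` {recolor p G}"
  then have H: "is_vc_graph G" "is_vc_graph H" "wl2_equivalent (recolor p G) H" by (auto simp: wl2_rel_def)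
  then have "wl2_equivalent (recolor (inv p) (recolor p G)) (recolor (inv p) H)"
    by (intro wl2_equivalent_recolor) (simp_all add: is_vc_graph_finite)
  then have "recolor (inv p) H \<in> wl2_rel `` {G}" using H p by (simp add: wl2_rel_def recolor_recolor bij_is_inj)
  moreover have "H = recolor p (recolor (inv p) H)" using p by (simp add: recolor_recolor bij_is_surj surj_iff[THEN iffD1])
  ultimately show "H \<in> recolor p ` (wl2_rel `` {G})" by blast
qed

section \<open>Amenability of small graphs and the counts for 16 vertices\<close>

lemma small_wl2_amenable:
  fixes G :: "('a, 'c) vc_graph"
  assumes "is_vc_graph G" "color_multiplicity G = 4" "card (V G) \<le> 15"
  shows "wl2_amenable G"
  unfolding wl2_amenable_def
proof (intro allI impI, rule ccontr)
  fix H :: "(nat, 'c) vc_graph"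
  assume H: "is_vc_graph H" "wl2_equivalent G H" "\<not> vc_iso G H"
  have "card {v \<in> V G. vcol G v = k} \<le> 4" for k using card_class_le_multiplicity[OF assms(1), of k] assms(2) by simp
  then have "card (V G) = 16" using wl2_equivalent_iso_or_cfi[OF assms(1) H(1,2) _ _ H(3)] assms(3) by simp
  then show False using assms(3) by simp
qed

text \<open>So \<open>relabelings D\<close> together with \<open>b\<close> is a complete invariant
  up to isomorphism and renaming, whence \<open>436 = 2 * 218\<close>.\<close>

lemma iso_renaming_cfi_graph_iff:
  assumes D: "D \<subseteq> arcs4" "D' \<subseteq> arcs4"
  shows "(cfi_graph D b, cfi_graph D' b') \<in> iso_renaming_rel \<longleftrightarrow> b = b' \<and> D' \<in> relabelings D"
proof
  assume "(cfi_graph D b, cfi_graph D' b') \<in> iso_renaming_rel"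
  then obtain p where p: "bij p" "vc_iso (recolor p (cfi_graph D b)) (cfi_graph D' b')" by (auto simp: iso_renaming_rel_def)
  have "wl2_equivalent (recolor p (cfi_graph D b)) (cfi_graph D' b')" by (rule vc_iso_wl2_equivalent) (use p in simp_all)
  then show "b = b' \<and> D' \<in> relabelings D"
    using wl2_equivalent_cfi_graph[OF bij_is_inj[OF p(1)] D] vc_iso_cfi_graph_twist[OF p(1), of id D b D' b'] p by simp
qed (use relabel_vc_iso[OF D(1)] in \<open>auto simp: iso_renaming_rel_def\<close>)

lemma card_not_amenable: "card ({G \<in> vc_graphs 16 4. \<not> wl2_amenable G} // iso_renaming_rel) = 436"
proof -
  let ?A = "{G \<in> vc_graphs 16 4. \<not> wl2_amenable G}"
  let ?R = "iso_renaming_rel :: (nat, nat) vc_graph rel"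
  let ?f = "\<lambda>(D, b). ?R `` {cfi_graph D b}"
  have R: "?R `` {G} = ?R `` {H}" if "(G, H) \<in> ?R" for G H
    using sym_trans_Image[OF sym_iso_renaming_rel trans_iso_renaming_rel that] .
  have "?A // ?R = ?f ` (Pow arcs4 \<times> UNIV)"
  proof (intro subset_antisym subsetI)
    fix Q assume "Q \<in> ?A // ?R"
    then obtain G where G: "G \<in> vc_graphs 16 4" "\<not> wl2_amenable G" "Q = ?R `` {G}" by (auto elim: quotientE)
    have G': "is_vc_graph G" "card (V G) = 16" "color_multiplicity G = 4" using G(1) by (auto simp: vc_graphs_def)
    obtain H :: "(nat, nat) vc_graph" where H: "is_vc_graph H" "wl2_equivalent G H" "\<not> vc_iso G H"
      using G(2) by (auto simp: wl2_amenable_def)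
    obtain p D b where p: "bij p" "D \<subseteq> arcs4" "vc_iso (recolor p (cfi_graph D b)) G"
      using wl2_equivalent_iso_or_cfi_graph[OF G'(1) H(1,2) _ _ H(3)] G' by auto
    then have "(cfi_graph D b, G) \<in> ?R" using G' by (auto simp: iso_renaming_rel_def)
    then have "Q = ?f (D, b)" using R G(3) by simp
    then show "Q \<in> ?f ` (Pow arcs4 \<times> UNIV)" using p(2) by blast
  next
    fix Q assume "Q \<in> ?f ` (Pow arcs4 \<times> UNIV)"
    then obtain D b where D: "D \<subseteq> arcs4" "Q = ?R `` {cfi_graph D b}" by auto
    have "cfi_graph D b \<in> ?A"
      using cfi_vc_graphs[OF cfi_cfi_graph[OF D(1)]] not_amenable_cfi_graph[of id "cfi_graph D b" D b] vc_iso_refl[of "cfi_graph D b"] by simp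
    then show "Q \<in> ?A // ?R" unfolding D(2) by (rule quotientI)
  qed
  moreover have "card (?f ` (Pow arcs4 \<times> UNIV)) = card (map_prod relabelings id ` (Pow arcs4 \<times> (UNIV :: bool set)))"
  proof (rule card_image_same_kernel)
    fix x y assume "x \<in> Pow arcs4 \<times> (UNIV :: bool set)" "y \<in> Pow arcs4 \<times> (UNIV :: bool set)"
    then obtain D b D' b' where xy: "x = (D, b)" "y = (D', b')" "D \<subseteq> arcs4" "D' \<subseteq> arcs4" by auto
    have "(cfi_graph D' b', cfi_graph D' b') \<in> ?R" using iso_renaming_cfi_graph_iff[OF xy(4,4)] relabelings_self by blast
    then have "?R `` {cfi_graph D b} = ?R `` {cfi_graph D' b'} \<longleftrightarrow> (cfi_graph D b, cfi_graph D' b') \<in> ?R"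
      using R by blast
    then show "?f x = ?f y \<longleftrightarrow> map_prod relabelings id x = map_prod relabelings id y"
      unfolding xy using iso_renaming_cfi_graph_iff[OF xy(3,4)] relabelings_eq_iff by auto
  qed
  moreover have "map_prod relabelings id ` (Pow arcs4 \<times> (UNIV :: bool set)) = (relabelings ` Pow arcs4) \<times> UNIV"
    by (simp add: map_prod_surj_on)
  ultimately show ?thesis using card_relabelings by (simp add: card_cartesian_product)
qed

text \<open>Both twists lie in one class, so the untwisted graph can represent it.\<close>

lemma ambiguous_wl2_class_iff:
  "K \<in> ambiguous_wl2_classes 16 4 \<longleftrightarrow> (\<exists>p D. bij p \<and> D \<subseteq> arcs4 \<and> K = wl2_rel `` {recolor p (cfi_graph D False)})"
proof
  assume "K \<in> ambiguous_wl2_classes 16 4"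
  then obtain G0 G H where K: "G0 \<in> vc_graphs 16 4" "K = wl2_rel `` {G0}" "G \<in> K" "H \<in> K" "\<not> vc_iso G H"
    unfolding ambiguous_wl2_classes_def by (auto elim!: quotientE)
  have G0: "is_vc_graph G0" "card (V G0) = 16" "color_multiplicity G0 = 4" using K(1) by (auto simp: vc_graphs_def)
  \<comment> \<open>Two nonisomorphic members cannot both be isomorphic to the representative
    \<open>G0\<close>, so the structure theorem applies to \<open>G0\<close> itself.\<close>
  have "\<not> vc_iso G0 G \<or> \<not> vc_iso G0 H" using K(5) vc_iso_sym vc_iso_trans by blast
  then obtain H0 :: "(nat, nat) vc_graph" where H0: "is_vc_graph H0" "wl2_equivalent G0 H0" "\<not> vc_iso G0 H0"
    using K(2-4) by (auto simp: wl2_rel_def)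
  obtain p D b where p: "bij p" "D \<subseteq> arcs4" "vc_iso (recolor p (cfi_graph D b)) G0"
    using wl2_equivalent_iso_or_cfi_graph[OF G0(1) H0(1,2) _ _ H0(3)] G0 by auto
  have fin: "finite (V G0)" by (rule is_vc_graph_finite[OF G0(1)])
  have "wl2_equivalent (recolor p (cfi_graph D b)) G0" by (rule vc_iso_wl2_equivalent) (use p fin in simp_all)
  then have "wl2_equivalent (recolor p (cfi_graph D False)) G0"
    using wl2_equivalent_trans[OF _ _ _ wl2_equivalent_cfi_graphs] fin by simp
  then have "(recolor p (cfi_graph D False), G0) \<in> wl2_rel" using G0 by (simp add: wl2_rel_def)
  from sym_trans_Image[OF sym_wl2_rel trans_wl2_rel this]
  show "\<exists>p D. bij p \<and> D \<subseteq> arcs4 \<and> K = wl2_rel `` {recolor p (cfi_graph D False)}" using p K(2) by blast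
next
  assume "\<exists>p D. bij p \<and> D \<subseteq> arcs4 \<and> K = wl2_rel `` {recolor p (cfi_graph D False)}"
  then obtain p D where p: "bij p" "D \<subseteq> arcs4" "K = wl2_rel `` {recolor p (cfi_graph D False)}" by blast
  have "recolor p (cfi_graph D False) \<in> vc_graphs 16 4" by (rule cfi_vc_graphs[OF cfi_recolor_cfi_graph[OF p(1,2)]])
  then have "K \<in> vc_graphs 16 4 // wl2_rel" unfolding p(3) by (rule quotientI)
  moreover have "recolor p (cfi_graph D b) \<in> K" for b
    using wl2_equivalent_cfi_graphs unfolding p(3) by (simp add: wl2_rel_def)
  moreover have "\<not> vc_iso (recolor p (cfi_graph D False)) (recolor p (cfi_graph D True))"
    using vc_iso_cfi_graph_twist[OF p(1,1)] by blast
  ultimately show "K \<in> ambiguous_wl2_classes 16 4" unfolding ambiguous_wl2_classes_def by blast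
qed

lemma card_ambiguous: "card (ambiguous_wl2_classes 16 4 // class_renaming_rel) = 218"
proof -
  let ?R = "class_renaming_rel :: (nat, nat) vc_graph set rel"
  let ?K = "\<lambda>D. wl2_rel `` {cfi_graph D False}"
  have R: "?R `` {K} = ?R `` {L}" if "(K, L) \<in> ?R" for K L
    using sym_trans_Image[OF sym_class_renaming_rel trans_class_renaming_rel that] .
  have KR: "(?K D, wl2_rel `` {recolor p (cfi_graph D False)}) \<in> ?R" if "bij p" for p D
    using recolor_wl2_class[OF that, of "cfi_graph D False"] that by (auto simp: class_renaming_rel_def)
  have "ambiguous_wl2_classes 16 4 // ?R = (\<lambda>D. ?R `` {?K D}) ` Pow arcs4"
  proof (intro subset_antisym subsetI)
    fix Q assume "Q \<in> ambiguous_wl2_classes 16 4 // ?R"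
    then obtain K where K: "K \<in> ambiguous_wl2_classes 16 4" "Q = ?R `` {K}" by (rule quotientE)
    then obtain p D where p: "bij p" "D \<subseteq> arcs4" "K = wl2_rel `` {recolor p (cfi_graph D False)}"
      unfolding ambiguous_wl2_class_iff by blast
    then have "Q = ?R `` {?K D}" using R[OF KR[OF p(1), of D]] K(2) by simp
    then show "Q \<in> (\<lambda>D. ?R `` {?K D}) ` Pow arcs4" using p(2) by blast
  next
    fix Q assume "Q \<in> (\<lambda>D. ?R `` {?K D}) ` Pow arcs4"
    then obtain D where D: "D \<subseteq> arcs4" "Q = ?R `` {?K D}" by blast
    have "?K D \<in> ambiguous_wl2_classes 16 4"
      unfolding ambiguous_wl2_class_iff by (intro exI[of _ id] exI[of _ D]) (simp add: D(1))
    then show "Q \<in> ambiguous_wl2_classes 16 4 // ?R" unfolding D(2) by (rule quotientI)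
  qed
  moreover have "card ((\<lambda>D. ?R `` {?K D}) ` Pow arcs4) = card (relabelings ` Pow arcs4)"
  proof (rule card_image_same_kernel)
    fix D D' assume "D \<in> Pow arcs4" "D' \<in> Pow arcs4"
    then have D: "D \<subseteq> arcs4" "D' \<subseteq> arcs4" by auto
    show "?R `` {?K D} = ?R `` {?K D'} \<longleftrightarrow> relabelings D = relabelings D'"
      unfolding relabelings_eq_iff
    proof
      assume "?R `` {?K D} = ?R `` {?K D'}"
      moreover have "(?K D', ?K D') \<in> ?R" using KR[of id D'] by simp
      ultimately have "(?K D, ?K D') \<in> ?R" by blast
      then obtain p where p: "bij p" "?K D' = recolor p ` ?K D" by (auto simp: class_renaming_rel_def)
      have "cfi_graph D' False \<in> ?K D'" using wl2_equivalent_cfi_graphs[of id D' False False] by (simp add: wl2_rel_def)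
      then have "wl2_equivalent (recolor p (cfi_graph D False)) (cfi_graph D' False)"
        unfolding p(2) recolor_wl2_class[OF p(1)] by (simp add: wl2_rel_def)
      then show "D' \<in> relabelings D" by (rule wl2_equivalent_cfi_graph[OF bij_is_inj[OF p(1)] D])
    next
      assume "D' \<in> relabelings D"
      then obtain p where p: "bij p" "vc_iso (recolor p (cfi_graph D False)) (cfi_graph D' False)"
        using relabel_vc_iso[OF D(1)] by blast
      have "wl2_equivalent (recolor p (cfi_graph D False)) (cfi_graph D' False)" by (rule vc_iso_wl2_equivalent) (use p in simp_all)
      then have "(recolor p (cfi_graph D False), cfi_graph D' False) \<in> wl2_rel" by (simp add: wl2_rel_def)
      from sym_trans_Image[OF sym_wl2_rel trans_wl2_rel this]
      show "?R `` {?K D} = ?R `` {?K D'}" using R[OF KR[OF p(1), of D]] by simp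
    qed
  qed
  ultimately show ?thesis using card_relabelings by simp
qed

lemma card_iso_types:
  assumes "K \<in> ambiguous_wl2_classes 16 4"
  shows "card (K // iso_rel) = 2"
proof -
  obtain p D where p: "bij p" "D \<subseteq> arcs4" "K = wl2_rel `` {recolor p (cfi_graph D False)}"
    using assms unfolding ambiguous_wl2_class_iff by blast
  let ?X = "\<lambda>b. recolor p (cfi_graph D b)"
  have "K // iso_rel = (\<lambda>b. iso_rel `` {?X b}) ` UNIV"
  proof (intro subset_antisym subsetI)
    fix Q assume "Q \<in> K // iso_rel"
    then obtain H where H: "H \<in> K" "Q = iso_rel `` {H}" by (rule quotientE)
    then have "is_vc_graph H" "wl2_equivalent (?X False) H" unfolding p(3) by (auto simp: wl2_rel_def)
    then obtain b where "vc_iso (?X b) H" using wl2_class_cfi_graph[OF p(1,2)] by blast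
    then have "(?X b, H) \<in> iso_rel" using \<open>is_vc_graph H\<close> by (simp add: iso_rel_def)
    then show "Q \<in> (\<lambda>b. iso_rel `` {?X b}) ` UNIV"
      using sym_trans_Image[OF sym_iso_rel trans_iso_rel] H(2) by blast
  next
    fix Q assume "Q \<in> (\<lambda>b. iso_rel `` {?X b}) ` UNIV"
    then obtain b where "Q = iso_rel `` {?X b}" by blast
    moreover have "?X b \<in> K" using wl2_equivalent_cfi_graphs unfolding p(3) by (simp add: wl2_rel_def)
    ultimately show "Q \<in> K // iso_rel" by (simp add: quotientI)
  qed
  moreover have "iso_rel `` {?X False} \<noteq> iso_rel `` {?X True}"
  proof
    assume "iso_rel `` {?X False} = iso_rel `` {?X True}"
    moreover have "?X True \<in> iso_rel `` {?X True}" using vc_iso_refl[of "?X True"] by (simp add: iso_rel_def)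
    ultimately have "(?X False, ?X True) \<in> iso_rel" by blast
    then have "vc_iso (?X False) (?X True)" by (simp add: iso_rel_def)
    then show False using vc_iso_cfi_graph_twist[OF p(1,1)] by blast
  qed
  ultimately show ?thesis by (simp add: UNIV_bool)
qed

theorem theorem12p1:
  shows "(\<forall>G :: ('a, 'c) vc_graph.
            is_vc_graph G \<and> color_multiplicity G = 4 \<and> card (V G) \<le> 15 \<longrightarrow> wl2_amenable G)
       \<and> card ({G \<in> vc_graphs 16 4. \<not> wl2_amenable G} // iso_renaming_rel) = 436
       \<and> card (ambiguous_wl2_classes 16 4 // class_renaming_rel) = 218
       \<and> (\<forall>K \<in> ambiguous_wl2_classes 16 4. card (K // iso_rel) = 2)"
  using small_wl2_amenable card_not_amenable card_ambiguous card_iso_types by blast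

end
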